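(* There is an efficient randomized algorithm that, given any positive integers $D,n,k$ and an $n$-vertex $k$-edge-connected graph $G$ of diameter at most $D$, computes a collection $\mathcal{T}'=\{T'_1,\ldots,T'_{\lfloor k/2\rfloor}\}$ of $\lfloor k/2\rfloor$ spanning trees of $G$, such that each edge of $G$ appears in at most two of the trees in $\mathcal{T}'$, and, with high probability, each tree $T'_i\in\mathcal{T}'$ has diameter $O((101k\ln n)^{D})$.
   Context: Graphs are finite, undirected, unweighted, without loops; parallel edges are allowed. The diameter of a graph is the maximum, over pairs of vertices, of the length (number of edges) of a shortest path between them. "Efficient" means running time polynomial in the input size. "With high probability" means with probability at least $1-1/\mathrm{poly}(n)$. A graph is $k$-edge-connected if it remains connected after deletion of any set of at most $k-1$ edges. *)

theory Defs
  imports "HOL-Probability.Probability" "HOL-Computational_Algebra.Polynomial"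
    "HOL-Library.Log_Nat"
begin

section \<open>Undirected multigraphs\<close>

text \<open>Edges are named, so parallel edges are distinct names with the same set of endpoints.\<close>

record ('v, 'e) multigraph =
  verts :: "'v set"
  edges :: "'e set"
  ends :: "'e \<Rightarrow> 'v set"

definition wf_multigraph :: "('v, 'e) multigraph \<Rightarrow> bool" where
  "wf_multigraph G \<longleftrightarrow> finite (verts G) \<and> finite (edges G) \<and>
     (\<forall>e\<in>edges G. ends G e \<subseteq> verts G \<and> card (ends G e) = 2)"

definition is_walk :: "('v, 'e) multigraph \<Rightarrow> 'v list \<Rightarrow> 'e list \<Rightarrow> bool" where
  "is_walk G vs es \<longleftrightarrow> length vs = Suc (length es) \<and> set vs \<subseteq> verts G \<and> set es \<subseteq> edges G \<and>
     (\<forall>i<length es. ends G (es ! i) = {vs ! i, vs ! Suc i})"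

definition is_path :: "('v, 'e) multigraph \<Rightarrow> 'v \<Rightarrow> 'v list \<Rightarrow> 'e list \<Rightarrow> 'v \<Rightarrow> bool" where
  "is_path G u vs es v \<longleftrightarrow> is_walk G vs es \<and> distinct vs \<and> hd vs = u \<and> last vs = v"

text \<open>Two parallel edges form a cycle of length two; \<^term>\<open>distinct es\<close> excludes traversing one edge
  back and forth.\<close>

definition is_cycle :: "('v, 'e) multigraph \<Rightarrow> 'v list \<Rightarrow> 'e list \<Rightarrow> bool" where
  "is_cycle G vs es \<longleftrightarrow> is_walk G vs es \<and> es \<noteq> [] \<and> hd vs = last vs \<and> distinct (tl vs) \<and> distinct es"

definition connected_graph :: "('v, 'e) multigraph \<Rightarrow> bool" where
  "connected_graph G \<longleftrightarrow> verts G \<noteq> {} \<and>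
     (\<forall>u\<in>verts G. \<forall>v\<in>verts G. \<exists>vs es. is_path G u vs es v)"

definition edge_connected :: "nat \<Rightarrow> ('v, 'e) multigraph \<Rightarrow> bool" where
  "edge_connected k G \<longleftrightarrow>
     (\<forall>F\<subseteq>edges G. card F \<le> k - 1 \<longrightarrow> connected_graph (G\<lparr>edges := edges G - F\<rparr>))"

text \<open>Distance and diameter are meaningful for finite connected graphs only.\<close>

definition graph_dist :: "('v, 'e) multigraph \<Rightarrow> 'v \<Rightarrow> 'v \<Rightarrow> nat" where
  "graph_dist G u v = (LEAST l. \<exists>vs es. is_path G u vs es v \<and> length es = l)"

definition graph_diameter :: "('v, 'e) multigraph \<Rightarrow> nat" where
  "graph_diameter G = Max {graph_dist G u v |u v. u \<in> verts G \<and> v \<in> verts G}"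

abbreviation spanning_subgraph :: "('v, 'e) multigraph \<Rightarrow> 'e set \<Rightarrow> ('v, 'e) multigraph" where
  "spanning_subgraph G F \<equiv> G\<lparr>edges := F\<rparr>"

definition spanning_tree :: "('v, 'e) multigraph \<Rightarrow> 'e set \<Rightarrow> bool" where
  "spanning_tree G F \<longleftrightarrow> F \<subseteq> edges G \<and> connected_graph (spanning_subgraph G F) \<and>
     (\<nexists>vs es. is_cycle (spanning_subgraph G F) vs es)"


section \<open>Randomized algorithms\<close>

text \<open>
  The machine model is a structured random access machine with named, zero-initialized arrays of
  natural numbers; a scalar is cell 0 of an array. Its only arithmetic is addition and truncated
  subtraction, and its only source of randomness is the fair coin. The expressions occurring in a
  fixed program have bounded size, so each step performs boundedly many elementary operations, and
  numbers get longer by at most boundedly many bits per step. Hence unit-cost polynomial time in this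
  model coincides with polynomial time on (probabilistic) Turing machines; unit-cost multiplication
  would destroy this and is therefore absent.
\<close>

type_synonym state = "string \<Rightarrow> nat \<Rightarrow> nat"

datatype aexp = Num nat | Cell string aexp | Plus aexp aexp | Minus aexp aexp

datatype bexp = Less aexp aexp | Not bexp | And bexp bexp

datatype com =
    SKIP
  | Store string aexp aexp
  | Flip string aexp
  | Seq com com
  | If bexp com com
  | While bexp com

primrec aval :: "aexp \<Rightarrow> state \<Rightarrow> nat" where
  "aval (Num a) s = a"
| "aval (Cell x a) s = s x (aval a s)"
| "aval (Plus a b) s = aval a s + aval b s"
| "aval (Minus a b) s = aval a s - aval b s"

primrec bval :: "bexp \<Rightarrow> state \<Rightarrow> bool" where
  "bval (Less a b) s \<longleftrightarrow> aval a s < aval b s"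
| "bval (Not b) s \<longleftrightarrow> \<not> bval b s"
| "bval (And b b') s \<longleftrightarrow> bval b s \<and> bval b' s"

definition update :: "state \<Rightarrow> string \<Rightarrow> nat \<Rightarrow> nat \<Rightarrow> state" where
  "update s x i a = s(x := (s x)(i := a))"

text \<open>Small-step semantics; \<^term>\<open>SKIP\<close> is the halted program. \<open>Store x a b\<close> is the assignment
  \<open>x[a] := b\<close>, and \<open>Flip x a\<close> writes a fresh uniformly random bit to \<open>x[a]\<close>.\<close>

primrec step :: "com \<Rightarrow> state \<Rightarrow> (com \<times> state) pmf" where
  "step SKIP s = return_pmf (SKIP, s)"
| "step (Store x a b) s = return_pmf (SKIP, update s x (aval a s) (aval b s))"
| "step (Flip x a) s =
     map_pmf (\<lambda>r. (SKIP, update s x (aval a s) (if r then 1 else 0))) (bernoulli_pmf (1/2))"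
| "step (Seq p q) s =
     (if p = SKIP then return_pmf (q, s) else map_pmf (\<lambda>(p', s'). (Seq p' q, s')) (step p s))"
| "step (If b p q) s = return_pmf (if bval b s then p else q, s)"
| "step (While b p) s = return_pmf (if bval b s then Seq p (While b p) else SKIP, s)"

primrec run :: "nat \<Rightarrow> com \<Rightarrow> state \<Rightarrow> (com \<times> state) pmf" where
  "run 0 p s = return_pmf (p, s)"
| "run (Suc t) p s = bind_pmf (step p s) (\<lambda>(p', s'). run t p' s')"


section \<open>Input and output encoding\<close>

text \<open>An \<open>n\<close>-vertex graph is given by its edge list: the vertices are \<open>0, \<dots>, n - 1\<close>, and the
  edge named \<open>e\<close> joins the two components of the \<open>e\<close>-th entry.\<close>

definition graph_of :: "nat \<Rightarrow> (nat \<times> nat) list \<Rightarrow> (nat, nat) multigraph" where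
  "graph_of n es = \<lparr>verts = {..<n}, edges = {..<length es},
     ends = (\<lambda>e. {fst (es ! e), snd (es ! e)})\<rparr>"

definition array :: "nat list \<Rightarrow> nat \<Rightarrow> nat" where
  "array xs i = (if i < length xs then xs ! i else 0)"

definition input_state :: "nat \<Rightarrow> nat \<Rightarrow> nat \<Rightarrow> (nat \<times> nat) list \<Rightarrow> state" where
  "input_state D n k es = (\<lambda>_ _. 0)(
     ''D'' := array [D], ''n'' := array [n], ''k'' := array [k], ''m'' := array [length es],
     ''fst'' := array (map fst es), ''snd'' := array (map snd es))"

text \<open>\<^term>\<open>floorlog 2 a\<close> is the length of the binary representation of \<open>a\<close>, except that it is
  0 for \<open>a = 0\<close>.\<close>

definition bit_length :: "nat \<Rightarrow> nat" where
  "bit_length a = max 1 (floorlog 2 a)"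

definition input_size :: "nat \<Rightarrow> nat \<Rightarrow> nat \<Rightarrow> (nat \<times> nat) list \<Rightarrow> nat" where
  "input_size D n k es = bit_length D + bit_length n + bit_length k + bit_length (length es) +
     (\<Sum>(u, v)\<leftarrow>es. bit_length u + bit_length v)"

text \<open>The output is the array \<open>T\<close>, which lists the \<open>n - 1\<close> edges of tree 0, then those of tree 1, and
  so on. For \<open>n = 1\<close> the trees have no edges and nothing is written; this matters because the
  one-vertex graph is \<open>k\<close>-edge-connected for every \<open>k\<close>, so that \<open>k\<close> is not bounded by a polynomial in
  the input size there.\<close>

definition output_tree :: "nat \<Rightarrow> state \<Rightarrow> nat \<Rightarrow> nat set" where
  "output_tree n s i = {s ''T'' (i * (n - 1) + j) |j. j < n - 1}"

end

theory Submission
  imports Defs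
begin

text \<open>
  The algorithm packs \<open>h = \<lfloor>k/2\<rfloor>\<close> edge-disjoint spanning trees \<open>T\<^sub>i\<close> by matroid-union augmentation,
  independently gives every edge a random label below the least power of two \<open>W \<ge> h\<close> (so \<open>W \<le> k\<close>), and
  outputs a breadth-first search tree of \<open>T\<^sub>i \<union> E\<^sub>i\<close>, where \<open>E\<^sub>i\<close> are the edges labelled \<open>i\<close>. Every edge
  lies in at most one \<open>T\<^sub>i\<close> and one \<open>E\<^sub>i\<close>.

  Packing. Every forest edge on the cycle closed by \<open>x\<close> can be exchanged for \<open>x\<close>; level 0 are the
  uncovered edges and level \<open>r + 1\<close> are the edges exchangeable for an edge of level \<open>r\<close>. Adding to a
  forest an addable edge of minimal level \<open>t\<close> either covers a new edge (\<open>t = 0\<close>) or makes an edge of level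
  at most \<open>t - 1\<close> addable, so no augmenting path has to be traced. If nothing is addable, the labelled
  edges have components \<open>P\<close> in which every forest is connected; the other edges are covered and number
  at most \<open>h (|P| - 1)\<close>, but \<open>k\<close>-edge-connectivity gives at least \<open>k |P| / 2\<close> of them unless \<open>|P| = 1\<close>.

  Diameter. Fix a shortest path tree of \<open>G\<close> from a root. Reveal the labels of the parent edges level by
  level, the deepest level first. If every vertex reaches some level \<open>\<le> j\<close> within distance \<open>\<rho>\<close>, then it
  reaches a level \<open>< j\<close> or \<open>l\<close> different vertices of level \<open>j\<close> within distance \<open>l (2 \<rho> + 1) + \<rho>\<close>,
  since the tree \<open>T\<^sub>i\<close> provides vertices at distances \<open>0, 2 \<rho> + 1, 2 (2 \<rho> + 1), \<dots>\<close>. The parent edges of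
  these vertices are unrevealed, and for \<open>l \<ge> 4 k ln n\<close> one of them has label \<open>i\<close> except with
  probability \<open>n\<^sup>-\<^sup>4\<close>. Hence \<open>\<rho>\<close> grows by a factor of at most \<open>2 l + 1\<close> per level.
\<close>

section \<open>Programs with time bounds\<close>

text \<open>Only the diameter bound is probabilistic: spanning and congestion hold for every
  outcome. The packing is finished before the first coin flip, so the trees are fixed sets when the
  labels are drawn. Revealing the deepest level first yields the independence: which vertices of
  level \<open>j\<close> are reachable depends on labels of deeper parent edges only. The label
  range is a power of two because boundedly many fair coins cannot produce an exactly uniform value
  for any other range; edges with a label of \<open>h\<close> or more enter no \<open>E_i\<close>.
  The failure probability \<open>n^-4\<close> is summed over levels, start vertices and trees, at
  most \<open>n\<close> of each, which leaves \<open>1/n\<close>. Counting \<open>min D n\<close>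
  levels takes care of large \<open>D\<close>. If \<open>k \<ge> n\<close>, there may be more than
  \<open>n\<close> trees, but then even a tree of diameter \<open>2 n\<close> is within the bound.
  Polynomial time rests on \<open>k \<le> m\<close> and \<open>n \<le> 2 m\<close>, both
  consequences of connectivity for \<open>n \<ge> 2\<close>; for \<open>n = 1\<close> the number
  \<open>k\<close> is unbounded and the program halts at once.\<close>

definition yields :: "com \<Rightarrow> state \<Rightarrow> nat \<Rightarrow> state pmf \<Rightarrow> bool" where
  "yields p s t d \<longleftrightarrow> run t p s = map_pmf (Pair SKIP) d"

lemma run_SKIP [simp]: "run t SKIP s = return_pmf (SKIP, s)"
  by (induction t) (auto simp: bind_return_pmf)

lemma run_add: "run (a + b) p s = bind_pmf (run a p s) (\<lambda>(p', s'). run b p' s')"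
  by (induction a arbitrary: p s)
    (auto simp: bind_return_pmf bind_assoc_pmf case_prod_beta intro!: bind_pmf_cong)

lemma yields_mono:
  assumes "yields p s t d" "t \<le> t'"
  shows "yields p s t' d"
proof -
  obtain x where "t' = t + x" using assms(2) le_Suc_ex by blast
  then show ?thesis
    using assms(1) by (simp add: yields_def run_add bind_map_pmf flip: map_pmf_def)
qed

lemma yields_SKIP: "yields SKIP s t (return_pmf s)"
  by (simp add: yields_def)

text \<open>Induction on \<open>t1\<close>, conditioning on the first step of \<open>p\<close>. The
  additional step is the one in which \<open>Seq\<close> discards its finished first part. One bound
  \<open>t2\<close> serves all intermediate states, because runs of a fixed length are
  compared.\<close>

lemma yields_Seq:
  assumes "yields p s t1 d" "\<And>s'. s' \<in> set_pmf d \<Longrightarrow> yields q s' t2 (e s')"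
  shows "yields (Seq p q) s (Suc (t1 + t2)) (bind_pmf d e)"
  using assms
proof (induction t1 arbitrary: p s d)
  case 0
  then have "set_pmf (return_pmf (p, s)) = set_pmf (map_pmf (Pair SKIP) d)"
    by (simp add: yields_def)
  then have p: "p = SKIP" and "set_pmf d \<subseteq> {s}" by auto
  then have d: "d = return_pmf s" by (simp add: set_pmf_subset_singleton)
  show ?case
    using 0(2)[of s] p d by (simp add: yields_def bind_return_pmf)
next
  case (Suc t1)
  show ?case
  proof (cases "p = SKIP")
    case True
    then have "set_pmf (return_pmf (p, s)) = set_pmf (map_pmf (Pair SKIP) d)"
      using Suc.prems(1) by (simp add: yields_def bind_return_pmf)
    then have "set_pmf d \<subseteq> {s}" by auto
    then have d: "d = return_pmf s" by (simp add: set_pmf_subset_singleton)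
    then have "yields q s (Suc (t1 + t2)) (e s)"
      using Suc.prems(2)[of s] by (auto intro: yields_mono)
    then show ?thesis
      using True d by (simp add: yields_def bind_return_pmf)
  next
    case False
    \<comment> \<open>The distribution of the state after the remaining \<open>t1\<close> steps,
      given the outcome of the first; \<open>d\<close> is the mixture of these.\<close>
    define d' where "d' = (\<lambda>(p', s'). map_pmf snd (run t1 p' s'))"
    have d: "d = bind_pmf (step p s) d'"
    proof -
      have "d = map_pmf snd (map_pmf (Pair SKIP) d)"
        by (simp add: map_pmf_comp)
      also have "\<dots> = map_pmf snd (run (Suc t1) p s)"
        using Suc.prems(1) by (simp add: yields_def)
      also have "\<dots> = bind_pmf (step p s) d'"
        by (auto simp: d'_def map_bind_pmf case_prod_beta intro!: bind_pmf_cong)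
      finally show ?thesis .
    qed
    \<comment> \<open>The whole run ends in \<open>SKIP\<close> with certainty, hence so does its
      remainder after any possible first step.\<close>
    have *: "yields p' s' t1 (d' (p', s'))" if "(p', s') \<in> set_pmf (step p s)" for p' s'
    proof -
      have "set_pmf (run t1 p' s') \<subseteq> set_pmf (run (Suc t1) p s)"
        using that by force
      also have "\<dots> = set_pmf (map_pmf (Pair SKIP) d)"
        using Suc.prems(1) by (simp only: yields_def)
      finally have "\<forall>x\<in>set_pmf (run t1 p' s'). fst x = SKIP" by auto
      then have "map_pmf (Pair SKIP) (map_pmf snd (run t1 p' s')) = run t1 p' s'"
        unfolding map_pmf_comp by (intro map_pmf_idI) (metis prod.collapse)
      then show ?thesis by (simp add: yields_def d'_def)
    qed
    have **: "yields (Seq p' q) s' (Suc (t1 + t2)) (bind_pmf (d' (p', s')) e)"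
      if "(p', s') \<in> set_pmf (step p s)" for p' s'
      using Suc.IH[OF *[OF that]] Suc.prems(2) that unfolding d by (simp, blast)
    have "run (Suc (Suc (t1 + t2))) (Seq p q) s =
        bind_pmf (step p s) (\<lambda>(p', s'). run (Suc (t1 + t2)) (Seq p' q) s')"
      using False by (subst run.simps(2)) (simp add: bind_map_pmf case_prod_unfold del: run.simps)
    also have "\<dots> = bind_pmf (step p s) (\<lambda>x. map_pmf (Pair SKIP) (bind_pmf (d' x) e))"
      using ** by (intro bind_pmf_cong refl) (auto simp: yields_def simp del: run.simps)
    also have "\<dots> = map_pmf (Pair SKIP) (bind_pmf d e)"
      by (simp add: d map_bind_pmf bind_assoc_pmf)
    finally show ?thesis by (simp add: yields_def)
  qed
qed

lemma yields_While:
  assumes "bval b s" "yields (Seq p (While b p)) s t d"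
  shows "yields (While b p) s (Suc t) d"
  using assms by (simp add: yields_def bind_return_pmf)

lemma yields_Flip:
  "yields (Flip x a) s (Suc t)
     (map_pmf (\<lambda>r. update s x (aval a s) (if r then 1 else 0)) (bernoulli_pmf (1/2)))"
  by (simp add: yields_def bind_map_pmf case_prod_beta map_pmf_comp) (simp add: map_pmf_def)

text \<open>The result is a point mass, so this is a logic for deterministic code with a step bound;
  the random part, \<open>sample\<close>, is treated with \<open>yields\<close> directly.\<close>

definition wp :: "com \<Rightarrow> nat \<Rightarrow> (state \<Rightarrow> bool) \<Rightarrow> state \<Rightarrow> bool" where
  "wp p t Q s \<longleftrightarrow> (\<exists>s'. yields p s t (return_pmf s') \<and> Q s')"

lemma wp_mono:
  assumes "wp p t Q s" "t \<le> t'" "\<And>s'. Q s' \<Longrightarrow> Q' s'"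
  shows "wp p t' Q' s"
  using assms unfolding wp_def by (blast intro: yields_mono)

lemma wp_SKIP: "Q s \<Longrightarrow> wp SKIP t Q s"
  unfolding wp_def using yields_SKIP by blast

lemma wp_Store: "Q (update s x (aval a s) (aval b s)) \<Longrightarrow> wp (Store x a b) (Suc t) Q s"
  by (auto simp: wp_def yields_def bind_return_pmf)

lemma wp_Seq:
  assumes "wp p t1 (wp q t2 Q) s"
  shows "wp (Seq p q) (Suc (t1 + t2)) Q s"
proof -
  obtain s' s'' where "yields p s t1 (return_pmf s')" "yields q s' t2 (return_pmf s'')" "Q s''"
    using assms by (auto simp: wp_def)
  then show ?thesis
    using yields_Seq[of p s t1 "return_pmf s'" q t2 "\<lambda>_. return_pmf s''"]
    by (auto simp: wp_def bind_return_pmf)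
qed

lemma wp_If:
  assumes "bval b s \<Longrightarrow> wp p t Q s" "\<not> bval b s \<Longrightarrow> wp q t Q s"
  shows "wp (If b p q) (Suc t) Q s"
  using assms by (cases "bval b s") (auto simp: wp_def yields_def bind_return_pmf)

text \<open>The two extra steps unfold the loop and remove the finished body from
  \<open>Seq\<close>.\<close>

lemma wp_While_True:
  assumes "bval b s" "wp p t1 (wp (While b p) t2 Q) s"
  shows "wp (While b p) (Suc (Suc (t1 + t2))) Q s"
  using wp_Seq[OF assms(2)] assms(1) yields_While unfolding wp_def by blast

lemma wp_While_False:
  assumes "\<not> bval b s" "Q s"
  shows "wp (While b p) (Suc t) Q s"
  using assms by (auto simp: wp_def yields_def bind_return_pmf)

section \<open>Loop-free deterministic code, run by evaluation\<close>

primrec straight :: "com \<Rightarrow> bool" where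
  "straight SKIP = True"
| "straight (Store x a b) = True"
| "straight (Flip x a) = False"
| "straight (Seq p q) \<longleftrightarrow> straight p \<and> straight q"
| "straight (If b p q) \<longleftrightarrow> straight p \<and> straight q"
| "straight (While b p) = False"

text \<open>The equations for \<open>Flip\<close> and \<open>While\<close> are placeholders; the
  function describes execution under \<open>straight\<close> only.\<close>

primrec exec :: "com \<Rightarrow> state \<Rightarrow> state" where
  "exec SKIP s = s"
| "exec (Store x a b) s = update s x (aval a s) (aval b s)"
| "exec (Flip x a) s = s"
| "exec (Seq p q) s = exec q (exec p s)"
| "exec (If b p q) s = (if bval b s then exec p s else exec q s)"
| "exec (While b p) s = s"

primrec cost :: "com \<Rightarrow> nat" where
  "cost SKIP = 0"
| "cost (Store x a b) = 1"
| "cost (Flip x a) = 1"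
| "cost (Seq p q) = Suc (cost p + cost q)"
| "cost (If b p q) = Suc (max (cost p) (cost q))"
| "cost (While b p) = 0"

lemma wp_straight:
  assumes "straight p" "Q (exec p s)" "cost p \<le> t"
  shows "wp p t Q s"
proof -
  have "wp p (cost p) Q s"
    using assms(1,2)
  proof (induction p arbitrary: s Q)
    case SKIP then show ?case by (simp add: wp_SKIP)
  next
    case (Store x a b) then show ?case by (simp add: wp_Store)
  next
    case (Seq p q)
    show ?case unfolding cost.simps
      by (rule wp_Seq, rule Seq.IH(1)) (use Seq.prems in \<open>auto intro: Seq.IH(2)\<close>)
  next
    case (If b p q)
    show ?case unfolding cost.simps
    proof (rule wp_If)
      assume "bval b s"
      then have "wp p (cost p) Q s" using If by auto
      then show "wp p (max (cost p) (cost q)) Q s" by (rule wp_mono) auto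
    next
      assume "\<not> bval b s"
      then have "wp q (cost q) Q s" using If by auto
      then show "wp q (max (cost p) (cost q)) Q s" by (rule wp_mono) auto
    qed
  qed auto
  then show ?thesis using assms(3) by (rule wp_mono)
qed

abbreviation var :: "string \<Rightarrow> aexp" where
  "var x \<equiv> Cell x (Num 0)"

abbreviation assign :: "string \<Rightarrow> aexp \<Rightarrow> com" where
  "assign x a \<equiv> Store x (Num 0) a"

definition Eq :: "aexp \<Rightarrow> aexp \<Rightarrow> bexp" where
  "Eq a b = And (Not (Less a b)) (Not (Less b a))"

lemma bval_Eq [simp]: "bval (Eq a b) s \<longleftrightarrow> aval a s = aval b s"
  by (auto simp: Eq_def)

section \<open>Counting loops\<close>

definition For :: "string \<Rightarrow> aexp \<Rightarrow> com \<Rightarrow> com" where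
  "For x a p = Seq (assign x (Num 0)) (While (Less (var x) a) (Seq p (assign x (Plus (var x) (Num 1)))))"

text \<open>\<open>N\<close> is an upper bound on the number of iterations, not the number itself,
  so all times are functions of one \<open>N\<close>. Each round adds 4 steps to the body (loop
  unfolding, increment, two \<open>Seq\<close> removals); 3 steps pay for initialisation,
  \<open>Seq\<close> and the final test.\<close>

definition for_time :: "nat \<Rightarrow> nat \<Rightarrow> nat" where
  "for_time N t = 3 + N * (t + 4)"

lemma update_same [simp]: "update s x i a x = (s x)(i := a)"
  by (simp add: update_def)

lemma update_other [simp]: "y \<noteq> x \<Longrightarrow> update s x i a y = s y"
  by (simp add: update_def)

text \<open>Bound and invariant refer to the state after the increment: the bound is evaluated again
  in each test, and both may read the counter.\<close>

definition for_step :: "string \<Rightarrow> aexp \<Rightarrow> nat \<Rightarrow> (nat \<Rightarrow> state \<Rightarrow> bool) \<Rightarrow> nat \<Rightarrow> state \<Rightarrow> bool" where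
  "for_step x a K I i s \<longleftrightarrow> s x 0 = i \<and> aval a (update s x 0 (Suc i)) = K \<and> I (Suc i) (update s x 0 (Suc i))"

lemma wp_For:
  assumes init: "I 0 (update s x 0 0)" and K: "aval a (update s x 0 0) = K"
    and body: "\<And>i s. i < K \<Longrightarrow> s x 0 = i \<Longrightarrow> aval a s = K \<Longrightarrow> I i s \<Longrightarrow>
      wp p t (for_step x a K I i) s"
    and fin: "\<And>s. s x 0 = K \<Longrightarrow> I K s \<Longrightarrow> Q s"
    and T: "K \<le> N"
  shows "wp (For x a p) (for_time N t) Q s"
proof -
  let ?W = "While (Less (var x) a) (Seq p (assign x (Plus (var x) (Num 1))))"
  have W: "wp ?W (1 + j * (t + 4)) Q s"
    if "i + j = K" "s x 0 = i" "aval a s = K" "I i s" for i j s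
    using that
  proof (induction j arbitrary: i s)
    case 0
    then show ?case by (auto intro!: wp_While_False fin)
  next
    case (Suc j)
    have "wp ?W (Suc (Suc (Suc (t + 1) + (1 + j * (t + 4))))) Q s"
    proof (rule wp_While_True)
      show "bval (Less (var x) a) s" using Suc.prems by simp
      show "wp (Seq p (assign x (Plus (var x) (Num 1)))) (Suc (t + 1)) (wp ?W (1 + j * (t + 4)) Q) s"
      proof (rule wp_Seq, rule wp_mono[OF body])
        show "i < K" using Suc.prems by simp
        fix s' assume s': "for_step x a K I i s'"
        have "wp ?W (1 + j * (t + 4)) Q (update s' x 0 (Suc i))"
          by (rule Suc.IH[of "Suc i"]) (use s' Suc.prems in \<open>auto simp: for_step_def\<close>)
        then show "wp (assign x (Plus (var x) (Num 1))) 1 (wp ?W (1 + j * (t + 4)) Q) s'"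
          using s' unfolding One_nat_def by (intro wp_Store) (simp add: for_step_def)
      qed (use Suc.prems in auto)
    qed
    then show ?case by (rule wp_mono) auto
  qed
  have "wp (For x a p) (Suc (1 + (1 + K * (t + 4)))) Q s"
    unfolding For_def
  proof (rule wp_Seq)
    have "wp ?W (1 + K * (t + 4)) Q (update s x 0 0)"
      by (rule W[of 0]) (use init K in auto)
    then show "wp (assign x (Num 0)) 1 (wp ?W (1 + K * (t + 4)) Q) s"
      unfolding One_nat_def by (intro wp_Store) simp
  qed
  then show ?thesis by (rule wp_mono) (use T in \<open>auto simp: for_time_def intro: mult_le_mono\<close>)
qed

section \<open>Multigraphs and forests\<close>

definition adj :: "('e \<Rightarrow> 'v set) \<Rightarrow> 'e set \<Rightarrow> 'v \<Rightarrow> 'v \<Rightarrow> bool" where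
  "adj en A u v \<longleftrightarrow> (\<exists>e\<in>A. en e = {u, v})"

abbreviation conn :: "('e \<Rightarrow> 'v set) \<Rightarrow> 'e set \<Rightarrow> 'v \<Rightarrow> 'v \<Rightarrow> bool" where
  "conn en A \<equiv> (adj en A)\<^sup>*\<^sup>*"

text \<open>Acyclicity as "every edge is a bridge", which suits manipulations of edge sets;
  \<open>forest_acyclic\<close> translates it into the absence of cycles.\<close>

definition forest :: "('e \<Rightarrow> 'v set) \<Rightarrow> 'e set \<Rightarrow> bool" where
  "forest en A \<longleftrightarrow> (\<forall>e\<in>A. \<forall>u v. en e = {u, v} \<longrightarrow> \<not> conn en (A - {e}) u v)"

lemma adj_sym: "adj en A u v \<Longrightarrow> adj en A v u"
  by (auto simp: adj_def insert_commute)

lemma conn_sym: "conn en A u v \<Longrightarrow> conn en A v u"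
  by (metis adj_sym sympD sympI symp_rtranclp)

lemma adj_mono: "adj en A u v \<Longrightarrow> A \<subseteq> B \<Longrightarrow> adj en B u v"
  by (auto simp: adj_def)

lemma conn_mono: "conn en A u v \<Longrightarrow> A \<subseteq> B \<Longrightarrow> conn en B u v"
  by (metis adj_mono mono_rtranclp)

lemma relpowp_adj_mono: "(adj en A ^^ i) u v \<Longrightarrow> A \<subseteq> B \<Longrightarrow> (adj en B ^^ i) u v"
proof (induction i arbitrary: v)
  case (Suc i)
  then show ?case by (auto elim!: relpowp_Suc_E intro!: relpowp_Suc_I adj_mono)
qed simp

lemma relpowp_adj_sym: "(adj en A ^^ i) u v \<Longrightarrow> (adj en A ^^ i) v u"
proof (induction i arbitrary: v)
  case (Suc i)
  then show ?case by (metis adj_sym relpowp_Suc_E relpowp_Suc_I2)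
qed simp

lemma conn_edge: "e \<in> A \<Longrightarrow> en e = {u, v} \<Longrightarrow> conn en A u v"
  by (intro r_into_rtranclp) (auto simp: adj_def)

text \<open>Reduces a walk to one that uses \<open>e\<close> at most once.\<close>

lemma conn_insert:
  assumes "conn en (insert e A) x y" "en e = {a, b}"
  shows "conn en A x y \<or> conn en A x a \<and> conn en A b y \<or> conn en A x b \<and> conn en A a y"
  using assms(1)
proof (induction rule: rtranclp_induct)
  case (step y z)
  show ?case
  proof (cases "adj en A y z")
    case True
    then show ?thesis using step.IH by (meson rtranclp.rtrancl_into_rtrancl)
  next
    case False
    then have "{y, z} = {a, b}" using step.hyps(2) assms(2) by (auto simp: adj_def)
    then have "y = a \<and> z = b \<or> y = b \<and> z = a" by (auto simp: doubleton_eq_iff)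
    then show ?thesis using step.IH by (meson conn_sym rtranclp.rtrancl_refl rtranclp_trans)
  qed
qed simp

lemma forest_mono: "forest en A \<Longrightarrow> B \<subseteq> A \<Longrightarrow> forest en B"
  unfolding forest_def by (meson Diff_mono conn_mono order_refl subsetD)

text \<open>If an old edge \<open>f\<close> stopped being a bridge, the detour around it would use
  \<open>e\<close>; closing the detour with \<open>f\<close> would join \<open>a\<close> and
  \<open>b\<close> inside \<open>A\<close>.\<close>

lemma forest_insert:
  assumes "forest en A" "en e = {a, b}" "\<not> conn en A a b"
  shows "forest en (insert e A)"
  unfolding forest_def
proof (intro ballI allI impI notI)
  fix f u v assume f: "f \<in> insert e A" "en f = {u, v}" and c: "conn en (insert e A - {f}) u v"
  show False
  proof (cases "f = e")
    case True
    then have "conn en A u v" using c by (auto elim: conn_mono)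
    moreover have "u = a \<and> v = b \<or> u = b \<and> v = a"
      using True f assms(2) by (auto simp: doubleton_eq_iff)
    ultimately show False using assms(3) conn_sym by metis
  next
    case False
    then have fA: "f \<in> A" using f by auto
    have "insert e A - {f} = insert e (A - {f})" using False by auto
    then have "conn en (A - {f}) u a \<and> conn en (A - {f}) b v \<or> conn en (A - {f}) u b \<and> conn en (A - {f}) a v"
      using conn_insert[of en e "A - {f}" u v a b] c assms(1,2) fA f by (auto simp: forest_def)
    then have "conn en A u a \<and> conn en A b v \<or> conn en A u b \<and> conn en A a v"
      by (meson Diff_subset conn_mono)
    then show False using conn_edge[of f A en u v, OF fA f(2)] assms(3) by (meson conn_sym rtranclp_trans)
  qed
qed

text \<open>A detour replacing \<open>y\<close> would have to cross \<open>e\<close>, with one end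
  of \<open>e\<close> reachable from \<open>p\<close> and the other from \<open>q\<close> in
  \<open>A\<close>. As \<open>p\<close> and \<open>q\<close> are joined in \<open>A\<close>, so
  would be the ends of \<open>e\<close>.\<close>

lemma conn_exchange:
  assumes "en e = {a, b}" "\<not> conn en A a b" "conn en A p q" "\<not> conn en (A - {y}) p q" "y \<in> A"
  shows "\<not> conn en (insert e A - {y}) p q"
proof
  assume c: "conn en (insert e A - {y}) p q"
  have "e \<noteq> y" using assms conn_edge by metis
  then have "insert e A - {y} = insert e (A - {y})" by auto
  then have "conn en (A - {y}) p a \<and> conn en (A - {y}) b q \<or> conn en (A - {y}) p b \<and> conn en (A - {y}) a q"
    using conn_insert[of en e "A - {y}" p q a b] c assms by auto
  then have "conn en A p a \<and> conn en A b q \<or> conn en A p b \<and> conn en A a q"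
    by (meson Diff_subset conn_mono)
  then show False using assms(2,3) by (meson conn_sym rtranclp_trans)
qed

section \<open>Paths, distances and diameter as iterated adjacency\<close>

lemma is_path_relpowp:
  assumes "is_path G u vs es v"
  shows "(adj (ends G) (edges G) ^^ length es) u v"
proof -
  have w: "is_walk G vs es" "hd vs = u" "last vs = v" using assms by (auto simp: is_path_def)
  then have len: "length vs = Suc (length es)" by (simp add: is_walk_def)
  have "(adj (ends G) (edges G) ^^ j) (vs ! 0) (vs ! j)" if "j \<le> length es" for j
    using that
  proof (induction j)
    case (Suc j)
    then have "adj (ends G) (edges G) (vs ! j) (vs ! Suc j)"
      using w(1) unfolding is_walk_def adj_def by (meson Suc_le_eq nth_mem subsetD)
    then show ?case using Suc by (auto intro: relpowp_Suc_I)
  qed simp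
  moreover have "vs ! 0 = u" "vs ! length es = v"
    using w len by (metis hd_conv_nth length_0_conv nat.distinct(1), metis diff_Suc_1 last_conv_nth length_0_conv nat.distinct(1))
  ultimately show ?thesis by auto
qed

lemma relpowp_is_path:
  assumes "(adj (ends G) (edges G) ^^ i) u v" "u \<in> verts G"
    and wf: "\<And>e. e \<in> edges G \<Longrightarrow> ends G e \<subseteq> verts G"
  shows "\<exists>vs es. is_path G u vs es v \<and> length es \<le> i"
  using assms(1)
proof (induction i arbitrary: v)
  case 0
  then have "is_path G u [u] [] v" using assms(2) by (simp add: is_path_def is_walk_def)
  then show ?case by fastforce
next
  case (Suc i)
  from Suc.prems obtain w where w: "(adj (ends G) (edges G) ^^ i) u w" "adj (ends G) (edges G) w v"
    by (auto elim: relpowp_Suc_E)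
  obtain vs es where p: "is_path G u vs es w" "length es \<le> i" using Suc.IH[OF w(1)] by auto
  then have len: "length vs = Suc (length es)" by (simp add: is_path_def is_walk_def)
  show ?case
  proof (cases "v \<in> set vs")
    \<comment> \<open>Cutting the path at its earlier visit to \<open>v\<close> keeps it simple and
      does not lengthen it.\<close>
    case True
    then obtain j where j: "j < length vs" "vs ! j = v" by (auto simp: in_set_conv_nth)
    have "is_path G u (take (Suc j) vs) (take j es) v"
      unfolding is_path_def
    proof (intro conjI)
      have "is_walk G vs es" "distinct vs" "hd vs = u" using p(1) by (auto simp: is_path_def)
      then show "is_walk G (take (Suc j) vs) (take j es)" "distinct (take (Suc j) vs)"
        "hd (take (Suc j) vs) = u"
        using j len set_take_subset[of "Suc j" vs] set_take_subset[of j es]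
        unfolding is_walk_def by auto
      show "last (take (Suc j) vs) = v" using j by (simp add: take_Suc_conv_app_nth)
    qed
    moreover have "length (take j es) \<le> Suc i" using p(2) by simp
    ultimately show ?thesis by blast
  next
    case False
    obtain e where e: "e \<in> edges G" "ends G e = {w, v}" using w(2) by (auto simp: adj_def)
    have lw: "vs ! length es = w" using p(1) len unfolding is_path_def
      by (metis diff_Suc_1 last_conv_nth length_0_conv nat.distinct(1))
    have "is_path G u (vs @ [v]) (es @ [e]) v"
      unfolding is_path_def
    proof (intro conjI)
      have q: "is_walk G vs es" "distinct vs" "hd vs = u" "vs \<noteq> []"
        using p(1) len by (auto simp: is_path_def)
      then show "distinct (vs @ [v])" "hd (vs @ [v]) = u" "last (vs @ [v]) = v"
        using False by auto
      show "is_walk G (vs @ [v]) (es @ [e])"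
        using q(1) e wf[OF e(1)] lw unfolding is_walk_def by (auto simp: nth_append less_Suc_eq)
    qed
    then show ?thesis using p(2) by (metis Suc_le_mono length_append_singleton)
  qed
qed

lemma finite_graph_dists:
  "finite (verts G) \<Longrightarrow> finite {graph_dist G u v |u v. u \<in> verts G \<and> v \<in> verts G}"
  by (rule finite_subset[of _ "(\<lambda>(u, v). graph_dist G u v) ` (verts G \<times> verts G)"]) auto

lemma graph_diameter_le:
  assumes "finite (verts G)" "verts G \<noteq> {}" "\<And>e. e \<in> edges G \<Longrightarrow> ends G e \<subseteq> verts G"
    and "\<And>u v. u \<in> verts G \<Longrightarrow> v \<in> verts G \<Longrightarrow> \<exists>i\<le>d. (adj (ends G) (edges G) ^^ i) u v"
  shows "graph_diameter G \<le> d"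
proof -
  have "graph_dist G u v \<le> d" if uv: "u \<in> verts G" "v \<in> verts G" for u v
  proof -
    obtain i where i: "i \<le> d" "(adj (ends G) (edges G) ^^ i) u v" using assms(4)[OF uv] by auto
    obtain vs es where "is_path G u vs es v" and es: "length es \<le> i"
      using relpowp_is_path[OF i(2) uv(1) assms(3)] by auto
    then have "graph_dist G u v \<le> length es" unfolding graph_dist_def
      by (intro Least_le) blast
    then show ?thesis using i es by simp
  qed
  then show ?thesis unfolding graph_diameter_def
    by (intro Max.boundedI finite_graph_dists assms(1)) (use assms(2) in blast, blast)
qed

lemma relpowp_le_graph_diameter:
  assumes "connected_graph G" "finite (verts G)" "u \<in> verts G" "v \<in> verts G"
  shows "\<exists>i\<le>graph_diameter G. (adj (ends G) (edges G) ^^ i) u v"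
proof -
  have "\<exists>l vs es. is_path G u vs es v \<and> length es = l"
    using assms unfolding connected_graph_def by blast
  then obtain vs es where "is_path G u vs es v" "length es = graph_dist G u v"
    using LeastI_ex[of "\<lambda>l. \<exists>vs es. is_path G u vs es v \<and> length es = l"] unfolding graph_dist_def by blast
  moreover have "graph_dist G u v \<le> graph_diameter G"
    unfolding graph_diameter_def using assms by (intro Max_ge finite_graph_dists) auto
  ultimately show ?thesis using is_path_relpowp by metis
qed

lemma connected_graph_conn:
  "connected_graph G \<Longrightarrow> u \<in> verts G \<Longrightarrow> v \<in> verts G \<Longrightarrow> conn (ends G) (edges G) u v"
  unfolding connected_graph_def by (metis is_path_relpowp relpowp_imp_rtranclp)

lemma conn_connected_graph:
  assumes "verts G \<noteq> {}" "\<And>e. e \<in> edges G \<Longrightarrow> ends G e \<subseteq> verts G"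
    "\<And>u v. u \<in> verts G \<Longrightarrow> v \<in> verts G \<Longrightarrow> conn (ends G) (edges G) u v"
  shows "connected_graph G"
  unfolding connected_graph_def
proof (intro conjI ballI assms(1))
  fix u v assume uv: "u \<in> verts G" "v \<in> verts G"
  then obtain i where "(adj (ends G) (edges G) ^^ i) u v" using assms(3) rtranclp_imp_relpowp by metis
  then show "\<exists>vs es. is_path G u vs es v"
    using relpowp_is_path[OF _ uv(1) assms(2)] by metis
qed

text \<open>A simple path visits distinct vertices of \<open>V\<close>, so it has fewer than
  \<open>card V\<close> edges.\<close>

lemma conn_relpowp_less:
  assumes "conn en A u v" "u \<in> V" "finite V" "\<And>e. e \<in> A \<Longrightarrow> en e \<subseteq> V"
  shows "\<exists>i<card V. (adj en A ^^ i) u v"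
proof -
  let ?G = "\<lparr>verts = V, edges = A, ends = en\<rparr>"
  obtain i where "(adj en A ^^ i) u v" using assms(1) rtranclp_imp_relpowp by metis
  then obtain vs es where p: "is_path ?G u vs es v"
    using relpowp_is_path[of i ?G u v] assms by auto
  then have "distinct vs" "set vs \<subseteq> V" "length vs = Suc (length es)"
    by (auto simp: is_path_def is_walk_def)
  then have "Suc (length es) \<le> card V" using assms(3) by (metis card_mono distinct_card)
  then show ?thesis using is_path_relpowp[OF p] by (intro exI[of _ "length es"]) auto
qed

text \<open>The rest of a cycle joins the ends of its first edge, and \<open>distinct es\<close>
  keeps that walk off the edge itself.\<close>

lemma forest_acyclic:
  assumes "forest (ends G) (edges G)"
  shows "\<not> is_cycle G vs es"
proof
  assume c: "is_cycle G vs es"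
  then obtain e es' where es: "es = e # es'" by (cases es) (auto simp: is_cycle_def)
  from c have w: "is_walk G vs es" "distinct es" "hd vs = last vs" by (auto simp: is_cycle_def)
  have len: "length vs = Suc (Suc (length es'))" using w(1) es by (simp add: is_walk_def)
  have "conn (ends G) (edges G - {e}) (vs ! 1) (vs ! Suc j)" if "j \<le> length es'" for j
    using that
  proof (induction j)
    case (Suc j)
    have "ends G (es ! Suc j) = {vs ! Suc j, vs ! Suc (Suc j)}" "es ! Suc j \<in> edges G"
      using w(1) Suc.prems es unfolding is_walk_def by (metis Suc_le_eq length_Cons not_less_eq, metis Suc_le_eq length_Cons nth_mem Suc_less_eq subsetD)
    moreover have "es ! Suc j \<noteq> e" using w(2) Suc.prems es by auto
    ultimately have "adj (ends G) (edges G - {e}) (vs ! Suc j) (vs ! Suc (Suc j))"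
      unfolding adj_def by blast
    then show ?case using Suc by (simp add: rtranclp.rtrancl_into_rtrancl)
  qed simp
  from this[of "length es'"] have "conn (ends G) (edges G - {e}) (vs ! 1) (last vs)"
    using len by (metis diff_Suc_1 last_conv_nth length_0_conv nat.distinct(1) order_refl)
  moreover have "last vs = vs ! 0" using w(3) len by (metis hd_conv_nth length_0_conv nat.distinct(1))
  moreover have "ends G e = {vs ! 0, vs ! 1}" "e \<in> edges G" using w(1) es by (auto simp: is_walk_def)
  ultimately show False using assms conn_sym unfolding forest_def by metis
qed

section \<open>Packing spanning trees\<close>

definition component :: "('e \<Rightarrow> 'v set) \<Rightarrow> 'v set \<Rightarrow> 'e set \<Rightarrow> 'v \<Rightarrow> 'v set" where
  "component en V A v = {w \<in> V. conn en A v w}"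

definition components :: "('e \<Rightarrow> 'v set) \<Rightarrow> 'v set \<Rightarrow> 'e set \<Rightarrow> 'v set set" where
  "components en V A = component en V A ` V"

lemma component_eq:
  "conn en A u v \<Longrightarrow> component en V A u = component en V A v"
  unfolding component_def by (auto intro: rtranclp_trans conn_sym)

text \<open>Precisely the components of \<open>a\<close> and \<open>b\<close> merge; the others stay
  as they are.\<close>

lemma card_components_insert:
  assumes V: "finite V" and e: "en e = {a, b}" "a \<in> V" "b \<in> V" and nc: "\<not> conn en A a b"
  shows "card (components en V A) = Suc (card (components en V (insert e A)))"
proof -
  let ?c = "component en V A" and ?d = "component en V (insert e A)"
  let ?ab = "?c a \<union> ?c b"
  have d: "?d v = (if v \<in> ?ab then ?ab else ?c v)" if "v \<in> V" for v
  proof -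
    have 1: "conn en (insert e A) v w" if "conn en A v w" for w
      using that by (rule conn_mono) auto
    have ab: "conn en (insert e A) a b" using e(1) by (intro conn_edge) auto
    have 2: "conn en (insert e A) v w" if "conn en A v x" "conn en A y w" "{x, y} = {a, b}" for w x y
    proof -
      have "conn en (insert e A) x y" using that(3) ab conn_sym
        by (metis doubleton_eq_iff)
      moreover have "conn en (insert e A) v x" "conn en (insert e A) y w"
        using that conn_mono subset_insertI by metis+
      ultimately show ?thesis by (meson rtranclp_trans)
    qed
    have 3: "conn en A v w \<or> conn en A v a \<and> conn en A b w \<or> conn en A v b \<and> conn en A a w"
      if "conn en (insert e A) v w" for w
      using conn_insert[of en e A v w a b] that e(1) by blast
    show ?thesis
    proof (cases "v \<in> ?ab")
      case True
      then have va: "conn en A v a \<or> conn en A v b" by (auto simp: component_def dest: conn_sym)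
      have "w \<in> ?d v \<longleftrightarrow> w \<in> ?ab" for w
      proof
        assume "w \<in> ?d v"
        then have w: "w \<in> V" "conn en (insert e A) v w" by (auto simp: component_def)
        from 3[OF w(2)] va show "w \<in> ?ab" using w(1) unfolding component_def
          by (auto intro: rtranclp_trans conn_sym)
      next
        assume "w \<in> ?ab"
        then have w: "w \<in> V" "conn en A a w \<or> conn en A b w" by (auto simp: component_def)
        from va w(2) have "conn en (insert e A) v w"
          using 1 2[of a b w] 2[of b a w] rtranclp_trans[of "adj en A" v a w]
            rtranclp_trans[of "adj en A" v b w] by (auto simp: insert_commute)
        then show "w \<in> ?d v" using w by (auto simp: component_def)
      qed
      then show ?thesis using True by auto
    next
      case False
      then have "\<not> conn en A v a" "\<not> conn en A v b" using \<open>v \<in> V\<close>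
        by (auto simp: component_def dest: conn_sym)
      then show ?thesis using False 1 3 by (auto simp: component_def)
    qed
  qed
  have mem: "v \<in> V \<Longrightarrow> v \<in> ?c v" for v by (simp add: component_def)
  have eq: "?c v = ?c x" if "v \<in> ?c x" for v x
    using that component_eq[of en A x v] by (auto simp: component_def)
  have ne: "?c a \<noteq> ?c b" using nc e mem by (auto simp: component_def)
  have notin: "?ab \<notin> components en V A"
  proof
    assume "?ab \<in> components en V A"
    then obtain w where "w \<in> V" "?ab = ?c w" by (auto simp: components_def)
    then have "a \<in> ?c w" "b \<in> ?c w" using mem e by auto
    then have "?c a = ?c w" "?c b = ?c w" using eq by auto
    then show False using ne by auto
  qed
  have sub: "{?c a, ?c b} \<subseteq> components en V A" using e by (auto simp: components_def)
  have "components en V (insert e A) = insert ?ab (components en V A - {?c a, ?c b})"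
  proof (intro equalityI subsetI)
    fix X assume "X \<in> components en V (insert e A)"
    then obtain v where v: "v \<in> V" "X = ?d v" by (auto simp: components_def)
    show "X \<in> insert ?ab (components en V A - {?c a, ?c b})"
      using d[OF v(1)] v mem[OF v(1)] by (auto simp: components_def split: if_splits)
  next
    fix X assume X: "X \<in> insert ?ab (components en V A - {?c a, ?c b})"
    show "X \<in> components en V (insert e A)"
    proof (cases "X = ?ab")
      case True
      then have "X = ?d a" using d[OF e(2)] mem[OF e(2)] by auto
      then show ?thesis using e(2) by (simp add: components_def)
    next
      case False
      then obtain v where v: "v \<in> V" "X = ?c v" "X \<noteq> ?c a" "X \<noteq> ?c b"
        using X by (auto simp: components_def)
      then have "v \<notin> ?ab" using eq by blast
      then have "X = ?d v" using d[OF v(1)] v by auto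
      then show ?thesis using v by (simp add: components_def)
    qed
  qed
  moreover have fin: "finite (components en V A)" using V by (simp add: components_def)
  ultimately have "card (components en V (insert e A)) = Suc (card (components en V A) - 2)"
    using notin sub ne by (simp add: card_Diff_subset)
  moreover have "card (components en V A) \<ge> 2"
    using card_mono[OF fin sub] ne by simp
  ultimately show ?thesis by simp
qed

text \<open>When the edges of \<open>Y\<close> are deleted one at a time, each is a bridge of what
  is left and splits one component.\<close>

lemma card_components_forest_Diff:
  assumes "finite V" "forest en A" "finite Y" "Y \<subseteq> A" "\<And>e. e \<in> A \<Longrightarrow> \<exists>a\<in>V. \<exists>b\<in>V. en e = {a, b}"
  shows "card (components en V (A - Y)) = card (components en V A) + card Y"
  using assms(3,4)
proof (induction Y)
  case (insert y Y)
  then obtain a b where ab: "a \<in> V" "b \<in> V" "en y = {a, b}" using assms(5) by blast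
  have eq: "A - Y = insert y (A - insert y Y)" using insert by auto
  have "\<not> conn en (A - {y}) a b" using assms(2) insert ab by (auto simp: forest_def)
  then have "\<not> conn en (A - insert y Y) a b" using conn_mono[of en "A - insert y Y" a b "A - {y}"] by blast
  then have "card (components en V (A - insert y Y)) = Suc (card (components en V (A - Y)))"
    using card_components_insert[of V en y a b "A - insert y Y"] ab assms(1) eq by simp
  then show ?case using insert by simp
qed simp

text \<open>\<open>e\<close> lies in the closure of \<open>A\<close> in the graphic matroid.\<close>

definition spans :: "('e \<Rightarrow> 'v set) \<Rightarrow> 'e set \<Rightarrow> 'e \<Rightarrow> bool" where
  "spans en A e \<longleftrightarrow> (\<exists>a b. en e = {a, b} \<and> conn en A a b)"

lemma spans_iff: "en e = {a, b} \<Longrightarrow> spans en A e \<longleftrightarrow> conn en A a b"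
  unfolding spans_def by (metis conn_sym doubleton_eq_iff)

lemma spans_mono: "spans en A e \<Longrightarrow> A \<subseteq> B \<Longrightarrow> spans en B e"
  unfolding spans_def by (meson conn_mono)

lemma spans_self: "e \<in> A \<Longrightarrow> en e = {a, b} \<Longrightarrow> spans en A e"
  by (auto simp: spans_iff intro: conn_edge)

text \<open>In a forest the path joining the ends of \<open>x\<close> is unique. Edges that can be
  deleted singly without cutting it are off that path, so they can be deleted together.\<close>

lemma spans_Diff_forest:
  assumes F: "forest en F" and Y: "finite Y" "Y \<subseteq> F" and x: "spans en F x"
    and s: "\<And>y. y \<in> Y \<Longrightarrow> spans en (F - {y}) x"
    and ends: "\<And>e. e \<in> F \<Longrightarrow> \<exists>a b. en e = {a, b}"
  shows "spans en (F - Y) x"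
  using Y s
proof (induction Y)
  case (insert y Y)
  obtain a b where ab: "en x = {a, b}" using x by (auto simp: spans_def)
  obtain p q where pq: "en y = {p, q}" using ends insert.prems by blast
  have eq: "F - Y = insert y (F - insert y Y)" using insert by auto
  have c: "conn en (insert y (F - insert y Y)) a b"
    using insert ab unfolding eq[symmetric] by (simp add: spans_iff)
  have sub: "F - insert y Y \<subseteq> F - {y}" by auto
  have ab': "conn en (F - {y}) a b" using insert.prems ab by (auto simp: spans_iff)
  have npq: "\<not> conn en (F - {y}) p q" using F insert.prems pq by (auto simp: forest_def)
  have "conn en (F - insert y Y) a b"
  proof (rule ccontr)
    assume "\<not> ?thesis"
    then have "conn en (F - insert y Y) a p \<and> conn en (F - insert y Y) q b \<or>
        conn en (F - insert y Y) a q \<and> conn en (F - insert y Y) p b"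
      using conn_insert[OF c pq] by auto
    then have "conn en (F - {y}) a p \<and> conn en (F - {y}) q b \<or>
        conn en (F - {y}) a q \<and> conn en (F - {y}) p b"
      using conn_mono[OF _ sub] by meson
    then show False using npq ab' by (meson conn_sym rtranclp_trans)
  qed
  then show ?case using ab by (simp add: spans_iff)
qed (use x in simp)

section \<open>Augmentation along exchange levels\<close>

locale forest_packing =
  fixes en :: "'e \<Rightarrow> 'v set" and V :: "'v set" and E :: "'e set" and h :: nat
  assumes finite_V: "finite V" and finite_E: "finite E"
    and ends: "\<And>e. e \<in> E \<Longrightarrow> \<exists>a\<in>V. \<exists>b\<in>V. en e = {a, b}"
begin

definition colour_class :: "('e \<Rightarrow> nat) \<Rightarrow> nat \<Rightarrow> 'e set" where
  "colour_class col c = {e \<in> E. col e = c}"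

text \<open>Colour 0 means uncovered and carries no forest condition; colours 1 to \<open>h\<close>
  are the forests, which are edge-disjoint because they come from one colouring.\<close>

definition valid :: "('e \<Rightarrow> nat) \<Rightarrow> bool" where
  "valid col \<longleftrightarrow> (\<forall>e\<in>E. col e \<le> h) \<and> (\<forall>c\<in>{1..h}. forest en (colour_class col c))"

text \<open>If the class of \<open>y\<close> spans \<open>x\<close>, this says that \<open>y\<close>
  lies on the cycle closed by \<open>x\<close>. If it does not, every \<open>y\<close> of the class
  qualifies, but then \<open>x\<close> is addable and the search ends at its level.\<close>

definition exchangeable :: "('e \<Rightarrow> nat) \<Rightarrow> 'e \<Rightarrow> 'e \<Rightarrow> bool" where
  "exchangeable col x y \<longleftrightarrow> col y \<noteq> 0 \<and> \<not> spans en (colour_class col (col y) - {y}) x"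

primrec level :: "('e \<Rightarrow> nat) \<Rightarrow> nat \<Rightarrow> 'e set" where
  "level col 0 = colour_class col 0"
| "level col (Suc r) = level col r \<union> {y \<in> E. \<exists>x\<in>level col r. exchangeable col x y}"

definition addable :: "('e \<Rightarrow> nat) \<Rightarrow> 'e \<Rightarrow> bool" where
  "addable col x \<longleftrightarrow> (\<exists>c\<in>{1..h}. \<not> spans en (colour_class col c) x)"

definition stuck :: "('e \<Rightarrow> nat) \<Rightarrow> bool" where
  "stuck col \<longleftrightarrow> (\<forall>r. \<forall>x\<in>level col r. \<not> addable col x)"

text \<open>The pair (number of uncovered edges, least level with an addable edge) in lexicographic
  order, written as one number to base \<open>Suc (card E)\<close>. The second entry is a proper
  digit only if the colouring is not stuck; otherwise \<open>LEAST\<close> has no witness.\<close>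

definition potential :: "('e \<Rightarrow> nat) \<Rightarrow> nat" where
  "potential col = card (colour_class col 0) * Suc (card E) + (LEAST r. \<exists>x\<in>level col r. addable col x)"

definition augments :: "('e \<Rightarrow> nat) \<Rightarrow> nat \<Rightarrow> 'e \<Rightarrow> nat \<Rightarrow> bool" where
  "augments col t x c \<longleftrightarrow> x \<in> level col t \<and> c \<in> {1..h} \<and> \<not> spans en (colour_class col c) x \<and>
     (\<forall>r<t. \<forall>w\<in>level col r. \<not> addable col w)"

lemma level_subset: "level col r \<subseteq> E"
  by (induction r) (auto simp: colour_class_def)

lemma level_mono: "r \<le> r' \<Longrightarrow> level col r \<subseteq> level col r'"
  by (rule lift_Suc_mono_le) auto

text \<open>Once two consecutive levels agree, all later ones do, and strict growth can occur at
  most \<open>card E\<close> times.\<close>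

lemma level_stable: "level col r \<subseteq> level col (card E)"
proof -
  have const: "level col (r + i) = level col r" if "level col (Suc r) = level col r" for r i
  proof (induction i)
    case (Suc i)
    then show ?case using that by auto
  qed simp
  have "\<exists>r\<le>card E. level col (Suc r) = level col r"
  proof (rule ccontr)
    assume *: "\<not> ?thesis"
    have "r \<le> Suc (card E) \<Longrightarrow> r \<le> card (level col r)" for r
    proof (induction r)
      case (Suc r)
      have "level col r \<subset> level col (Suc r)" using * Suc.prems by auto
      then have "card (level col r) < card (level col (Suc r))"
        by (rule psubset_card_mono[OF finite_subset[OF level_subset finite_E]])
      then show ?case using Suc by simp
    qed simp
    from this[of "Suc (card E)"] show False using card_mono[OF finite_E level_subset[of col "Suc (card E)"]] by simp
  qed
  then obtain r0 where r0: "r0 \<le> card E" "level col (Suc r0) = level col r0" by auto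
  have "level col r \<subseteq> level col (r0 + r)" by (intro level_mono) simp
  also have "\<dots> = level col (card E)" using const[OF r0(2), of r] const[OF r0(2), of "card E - r0"] r0(1) by simp
  finally show ?thesis .
qed

lemma stuck_iff: "stuck col \<longleftrightarrow> (\<forall>x\<in>level col (card E). \<not> addable col x)"
  unfolding stuck_def using level_stable by blast

lemma colour_class_upd:
  assumes "x \<in> E"
  shows "colour_class (col(x := c)) b =
    (if b = c then insert x (colour_class col c) else colour_class col b - {x})"
  using assms by (auto simp: colour_class_def)

lemma augments_valid:
  assumes "valid col" "augments col t x c"
  shows "valid (col(x := c))"
proof -
  have x: "x \<in> E" using assms(2) level_subset by (auto simp: augments_def)
  obtain a b where ab: "en x = {a, b}" using ends[OF x] by blast
  have "forest en (colour_class (col(x := c)) d)" if "d \<in> {1..h}" for d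
  proof (cases "d = c")
    case True
    then show ?thesis using assms that ab forest_insert[of en "colour_class col c" x a b]
      by (auto simp: colour_class_upd[OF x] valid_def augments_def spans_iff)
  next
    case False
    moreover have "forest en (colour_class col d)" using assms(1) that by (simp add: valid_def)
    ultimately show ?thesis by (auto simp: colour_class_upd[OF x] elim: forest_mono)
  qed
  then show ?thesis using assms by (auto simp: valid_def augments_def)
qed

text \<open>Minimality of \<open>t\<close> is what protects the exchanges below level
  \<open>t\<close>: their edges are not addable, hence spanned by class \<open>c\<close>, and so
  unaffected by the arrival of \<open>x\<close>.\<close>

lemma level_upd_subset:
  assumes aug: "augments col t x c" and "j < t"
  shows "level col j \<subseteq> level (col(x := c)) j"
  using assms(2)
proof (induction j)
  case 0
  have "x \<notin> colour_class col 0" using aug 0 by (fastforce simp: augments_def addable_def)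
  then show ?case by (auto simp: colour_class_def)
next
  case (Suc j)
  have x: "x \<in> E" using aug level_subset by (auto simp: augments_def)
  obtain a b where ab: "en x = {a, b}" using ends[OF x] by blast
  have sub: "level col j \<subseteq> level (col(x := c)) j" using Suc.IH Suc.prems Suc_lessD by blast
  have "y \<in> level (col(x := c)) (Suc j)" if y: "y \<in> level col (Suc j)" for y
  proof (cases "y \<in> level col j")
    case False
    then obtain z where z: "y \<in> E" "z \<in> level col j" "exchangeable col z y" using y by auto
    have "\<not> addable col y" using aug Suc.prems y unfolding augments_def by blast
    then have yx: "y \<noteq> x" using aug by (auto simp: augments_def addable_def)
    have "z \<in> E" using z(2) level_subset by auto
    then obtain p q where pq: "en z = {p, q}" using ends by blast
    have "\<not> spans en (colour_class (col(x := c)) (col y) - {y}) z"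
    \<comment> \<open>In the class that gains \<open>x\<close>, \<open>conn_exchange\<close> shows
      that \<open>y\<close> stays on the path joining the ends of \<open>z\<close>. Any other class
      can only lose \<open>x\<close> and so spans no more than before.\<close>
    proof (cases "col y = c")
      case True
      have "conn en (colour_class col c) p q"
      proof -
        have "\<not> addable col z" using aug z(2) Suc.prems Suc_lessD unfolding augments_def by blast
        then show ?thesis using aug pq by (auto simp: augments_def addable_def spans_iff)
      qed
      moreover have "\<not> conn en (colour_class col c - {y}) p q"
        using z(3) True pq by (auto simp: exchangeable_def spans_iff)
      moreover have "\<not> conn en (colour_class col c) a b"
        using aug ab by (auto simp: augments_def spans_iff)
      moreover have "y \<in> colour_class col c" using True z(1) by (simp add: colour_class_def)
      ultimately have "\<not> conn en (insert x (colour_class col c) - {y}) p q"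
        using conn_exchange[of en x a b "colour_class col c" p q y, OF ab] by blast
      then show ?thesis using True pq by (simp add: colour_class_upd[OF x] spans_iff)
    next
      case False
      then show ?thesis using z(3) spans_mono[of en "colour_class col (col y) - {x} - {y}" z]
        by (auto simp: colour_class_upd[OF x] exchangeable_def)
    qed
    then have "exchangeable (col(x := c)) z y" using z(3) yx by (simp add: exchangeable_def)
    then show ?thesis using z sub by auto
  qed (use sub in auto)
  then show ?case by blast
qed

lemma Least_le_card:
  assumes "\<not> stuck col"
  shows "(LEAST r. \<exists>x\<in>level col r. addable col x) \<le> card E"
  using assms by (intro Least_le) (auto simp: stuck_iff)

text \<open>At level 0 the leading digit drops, whatever happens to the other. At a higher level the
  leading digit stays and the least addable level drops.\<close>

lemma augments_potential:
  assumes v: "valid col" and aug: "augments col t x c" and ns: "\<not> stuck (col(x := c))"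
  shows "potential (col(x := c)) < potential col"
proof -
  let ?col = "col(x := c)"
  let ?L = "\<lambda>col. LEAST r. \<exists>x\<in>level col r. addable col x"
  have x: "x \<in> E" using aug level_subset by (auto simp: augments_def)
  obtain a b where ab: "en x = {a, b}" using ends[OF x] by blast
  have L: "?L col = t"
  proof (rule Least_equality)
    show "\<exists>x\<in>level col t. addable col x" using aug unfolding augments_def addable_def by blast
    show "t \<le> y" if "\<exists>x\<in>level col y. addable col x" for y
      using aug that by (auto simp: augments_def not_less[symmetric])
  qed
  show ?thesis
  proof (cases t)
    case 0
    then have x0: "x \<in> colour_class col 0" using aug by (auto simp: augments_def)
    then have "colour_class ?col 0 = colour_class col 0 - {x}"
      using aug by (auto simp: colour_class_upd[OF x] augments_def)
    then have "Suc (card (colour_class ?col 0)) = card (colour_class col 0)"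
      using x0 card_Suc_Diff1[of "colour_class col 0" x] finite_subset[OF _ finite_E]
      by (simp add: colour_class_def)
    then have "potential col \<ge> Suc (card (colour_class ?col 0)) * Suc (card E)"
      by (simp add: potential_def)
    moreover have "?L ?col \<le> card E" using Least_le_card[OF ns] .
    ultimately show ?thesis by (simp add: potential_def)
  next
    case (Suc r)
    have na: "\<not> addable col w" if "w \<in> level col r" for w using aug Suc that by (auto simp: augments_def)
    have ax: "addable col x" using aug by (auto simp: augments_def addable_def)
    then have "x \<notin> level col r" using na by auto
    then obtain w where w: "w \<in> level col r" "exchangeable col w x"
      using aug Suc by (auto simp: augments_def)
    \<comment> \<open>\<open>x\<close> differs from class \<open>c\<close> in colour, because a
      class spans its own members.\<close>
    have xc: "col x \<noteq> 0" "col x \<noteq> c" "col x \<le> h"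
      using w(2) aug v x spans_self[of x "colour_class col c" en a b] ab
      by (auto simp: exchangeable_def augments_def valid_def colour_class_def)
    \<comment> \<open>\<open>x\<close> was exchangeable for \<open>w\<close>; now that
      \<open>x\<close> has left its old class, that class no longer spans \<open>w\<close>.\<close>
    have "\<not> spans en (colour_class ?col (col x)) w"
      using w(2) xc by (simp add: colour_class_upd[OF x] exchangeable_def)
    then have "addable ?col w" using xc unfolding addable_def by (intro bexI[of _ "col x"]) auto
    moreover have "w \<in> level ?col r" using level_upd_subset[OF aug, of r] w(1) Suc by auto
    ultimately have "?L ?col \<le> r" by (intro Least_le) auto
    moreover have "colour_class ?col 0 = colour_class col 0"
      using xc aug by (auto simp: colour_class_upd[OF x] augments_def colour_class_def)
    ultimately show ?thesis using L Suc by (simp add: potential_def)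
  qed
qed

lemma potential_less: "\<not> stuck col \<Longrightarrow> potential col < Suc (card E) * Suc (card E)"
proof -
  assume "\<not> stuck col"
  then have "(LEAST r. \<exists>x\<in>level col r. addable col x) \<le> card E" by (rule Least_le_card)
  moreover have "card (colour_class col 0) \<le> card E"
    using finite_E by (auto simp: colour_class_def intro: card_mono)
  then have "card (colour_class col 0) * Suc (card E) \<le> card E * Suc (card E)" by (rule mult_le_mono1)
  ultimately show ?thesis by (simp add: potential_def)
qed

text \<open>The components of the labelled edges \<open>S\<close> act as the critical partition in
  the counting of Nash-Williams and Tutte; the cut condition leaves only the trivial
  partition.\<close>

lemma stuck_connected:
  assumes v: "valid col" and st: "stuck col" and V: "V \<noteq> {}" and k: "2 * h \<le> k" "k > 0"
    and cut: "\<And>X. X \<noteq> {} \<Longrightarrow> X \<subset> V \<Longrightarrow> k \<le> card {e \<in> E. en e \<inter> X \<noteq> {} \<and> en e \<inter> (V - X) \<noteq> {}}"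
    and c: "c \<in> {1..h}" and uv: "u \<in> V" "v \<in> V"
  shows "conn en (colour_class col c) u v"
proof -
  define S where "S = level col (card E)"
  have S: "S \<subseteq> E" unfolding S_def by (rule level_subset)
  have S0: "e \<in> S" if "e \<in> E" "col e = 0" for e
    using level_mono[of 0 "card E" col] that by (auto simp: S_def colour_class_def)
  have Sspan: "spans en (colour_class col c) x" if "x \<in> S" "c \<in> {1..h}" for x c
    using st that by (auto simp: S_def stuck_iff addable_def)
  have Sclosed: "y \<in> S" if "x \<in> S" "y \<in> E" "exchangeable col x y" for x y
  proof -
    have "y \<in> level col (Suc (card E))" using that by (auto simp: S_def)
    then show ?thesis using level_stable unfolding S_def by blast
  qed
  have ends': "\<exists>a b. en e = {a, b}" if "e \<in> E" for e using ends[OF that] by blast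
  have fE: "finite Y" if "Y \<subseteq> E" for Y using finite_E that by (rule rev_finite_subset)
  have FE: "colour_class col c \<subseteq> E" for c by (auto simp: colour_class_def)
  have span': "spans en (colour_class col c - (colour_class col c - S)) x" if "x \<in> S" "c \<in> {1..h}" for x c
  proof (rule spans_Diff_forest)
    show "forest en (colour_class col c)" using v that by (auto simp: valid_def)
    show "finite (colour_class col c - S)" using FE by (intro fE) auto
    show "spans en (colour_class col c) x" using Sspan that .
    show "spans en (colour_class col c - {y}) x" if "y \<in> colour_class col c - S" for y
      using Sclosed[of x y] that \<open>x \<in> S\<close> \<open>c \<in> _\<close> by (auto simp: exchangeable_def colour_class_def)
    show "\<exists>a b. en e = {a, b}" if "e \<in> colour_class col c" for e using ends' FE that by blast
  qed (use that in auto)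
  have Dif: "colour_class col c - (colour_class col c - S) = S \<inter> colour_class col c" for c by auto
  have conn_S: "conn en (S \<inter> colour_class col c) u v" if "conn en S u v" "c \<in> {1..h}" for u v c
    using that(1)
  proof (induction rule: rtranclp_induct)
    case (step y z)
    then obtain e where e: "e \<in> S" "en e = {y, z}" by (auto simp: adj_def)
    then have "conn en (S \<inter> colour_class col c) y z"
      using span'[OF e(1) that(2)] by (simp add: Dif spans_iff)
    then show ?case using step by (meson rtranclp_trans)
  qed simp
  let ?P = "components en V S"
  have finP: "finite ?P" using finite_V by (simp add: components_def)
  \<comment> \<open>Within a class the \<open>S\<close>-part already has the components
    \<open>?P\<close>; each edge outside \<open>S\<close> merges two of them, and at least one
    component remains.\<close>
  have cls_card: "card (colour_class col c - S) \<le> card ?P - 1" if "c \<in> {1..h}" for c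
  proof -
    have "component en V S w = component en V (S \<inter> colour_class col c) w" for w
      unfolding component_def using conn_S[OF _ that] conn_mono[of en "S \<inter> colour_class col c" _ _ S] by auto
    then have "?P = components en V (S \<inter> colour_class col c)" by (simp add: components_def)
    also have "S \<inter> colour_class col c = colour_class col c - (colour_class col c - S)" by auto
    finally have "card ?P = card (components en V (colour_class col c)) + card (colour_class col c - S)"
      using card_components_forest_Diff[of V en "colour_class col c" "colour_class col c - S"]
        finite_V v that ends fE FE by (auto simp: valid_def colour_class_def)
    moreover have "card (components en V (colour_class col c)) \<noteq> 0"
      using V finite_V by (simp add: components_def)
    ultimately show ?thesis by simp
  qed
  have "E - S = (\<Union>c\<in>{1..h}. colour_class col c - S)"
    using S0 v by (fastforce simp: colour_class_def valid_def)
  then have "card (E - S) \<le> (\<Sum>c\<in>{1..h}. card (colour_class col c - S))"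
    by (simp only:) (intro card_UN_le, simp)
  also have "\<dots> \<le> (\<Sum>c\<in>{1..h}. card ?P - 1)" using cls_card by (intro sum_mono) auto
  also have "\<dots> = h * (card ?P - 1)" by simp
  finally have up: "card (E - S) \<le> h * (card ?P - 1)" .
  have "card ?P = 1"
  proof (rule ccontr)
    assume "card ?P \<noteq> 1"
    moreover have "card ?P \<noteq> 0" using finP V by (simp add: components_def)
    ultimately have P2: "card ?P \<ge> 2" by simp
    let ?cut = "\<lambda>X. {e \<in> E. en e \<inter> X \<noteq> {} \<and> en e \<inter> (V - X) \<noteq> {}}"
    have cutX: "k \<le> card (?cut X)" "?cut X \<subseteq> E - S" if X: "X \<in> ?P" for X
    proof -
      obtain w where w: "w \<in> V" "X = component en V S w" using X by (auto simp: components_def)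
      have "X \<noteq> V"
      proof
        assume "X = V"
        have "Y = V" if "Y \<in> ?P" for Y
        proof -
          obtain w' where w': "w' \<in> V" "Y = component en V S w'" using \<open>Y \<in> ?P\<close> by (auto simp: components_def)
          then have "conn en S w w'" using \<open>X = V\<close> w by (auto simp: component_def)
          then show ?thesis using component_eq w' w \<open>X = V\<close> by metis
        qed
        then have "?P \<subseteq> {V}" by auto
        then have "card ?P \<le> 1" by (metis card.empty card.insert card_mono empty_iff finite.intros One_nat_def)
        then show False using P2 by simp
      qed
      then have "X \<subset> V" "X \<noteq> {}" using w by (auto simp: component_def)
      then show "k \<le> card (?cut X)" using cut by blast
      show "?cut X \<subseteq> E - S"
      proof
        fix e assume "e \<in> ?cut X"
        then obtain p q where e: "e \<in> E" "p \<in> en e" "p \<in> X" "q \<in> en e" "q \<in> V" "q \<notin> X" by auto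
        obtain a b where ab: "en e = {a, b}" using ends' e by blast
        have "en e = {p, q}" using e ab by auto
        then have "conn en S p q" if "e \<in> S" using that by (intro conn_edge)
        then have "e \<notin> S" using e w by (auto simp: component_def intro: rtranclp_trans)
        then show "e \<in> E - S" using e by auto
      qed
    qed
    have "card ?P * k = (\<Sum>X\<in>?P. k)" by simp
    also have "\<dots> \<le> (\<Sum>X\<in>?P. card (?cut X))" using cutX by (intro sum_mono) auto
    also have "\<dots> = (\<Sum>X\<in>?P. \<Sum>e\<in>E - S. of_bool (e \<in> ?cut X))"
    proof (intro sum.cong refl)
      fix X assume "X \<in> ?P"
      then have sub: "?cut X \<subseteq> E - S" using cutX by blast
      have "(\<Sum>e\<in>E - S. of_bool (e \<in> ?cut X)) = card ((E - S) \<inter> ?cut X)"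
        using finite_E unfolding of_bool_def by (subst sum.If_cases) auto
      also have "(E - S) \<inter> ?cut X = ?cut X" using sub by blast
      finally show "card (?cut X) = (\<Sum>e\<in>E - S. of_bool (e \<in> ?cut X))" by simp
    qed
    also have "\<dots> = (\<Sum>e\<in>E - S. \<Sum>X\<in>?P. of_bool (e \<in> ?cut X))" by (rule sum.swap)
    also have "\<dots> \<le> (\<Sum>e\<in>E - S. 2)"
    proof (intro sum_mono)
      fix e assume e: "e \<in> E - S"
      then obtain a b where ab: "a \<in> V" "b \<in> V" "en e = {a, b}" using ends by blast
      \<comment> \<open>An edge can be cut only by the components of its two ends, so the double
        count charges it at most twice.\<close>
      have "{X \<in> ?P. e \<in> ?cut X} \<subseteq> {component en V S a, component en V S b}"
      proof
        fix X assume "X \<in> {X \<in> ?P. e \<in> ?cut X}"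
        then obtain p where X: "X \<in> ?P" "p \<in> en e" "p \<in> X" by auto
        then obtain w where w: "w \<in> V" "X = component en V S w" by (auto simp: components_def)
        have "X = component en V S p" using w X component_eq[of en S w p] by (auto simp: component_def)
        then show "X \<in> {component en V S a, component en V S b}" using X ab by auto
      qed
      then have "card {X \<in> ?P. e \<in> ?cut X} \<le> card {component en V S a, component en V S b}"
        by (intro card_mono) auto
      also have "\<dots> \<le> 2" by (simp add: card_insert_if)
      also have "card {X \<in> ?P. e \<in> ?cut X} = (\<Sum>X\<in>?P. of_bool (e \<in> ?cut X))"
        using finP by (simp add: sum.If_cases of_bool_def Int_def)
      finally show "(\<Sum>X\<in>?P. of_bool (e \<in> ?cut X)) \<le> (2 :: nat)" .
    qed
    also have "\<dots> \<le> 2 * (h * (card ?P - 1))" using up by simp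
    also have "\<dots> \<le> k * (card ?P - 1)" using k by simp
    also have "\<dots> < k * card ?P" using k(2) P2 by simp
    finally show False by (simp add: mult.commute)
  qed
  then obtain X where "?P = {X}" by (auto simp: card_1_singleton_iff)
  moreover have "component en V S u \<in> ?P" "component en V S v \<in> ?P" using uv by (auto simp: components_def)
  ultimately have "component en V S u = component en V S v" by simp
  moreover have "v \<in> component en V S v" using uv by (simp add: component_def)
  ultimately have "conn en S u v" by (auto simp: component_def)
  then show ?thesis using conn_S[OF _ c] conn_mono by (metis Int_lower2)
qed

end

section \<open>Random shortcuts\<close>

definition near :: "('e \<Rightarrow> 'v set) \<Rightarrow> 'e set \<Rightarrow> nat \<Rightarrow> 'v \<Rightarrow> 'v \<Rightarrow> bool" where
  "near en A d u v \<longleftrightarrow> (\<exists>i\<le>d. (adj en A ^^ i) u v)"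

lemma near_mono: "near en A d u v \<Longrightarrow> A \<subseteq> B \<Longrightarrow> d \<le> d' \<Longrightarrow> near en B d' u v"
  unfolding near_def by (meson order_trans relpowp_adj_mono)

lemma near_refl: "near en A d u u"
  unfolding near_def by (intro exI[of _ 0]) auto

lemma near_trans: "near en A d u v \<Longrightarrow> near en A d' v w \<Longrightarrow> near en A (d + d') u w"
  unfolding near_def by (metis add_mono relcomppI relpowp_add)

lemma near_sym: "near en A d u v \<Longrightarrow> near en A d v u"
  unfolding near_def by (meson relpowp_adj_sym)

lemma near_conn: "near en A d u v \<Longrightarrow> conn en A u v"
  unfolding near_def by (meson relpowp_imp_rtranclp)

lemma near_edge: "e \<in> A \<Longrightarrow> en e = {u, v} \<Longrightarrow> near en A (Suc 0) u v"
  unfolding near_def by (intro exI[of _ "Suc 0"]) (auto simp: adj_def eq_OO)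

lemma conn_closed:
  assumes "conn en A u v" "u \<in> V" "\<And>e. e \<in> A \<Longrightarrow> en e \<subseteq> V"
  shows "v \<in> V"
  using assms(1,2) by induction (use assms(3) in \<open>auto simp: adj_def\<close>)

definition edge_dist :: "('e \<Rightarrow> 'v set) \<Rightarrow> 'e set \<Rightarrow> 'v \<Rightarrow> 'v \<Rightarrow> nat" where
  "edge_dist en A u v = (LEAST i. (adj en A ^^ i) u v)"

lemma edge_dist_le: "(adj en A ^^ i) u v \<Longrightarrow> edge_dist en A u v \<le> i"
  unfolding edge_dist_def by (rule Least_le)

lemma edge_dist_relpowp: "conn en A u v \<Longrightarrow> (adj en A ^^ edge_dist en A u v) u v"
  unfolding edge_dist_def by (metis LeastI rtranclp_imp_relpowp)

lemma edge_dist_le_add: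
  assumes "conn en A t v" "near en A d v w"
  shows "edge_dist en A t w \<le> edge_dist en A t v + d"
proof -
  obtain i where i: "i \<le> d" "(adj en A ^^ i) v w" using assms(2) by (auto simp: near_def)
  have "(adj en A ^^ (edge_dist en A t v + i)) t w"
    using edge_dist_relpowp[OF assms(1)] i(2) by (auto simp: relpowp_add)
  then show ?thesis using edge_dist_le i(1) by (meson add_left_mono le_trans)
qed

text \<open>The vertex \<open>m\<close> steps along a shortest walk has distance exactly
  \<open>m\<close>, since otherwise the walk could be shortened.\<close>

lemma ex_edge_dist_eq:
  assumes "conn en A t v" "m \<le> edge_dist en A t v"
  shows "\<exists>w. near en A m t w \<and> edge_dist en A t w = m"
proof -
  have "(adj en A ^^ (m + (edge_dist en A t v - m))) t v" using edge_dist_relpowp assms by fastforce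
  then obtain w where w: "(adj en A ^^ m) t w" "(adj en A ^^ (edge_dist en A t v - m)) w v"
    by (auto simp: relpowp_add)
  have tw: "near en A m t w" using w by (auto simp: near_def)
  have wv: "near en A (edge_dist en A t v - m) w v" using w by (auto simp: near_def)
  have "edge_dist en A t v \<le> edge_dist en A t w + (edge_dist en A t v - m)"
    using edge_dist_le_add[OF near_conn[OF tw] wv] .
  moreover have "edge_dist en A t w \<le> m" using edge_dist_le w by metis
  ultimately show ?thesis using tw assms(2) by (intro exI[of _ w]) auto
qed

text \<open>\<open>i\<close> counts the levels already left, from the deepest upwards; the outer
  \<open>Suc\<close> is the parent edge crossed to leave a level.\<close>

primrec radius :: "nat \<Rightarrow> nat \<Rightarrow> nat" where
  "radius l 0 = 0"
| "radius l (Suc i) = Suc (l * (2 * radius l i + 1) + radius l i)"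

text \<open>The \<open>Suc\<close> makes the induction go through: it absorbs the additive terms, as
  \<open>l + 2 \<le> 2 * l + 1\<close>.\<close>

lemma radius_le: "1 \<le> l \<Longrightarrow> Suc (radius l i) \<le> (2 * l + 1) ^ i"
proof (induction i)
  case (Suc i)
  have "Suc (radius l (Suc i)) = 2 * l * radius l i + l + radius l i + 2"
    by (simp add: algebra_simps)
  also have "\<dots> \<le> (2 * l + 1) * Suc (radius l i)" using Suc.prems by (simp add: algebra_simps)
  also have "\<dots> \<le> (2 * l + 1) * (2 * l + 1) ^ i" using Suc by (intro mult_le_mono2) auto
  finally show ?case by simp
qed simp

section \<open>The level-by-level argument for one fixed labelling\<close>

locale sampled_tree =
  fixes en :: "'e \<Rightarrow> 'v set" and V :: "'v set" and E F :: "'e set" and r :: 'v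
    and lvl :: "'v \<Rightarrow> nat" and par :: "'v \<Rightarrow> 'e" and L l :: nat
  assumes finite_V: "finite V" and finite_E: "finite E" and ends: "\<And>e. e \<in> E \<Longrightarrow> en e \<subseteq> V"
    and F: "F \<subseteq> E" and F_conn: "\<And>u v. u \<in> V \<Longrightarrow> v \<in> V \<Longrightarrow> conn en F u v"
    and r: "r \<in> V" and lvl_0: "\<And>v. v \<in> V \<Longrightarrow> lvl v = 0 \<longleftrightarrow> v = r"
    and par: "\<And>v. v \<in> V \<Longrightarrow> v \<noteq> r \<Longrightarrow> par v \<in> E \<and> (\<exists>w\<in>V. en (par v) = {v, w} \<and> lvl w < lvl v)"
    and lvl_le: "\<And>v. v \<in> V \<Longrightarrow> lvl v \<le> L" and l: "1 \<le> l"
begin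

text \<open>\<open>X\<close> is the set of edges with the label in question. Only parent edges of
  vertices deeper than \<open>j\<close> are consulted, so \<open>revealed X j\<close> does not
  depend on the labels of the parent edges of level \<open>j\<close>.\<close>

definition revealed :: "'e set \<Rightarrow> nat \<Rightarrow> 'e set" where
  "revealed X j = F \<union> (par ` {v \<in> V. lvl v > j} \<inter> X)"

definition frontier :: "'e set \<Rightarrow> nat \<Rightarrow> 'v \<Rightarrow> 'v set" where
  "frontier X j t = {y \<in> V. lvl y = j \<and>
     near en (revealed X j) (l * (2 * radius l (L - j) + 1) + radius l (L - j)) t y}"

text \<open>The only kind of failure: many vertices of level \<open>j\<close> within reach, and none
  of their parent edges in \<open>X\<close>.\<close>

definition bad :: "'e set \<Rightarrow> nat \<Rightarrow> 'v \<Rightarrow> bool" where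
  "bad X j t \<longleftrightarrow> l \<le> card (frontier X j t) \<and> par ` frontier X j t \<inter> X = {}"

lemma lvl_r [simp]: "lvl r = 0"
  using lvl_0 r by blast

text \<open>If two vertices shared a parent edge, each would be the parent of the other, hence
  strictly lower than the other.\<close>

lemma inj_par: "inj_on par (V - {r})"
proof (rule inj_onI)
  fix v w assume vw: "v \<in> V - {r}" "w \<in> V - {r}" "par v = par w"
  obtain v' where v': "en (par v) = {v, v'}" "lvl v' < lvl v" using par vw by blast
  obtain w' where w': "en (par w) = {w, w'}" "lvl w' < lvl w" using par vw by blast
  show "v = w" using v' w' vw(3) by (auto simp: doubleton_eq_iff)
qed

lemma revealed_subset: "revealed X j \<subseteq> E"
proof -
  have "par v \<in> E" if "v \<in> V" "j < lvl v" for v using that par[of v] by fastforce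
  then show ?thesis using F by (auto simp: revealed_def)
qed

lemma no_bad_step:
  assumes nb: "\<And>t. t \<in> V \<Longrightarrow> \<not> bad X j t" and j: "0 < j" "j \<le> L"
    and IH: "\<And>s. s \<in> V \<Longrightarrow> \<exists>y\<in>V. lvl y \<le> j \<and> near en (revealed X j) (radius l (L - j)) s y"
    and t: "t \<in> V"
  shows "\<exists>y\<in>V. lvl y \<le> j - 1 \<and> near en (revealed X (j - 1)) (radius l (Suc (L - j))) t y"
proof -
  let ?A = "revealed X j" and ?A' = "revealed X (j - 1)" and ?g = "radius l (L - j)"
  let ?R = "l * (2 * ?g + 1) + ?g"
  have sub: "?A \<subseteq> ?A'" by (auto simp: revealed_def)
  have A_V: "en e \<subseteq> V" if "e \<in> ?A" for e using that revealed_subset ends by blast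
  have conn: "conn en ?A t v" if "v \<in> V" for v
    by (rule conn_mono[OF F_conn[OF t that]]) (auto simp: revealed_def)
  have found: ?thesis if "y \<in> V" "lvl y \<le> j - 1" "near en ?A ?R t y" for y
    using that near_mono[OF that(3) sub, of "radius l (Suc (L - j))"] by auto
  \<comment> \<open>Either the root, of level 0, is already within reach, or it is so far away that
    a shortest walk towards it has vertices at all the required distances.\<close>
  show ?thesis
  proof (cases "edge_dist en ?A t r \<le> ?R")
    case True
    then have "near en ?A ?R t r" using edge_dist_relpowp[OF conn[OF r]] by (auto simp: near_def)
    then show ?thesis using found r by simp
  next
    case False
    \<comment> \<open>The points \<open>w\<close> lie \<open>2 * ?g + 1\<close> apart, so their
      helpers \<open>y\<close>, each within \<open>?g\<close>, cannot coincide.\<close>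
    have "\<exists>w y. near en ?A (a * (2 * ?g + 1)) t w \<and> edge_dist en ?A t w = a * (2 * ?g + 1) \<and>
        y \<in> V \<and> lvl y \<le> j \<and> near en ?A ?g w y" if a: "a < l" for a
    proof -
      have "a * (2 * ?g + 1) \<le> l * (2 * ?g + 1)" using a by (intro mult_le_mono1) simp
      then have "a * (2 * ?g + 1) \<le> edge_dist en ?A t r" using False by linarith
      then obtain w where w: "near en ?A (a * (2 * ?g + 1)) t w" "edge_dist en ?A t w = a * (2 * ?g + 1)"
        using ex_edge_dist_eq[OF conn[OF r]] by blast
      moreover have "w \<in> V" using conn_closed[OF near_conn[OF w(1)] t A_V] .
      ultimately show ?thesis using IH by blast
    qed
    then obtain w y where wy: "\<And>a. a < l \<Longrightarrow> near en ?A (a * (2 * ?g + 1)) t (w a)"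
        "\<And>a. a < l \<Longrightarrow> edge_dist en ?A t (w a) = a * (2 * ?g + 1)"
        "\<And>a. a < l \<Longrightarrow> y a \<in> V" "\<And>a. a < l \<Longrightarrow> lvl (y a) \<le> j"
        "\<And>a. a < l \<Longrightarrow> near en ?A ?g (w a) (y a)"
      by metis
    have ty: "near en ?A ?R t (y a)" if "a < l" for a
    proof (rule near_mono[OF near_trans[OF wy(1)[OF that] wy(5)[OF that]]])
      show "a * (2 * ?g + 1) + ?g \<le> ?R" using that by (intro add_mono mult_le_mono1) auto
    qed simp
    show ?thesis
    proof (cases "\<exists>a<l. lvl (y a) \<noteq> j")
      case True
      then obtain a where "a < l" "lvl (y a) \<noteq> j" by blast
      then show ?thesis using found[of "y a"] wy(3,4)[of a] ty by fastforce
    next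
      case False
      then have yj: "a < l \<Longrightarrow> lvl (y a) = j" for a by blast
      \<comment> \<open>A common helper would bring the distances of \<open>w a\<close> and
        \<open>w b\<close> within \<open>2 * ?g\<close> of each other.\<close>
      have sep: "a = b" if ab: "a < l" "b < l" "y a = y b" "a \<le> b" for a b
      proof (rule ccontr)
        assume "a \<noteq> b"
        have "edge_dist en ?A t (w b) \<le> edge_dist en ?A t (y b) + ?g"
          using edge_dist_le_add[OF conn[OF wy(3)[OF ab(2)]] near_sym[OF wy(5)[OF ab(2)]]] .
        moreover have "edge_dist en ?A t (y a) \<le> edge_dist en ?A t (w a) + ?g"
          using edge_dist_le_add[OF near_conn[OF wy(1)[OF ab(1)]] wy(5)[OF ab(1)]] .
        ultimately have "b * (2 * ?g + 1) \<le> a * (2 * ?g + 1) + 2 * ?g" using wy(2) ab by simp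
        moreover have "Suc a * (2 * ?g + 1) \<le> b * (2 * ?g + 1)"
          using ab \<open>a \<noteq> b\<close> by (intro mult_le_mono1) auto
        ultimately show False by simp
      qed
      have "inj_on y {..<l}" by (rule linorder_inj_onI') (use sep in \<open>fastforce\<close>)
      moreover have "y ` {..<l} \<subseteq> frontier X j t"
        using wy(3) yj ty by (auto simp: frontier_def)
      moreover have "finite (frontier X j t)" using finite_V by (simp add: frontier_def)
      ultimately have "l \<le> card (frontier X j t)" by (metis card_image card_lessThan card_mono)
      \<comment> \<open>The frontier has at least \<open>l\<close> members, so the absence of
        failure yields a parent edge in \<open>X\<close>, which becomes usable in
        \<open>?A'\<close>.\<close>
      then obtain v where v: "v \<in> frontier X j t" "par v \<in> X"
        using nb[OF t] by (auto simp: bad_def)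
      then have v': "v \<in> V" "lvl v = j" "near en ?A ?R t v" by (auto simp: frontier_def)
      then have "v \<noteq> r" using j by auto
      then obtain x where x: "x \<in> V" "en (par v) = {v, x}" "lvl x < lvl v" using par v' by blast
      have "par v \<in> ?A'" using v v' j by (auto simp: revealed_def)
      then have "near en ?A' (?R + Suc 0) t x"
        using near_trans[OF near_mono[OF v'(3) sub order_refl] near_edge] x by metis
      then show ?thesis using x v' by (intro bexI[of _ x]) auto
    qed
  qed
qed

text \<open>Starts at level \<open>L\<close>, where each vertex serves itself, and ends at level 0,
  where the root is the only vertex.\<close>

lemma no_bad_near:
  assumes nb: "\<And>j t. 0 < j \<Longrightarrow> j \<le> L \<Longrightarrow> t \<in> V \<Longrightarrow> \<not> bad X j t" and t: "t \<in> V"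
  shows "near en (F \<union> (E \<inter> X)) (radius l L) t r"
proof -
  have "i \<le> L \<Longrightarrow> t \<in> V \<Longrightarrow> \<exists>y\<in>V. lvl y \<le> L - i \<and> near en (revealed X (L - i)) (radius l i) t y" for i t
  proof (induction i arbitrary: t)
    case 0
    then show ?case using lvl_le near_refl by (intro bexI[of _ t]) auto
  next
    case (Suc i)
    have "\<exists>y\<in>V. lvl y \<le> (L - i) - 1 \<and>
        near en (revealed X ((L - i) - 1)) (radius l (Suc (L - (L - i)))) t y"
      by (rule no_bad_step) (use Suc nb in auto)
    then show ?case using Suc.prems by simp
  qed
  from this[OF order_refl t] obtain y where "y \<in> V" "lvl y = 0" "near en (revealed X 0) (radius l L) t y"
    by auto
  moreover have "revealed X 0 \<subseteq> F \<union> (E \<inter> X)" using revealed_subset[of X 0] by (auto simp: revealed_def)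
  ultimately show ?thesis using lvl_0 near_mono[of en "revealed X 0" "radius l L" t r] by simp
qed

end

section \<open>Failure probability\<close>

lemma prob_bind_le:
  assumes "\<And>x. x \<in> set_pmf p \<Longrightarrow> measure_pmf.prob (f x) A \<le> c"
  shows "measure_pmf.prob (bind_pmf p f) A \<le> c"
proof -
  have "c \<ge> 0" using assms set_pmf_not_empty[of p] by (meson all_not_in_conv measure_nonneg order_trans)
  have "emeasure (measure_pmf (bind_pmf p f)) A = (\<integral>\<^sup>+x. emeasure (f x) A \<partial>p)" by simp
  also have "\<dots> \<le> (\<integral>\<^sup>+x. ennreal c \<partial>p)"
    using assms by (intro nn_integral_mono_AE) (auto simp: AE_measure_pmf_iff measure_pmf.emeasure_eq_measure ennreal_leI)
  also have "\<dots> = ennreal c" by simp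
  finally show ?thesis using \<open>c \<ge> 0\<close> by (simp add: measure_pmf.emeasure_eq_measure)
qed

text \<open>Conditioning on the labels outside \<open>A\<close> fixes the set \<open>N g\<close> of edges that have to miss the label \<open>i\<close>.\<close>

lemma prob_all_miss_le:
  fixes W :: nat
  assumes E: "finite E" "A \<subseteq> E" and N: "\<And>g. N g \<subseteq> A"
    and dep: "\<And>g g'. (\<And>e. e \<in> E - A \<Longrightarrow> g e = g' e) \<Longrightarrow> N g = N g'" and i: "i < W"
  shows "measure_pmf.prob (Pi_pmf E 0 (\<lambda>_. pmf_of_set {..<W})) {g. l \<le> card (N g) \<and> (\<forall>e\<in>N g. g e \<noteq> i)}
    \<le> (1 - 1 / real W) ^ l"
proof -
  let ?P = "\<lambda>A. Pi_pmf A 0 (\<lambda>_. pmf_of_set {..<W})"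
  let ?m = "\<lambda>f g e. if e \<in> E - A then f e else g e"
  let ?bad = "{g. l \<le> card (N g) \<and> (\<forall>e\<in>N g. g e \<noteq> i)}"
  have fA: "finite A" using E finite_subset by blast
  have W: "0 \<le> 1 - 1 / real W" "1 - 1 / real W \<le> 1" using i by auto
  have "?P ((E - A) \<union> A) = bind_pmf (?P (E - A)) (\<lambda>f. map_pmf (?m f) (?P A))"
    using E fA by (subst Pi_pmf_union) (auto simp: pair_pmf_def map_bind_pmf map_pmf_def bind_assoc_pmf bind_return_pmf)
  moreover have "(E - A) \<union> A = E" using E by auto
  ultimately have P: "?P E = bind_pmf (?P (E - A)) (\<lambda>f. map_pmf (?m f) (?P A))" by simp
  show ?thesis unfolding P
  proof (rule prob_bind_le)
    fix f
    have Nf: "N (?m f g) = N f" for g by (rule dep) auto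
    have NfA: "N f \<subseteq> A" using N .
    show "measure_pmf.prob (map_pmf (?m f) (?P A)) ?bad \<le> (1 - 1 / real W) ^ l"
    proof (cases "l \<le> card (N f)")
      case False
      then have "?m f -` ?bad = {}" unfolding vimage_def by (simp only: mem_Collect_eq Nf) simp
      then show ?thesis by (simp only: measure_map_pmf measure_empty zero_le_power W)
    next
      case True
      have "?m f -` ?bad = {g. \<forall>e\<in>N f. ?m f g e \<noteq> i}"
        unfolding vimage_def by (simp only: mem_Collect_eq Nf True simp_thms)
      \<comment> \<open>With \<open>N f\<close> fixed the event is a product of one-coordinate
        events, so independence applies.\<close>
      also have "\<dots> = Pi A (\<lambda>e. if e \<in> N f then - {i} else UNIV)"
        using NfA by (auto simp: Pi_def)
      finally have "measure_pmf.prob (map_pmf (?m f) (?P A)) ?bad =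
          (\<Prod>e\<in>A. measure_pmf.prob (pmf_of_set {..<W}) (if e \<in> N f then - {i} else UNIV))"
        by (simp only: measure_map_pmf measure_Pi_pmf_Pi[OF fA])
      also have "\<dots> = (\<Prod>e\<in>A. if e \<in> N f then 1 - 1 / real W else 1)"
      proof (intro prod.cong refl)
        fix e assume "e \<in> A"
        have "measure_pmf.prob (pmf_of_set {..<W}) (- {i}) = 1 - measure_pmf.prob (pmf_of_set {..<W}) {i}"
          by (metis Compl_eq_Diff_UNIV UNIV_I measure_pmf.prob_compl sets_measure_pmf space_measure_pmf)
        also have "measure_pmf.prob (pmf_of_set {..<W}) {i} = 1 / real W"
          using i by (subst measure_pmf_of_set) auto
        finally show "measure_pmf.prob (pmf_of_set {..<W}) (if e \<in> N f then - {i} else UNIV) =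
            (if e \<in> N f then 1 - 1 / real W else 1)" by simp
      qed
      also have "\<dots> = (1 - 1 / real W) ^ card (N f)"
        using fA NfA by (simp add: prod.If_cases Int_absorb1)
      also have "\<dots> \<le> (1 - 1 / real W) ^ l" using True W by (intro power_decreasing) auto
      finally show ?thesis .
    qed
  qed
qed

context sampled_tree
begin

text \<open>The parent edges of level \<open>j\<close> are the block kept random. By injectivity of
  \<open>par\<close> they differ from the deeper parent edges that determine the frontier, and their
  number equals that of the frontier vertices.\<close>

lemma prob_bad_le:
  assumes j: "0 < j" and i: "i < W"
  shows "measure_pmf.prob (Pi_pmf E 0 (\<lambda>_. pmf_of_set {..<W})) {g. bad {e. g e = i} j t}
    \<le> (1 - 1 / real W) ^ l"
proof -
  let ?N = "\<lambda>g. par ` frontier {e. g e = i} j t"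
  have Vj: "{v \<in> V. lvl v = j} \<subseteq> V - {r}" using j by auto
  have "{g. bad {e. g e = i} j t} \<subseteq> {g. l \<le> card (?N g) \<and> (\<forall>e\<in>?N g. g e \<noteq> i)}"
  proof
    fix g assume "g \<in> {g. bad {e. g e = i} j t}"
    then have b: "bad {e. g e = i} j t" by simp
    have "frontier {e. g e = i} j t \<subseteq> V - {r}" using Vj by (auto simp: frontier_def)
    then have "card (?N g) = card (frontier {e. g e = i} j t)"
      using inj_par inj_on_subset card_image by blast
    then show "g \<in> {g. l \<le> card (?N g) \<and> (\<forall>e\<in>?N g. g e \<noteq> i)}"
      using b by (auto simp: bad_def)
  qed
  then have "measure_pmf.prob (Pi_pmf E 0 (\<lambda>_. pmf_of_set {..<W})) {g. bad {e. g e = i} j t} \<le>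
      measure_pmf.prob (Pi_pmf E 0 (\<lambda>_. pmf_of_set {..<W})) {g. l \<le> card (?N g) \<and> (\<forall>e\<in>?N g. g e \<noteq> i)}"
    by (intro measure_pmf.finite_measure_mono) auto
  also have "\<dots> \<le> (1 - 1 / real W) ^ l"
  proof (rule prob_all_miss_le[where A = "par ` {v \<in> V. lvl v = j}"])
    show "par ` {v \<in> V. lvl v = j} \<subseteq> E" using par Vj by auto
    show "?N g \<subseteq> par ` {v \<in> V. lvl v = j}" for g by (auto simp: frontier_def)
    show "?N g = ?N g'" if eq: "\<And>e. e \<in> E - par ` {v \<in> V. lvl v = j} \<Longrightarrow> g e = g' e" for g g'
    proof -
      have "g (par v) = g' (par v)" if v: "v \<in> V" "lvl v > j" for v
      proof (rule eq)
        have vr: "v \<in> V - {r}" using v by auto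
        have "par v \<notin> par ` {v \<in> V. lvl v = j}"
        proof
          assume "par v \<in> par ` {v \<in> V. lvl v = j}"
          then obtain w where "w \<in> V" "lvl w = j" "par v = par w" by auto
          moreover then have "v = w" using inj_par vr Vj by (auto dest: inj_onD)
          ultimately show False using v by simp
        qed
        then show "par v \<in> E - par ` {v \<in> V. lvl v = j}" using par vr by auto
      qed
      then have "revealed {e. g e = i} j = revealed {e. g' e = i} j" by (auto simp: revealed_def)
      then show ?thesis by (simp add: frontier_def)
    qed
  qed (use finite_E i in auto)
  finally show ?thesis .
qed

text \<open>Union bound over the pairs of a level and a start vertex.\<close>

lemma prob_far_le:
  assumes i: "i < W"
  shows "measure_pmf.prob (Pi_pmf E 0 (\<lambda>_. pmf_of_set {..<W}))
      {g. \<exists>t\<in>V. \<not> near en (F \<union> {e \<in> E. g e = i}) (radius l L) t r}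
    \<le> real L * real (card V) * (1 - 1 / real W) ^ l"
proof -
  let ?P = "measure_pmf.prob (Pi_pmf E 0 (\<lambda>_. pmf_of_set {..<W}))"
  have "{g. \<exists>t\<in>V. \<not> near en (F \<union> {e \<in> E. g e = i}) (radius l L) t r} \<subseteq>
      (\<Union>(j, t)\<in>{0<..L} \<times> V. {g. bad {e. g e = i} j t})"
  proof
    fix g assume "g \<in> {g. \<exists>t\<in>V. \<not> near en (F \<union> {e \<in> E. g e = i}) (radius l L) t r}"
    then obtain t where "t \<in> V" "\<not> near en (F \<union> (E \<inter> {e. g e = i})) (radius l L) t r"
      by (auto simp: Int_def)
    then show "g \<in> (\<Union>(j, t)\<in>{0<..L} \<times> V. {g. bad {e. g e = i} j t})"
      using no_bad_near[of "{e. g e = i}" t] by fastforce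
  qed
  then have "?P {g. \<exists>t\<in>V. \<not> near en (F \<union> {e \<in> E. g e = i}) (radius l L) t r} \<le>
      ?P (\<Union>(j, t)\<in>{0<..L} \<times> V. {g. bad {e. g e = i} j t})"
    by (intro measure_pmf.finite_measure_mono) auto
  also have "\<dots> \<le> (\<Sum>x\<in>{0<..L} \<times> V. ?P (case x of (j, t) \<Rightarrow> {g. bad {e. g e = i} j t}))"
    using finite_V by (intro measure_pmf.finite_measure_subadditive_finite) auto
  also have "\<dots> \<le> (\<Sum>x\<in>{0<..L} \<times> V. (1 - 1 / real W) ^ l)"
    using prob_bad_le[OF _ i] by (intro sum_mono) auto
  also have "\<dots> = real L * real (card V) * (1 - 1 / real W) ^ l"
    by (simp add: card_cartesian_product)
  finally show ?thesis .
qed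

end

section \<open>Breadth-first search\<close>

text \<open>\<open>d\<close> holds the distance plus one, so that 0 means not reached; in round
  \<open>b\<close> the vertices at distance \<open>b\<close>, with entry \<open>b + 1\<close>, are
  expanded.\<close>

definition relax :: "string \<Rightarrow> string \<Rightarrow> com" where
  "relax x y = If (And (Eq (Cell ''d'' (Cell x (var ''e''))) (Plus (var ''b'') (Num 1)))
       (Eq (Cell ''d'' (Cell y (var ''e''))) (Num 0)))
     (Seq (Store ''d'' (Cell y (var ''e'')) (Plus (var ''b'') (Num 2)))
       (Seq (Store ''T'' (var ''p'') (var ''e'')) (assign ''p'' (Plus (var ''p'') (Num 1)))))
     SKIP"

text \<open>\<open>n\<close> sweeps over all edges replace a queue. Edges are appended to
  \<open>T\<close> at \<open>p\<close>, which is not reset here, so successive calls write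
  successive blocks.\<close>

definition bfs :: "bexp \<Rightarrow> com" where
  "bfs allowed =
     Seq (For ''v'' (var ''n'') (Store ''d'' (var ''v'') (Num 0)))
    (Seq (Store ''d'' (var ''u'') (Num 1))
      (For ''b'' (var ''n'') (For ''e'' (var ''m'')
        (If allowed (Seq (relax ''fst'' ''snd'') (relax ''snd'' ''fst'')) SKIP))))"

definition bfs_vars :: "string set" where
  "bfs_vars = {''d'', ''T'', ''p'', ''v'', ''b'', ''e''}"

definition bfs_time :: "nat \<Rightarrow> nat" where
  "bfs_time N = for_time N 1 + for_time N (for_time N 20) + 3"

locale input_graph =
  fixes n m :: nat and a b :: "nat \<Rightarrow> nat"
  assumes a_less: "e < m \<Longrightarrow> a e < n" and b_less: "e < m \<Longrightarrow> b e < n"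
begin

definition en :: "nat \<Rightarrow> nat set" where
  "en e = {a e, b e}"

definition input :: "state \<Rightarrow> bool" where
  "input s \<longleftrightarrow> s ''n'' 0 = n \<and> s ''m'' 0 = m \<and> s ''fst'' = a \<and> s ''snd'' = b"

text \<open>The block of \<open>T\<close> from \<open>p0\<close> to \<open>p\<close> is the tree
  built so far, with one edge fewer than reached vertices. That reached vertices contain all ends of
  tree edges is what makes a new edge safe to add.\<close>

definition tree_inv :: "nat set \<Rightarrow> nat \<Rightarrow> nat \<Rightarrow> (nat \<Rightarrow> nat) \<Rightarrow> (nat \<Rightarrow> nat) \<Rightarrow> nat \<Rightarrow> bool" where
  "tree_inv A u p0 d T p \<longleftrightarrow> p0 \<le> p \<and> Suc (p - p0) = card {v. v < n \<and> d v \<noteq> 0} \<and>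
     T ` {p0..<p} \<subseteq> A \<and> (\<forall>e\<in>T ` {p0..<p}. \<forall>v\<in>en e. d v \<noteq> 0) \<and> forest en (T ` {p0..<p}) \<and>
     (\<forall>v<n. d v \<noteq> 0 \<longrightarrow> (adj en (T ` {p0..<p}) ^^ (d v - 1)) u v)"

text \<open>The last clause says that vertices at distance below \<open>i\<close> have been expanded
  completely; \<open>i + 2\<close> is the largest entry that round \<open>i\<close> can
  write.\<close>

definition round_inv :: "nat set \<Rightarrow> nat \<Rightarrow> nat \<Rightarrow> (nat \<Rightarrow> nat) \<Rightarrow> nat \<Rightarrow> (nat \<Rightarrow> nat) \<Rightarrow> (nat \<Rightarrow> nat) \<Rightarrow> nat \<Rightarrow> bool" where
  "round_inv A u p0 T0 i d T p \<longleftrightarrow> tree_inv A u p0 d T p \<and> (\<forall>q<p0. T q = T0 q) \<and> d u = 1 \<and>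
     (\<forall>v<n. d v \<le> i + 2) \<and>
     (\<forall>v w. d v \<noteq> 0 \<longrightarrow> d v \<le> i \<longrightarrow> adj en A v w \<longrightarrow> d w \<noteq> 0 \<and> d w \<le> d v + 1)"

definition bfs_post :: "nat set \<Rightarrow> nat \<Rightarrow> nat \<Rightarrow> (nat \<Rightarrow> nat) \<Rightarrow> (nat \<Rightarrow> nat) \<Rightarrow> (nat \<Rightarrow> nat) \<Rightarrow> nat \<Rightarrow> bool" where
  "bfs_post A u p0 T0 d T p \<longleftrightarrow> tree_inv A u p0 d T p \<and> (\<forall>q<p0. T q = T0 q) \<and>
     (\<forall>i<n. \<forall>v<n. (adj en A ^^ i) u v \<longrightarrow> d v \<noteq> 0 \<and> d v \<le> Suc i)"

lemma en_subset: "e < m \<Longrightarrow> en e \<subseteq> {..<n}"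
  using a_less b_less by (auto simp: en_def)

text \<open>An unreached \<open>y\<close> is isolated in the tree, so an edge to it closes no
  cycle.\<close>

lemma tree_inv_extend:
  assumes t: "tree_inv A u p0 d T p" and e: "e \<in> A" "A \<subseteq> {..<m}" "en e = {x, y}"
    and x: "d x = Suc i" and y: "d y = 0"
  shows "tree_inv A u p0 (d(y := i + 2)) (T(p := e)) (Suc p)"
proof -
  let ?F = "T ` {p0..<p}" and ?F' = "(T(p := e)) ` {p0..<Suc p}"
  have p: "p0 \<le> p" using t by (simp add: tree_inv_def)
  then have F': "?F' = insert e ?F" by (auto simp: atLeastLessThanSuc image_iff)
  have xy: "x < n" "y < n" using en_subset[of e] e by auto
  have "x \<noteq> y" using x y by auto
  have iso: "v = y \<Longrightarrow> \<not> adj en ?F w v" for v w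
    using t y unfolding tree_inv_def adj_def by blast
  have "\<not> conn en ?F x y"
  proof
    assume "conn en ?F x y"
    then show False using iso[of y] \<open>x \<noteq> y\<close> by (cases rule: rtranclp.cases) auto
  qed
  then have "forest en ?F'" unfolding F' using t e(3) by (intro forest_insert) (auto simp: tree_inv_def)
  moreover have "{v. v < n \<and> (d(y := i + 2)) v \<noteq> 0} = insert y {v. v < n \<and> d v \<noteq> 0}"
    using xy by auto
  then have "card {v. v < n \<and> (d(y := i + 2)) v \<noteq> 0} = Suc (card {v. v < n \<and> d v \<noteq> 0})"
    using y by simp
  moreover have "(adj en ?F' ^^ ((d(y := i + 2)) v - 1)) u v" if v: "v < n" "(d(y := i + 2)) v \<noteq> 0" for v
  proof (cases "v = y")
    case True
    have "(adj en ?F ^^ i) u x" using t xy x unfolding tree_inv_def by fastforce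
    then have "(adj en ?F' ^^ i) u x" by (rule relpowp_adj_mono) (auto simp: F')
    moreover have "adj en ?F' x y" using e(3) unfolding F' adj_def by blast
    ultimately show ?thesis using True by (auto intro: relpowp_Suc_I)
  next
    case False
    then have "(adj en ?F ^^ (d v - 1)) u v" using t v unfolding tree_inv_def by auto
    then have "(adj en ?F' ^^ (d v - 1)) u v" by (rule relpowp_adj_mono) (auto simp: F')
    then show ?thesis using False by simp
  qed
  moreover have "\<forall>f\<in>?F'. \<forall>v\<in>en f. (d(y := i + 2)) v \<noteq> 0"
    using t e(3) x unfolding F' tree_inv_def by auto
  moreover have "?F' \<subseteq> A" using t e(1) unfolding F' tree_inv_def by auto
  moreover have "Suc (Suc p - p0) = Suc (card {v. v < n \<and> d v \<noteq> 0})"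
    using t p unfolding tree_inv_def by (simp add: Suc_diff_le)
  ultimately show ?thesis using p unfolding tree_inv_def by simp
qed

lemma round_inv_extend:
  assumes r: "round_inv A u p0 T0 i d T p" and e: "e \<in> A" "A \<subseteq> {..<m}" "en e = {x, y}"
    and x: "d x = Suc i" and y: "d y = 0"
  shows "round_inv A u p0 T0 i (d(y := i + 2)) (T(p := e)) (Suc p)"
proof -
  have t: "tree_inv A u p0 d T p" "\<forall>q<p0. T q = T0 q" "d u = 1" "\<forall>v<n. d v \<le> i + 2"
    and c: "\<And>v w. d v \<noteq> 0 \<Longrightarrow> d v \<le> i \<Longrightarrow> adj en A v w \<Longrightarrow> d w \<noteq> 0 \<and> d w \<le> d v + 1"
    using r by (auto simp: round_inv_def)
  have "p0 \<le> p" using t(1) by (simp add: tree_inv_def)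
  then have "\<forall>q<p0. (T(p := e)) q = T0 q" using t(2) by simp
  moreover have "(d(y := i + 2)) u = 1" "\<forall>v<n. (d(y := i + 2)) v \<le> i + 2" using t(3,4) y by auto
  moreover have "(d(y := i + 2)) w \<noteq> 0 \<and> (d(y := i + 2)) w \<le> (d(y := i + 2)) v + 1"
    if "(d(y := i + 2)) v \<noteq> 0" "(d(y := i + 2)) v \<le> i" "adj en A v w" for v w
  proof -
    have "v \<noteq> y" using that(2) by auto
    then show ?thesis using c[of v w] that y by auto
  qed
  ultimately show ?thesis unfolding round_inv_def using tree_inv_extend[OF t(1) e x y] by blast
qed

text \<open>The last two facts carry the record of handled edges across later relaxations: round
  \<open>i\<close> writes only the entry \<open>i + 2\<close>, so it neither creates vertices to
  expand nor makes a vertex unreached.\<close>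

lemma exec_relax:
  assumes r: "round_inv A u p0 T0 i (s ''d'') (s ''T'') (s ''p'' 0)"
    and e: "s ''e'' 0 \<in> A" "A \<subseteq> {..<m}" "en (s ''e'' 0) = {s x (s ''e'' 0), s y (s ''e'' 0)}"
    and b: "s ''b'' 0 = i" and xy: "x \<in> {''fst'', ''snd''}" "y \<in> {''fst'', ''snd''}"
  defines "s' \<equiv> exec (relax x y) s"
  shows "round_inv A u p0 T0 i (s' ''d'') (s' ''T'') (s' ''p'' 0)"
    and "s' ''d'' (s x (s ''e'' 0)) = Suc i \<Longrightarrow> s' ''d'' (s y (s ''e'' 0)) \<noteq> 0"
    and "\<And>z. z \<notin> {''d'', ''T'', ''p''} \<Longrightarrow> s' z = s z"
    and "\<And>v. s ''d'' v \<noteq> 0 \<Longrightarrow> s' ''d'' v \<noteq> 0"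
    and "\<And>v. s' ''d'' v = Suc i \<Longrightarrow> s ''d'' v = Suc i"
proof -
  let ?x = "s x (s ''e'' 0)" and ?y = "s y (s ''e'' 0)"
  have "round_inv A u p0 T0 i (s' ''d'') (s' ''T'') (s' ''p'' 0) \<and>
    (s' ''d'' ?x = Suc i \<longrightarrow> s' ''d'' ?y \<noteq> 0) \<and> (\<forall>z. z \<notin> {''d'', ''T'', ''p''} \<longrightarrow> s' z = s z) \<and>
    (\<forall>v. s ''d'' v \<noteq> 0 \<longrightarrow> s' ''d'' v \<noteq> 0) \<and> (\<forall>v. s' ''d'' v = Suc i \<longrightarrow> s ''d'' v = Suc i)"
  proof (cases "s ''d'' ?x = Suc i \<and> s ''d'' ?y = 0")
    case True
    have "s' = update (update (update s ''d'' ?y (i + 2)) ''T'' (s ''p'' 0) (s ''e'' 0)) ''p'' 0 (Suc (s ''p'' 0))"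
      using True b xy by (auto simp: s'_def relax_def)
    then have s': "s' ''d'' = (s ''d'')(?y := i + 2)" "s' ''T'' = (s ''T'')(s ''p'' 0 := s ''e'' 0)"
      "s' ''p'' 0 = Suc (s ''p'' 0)" and fr: "\<And>z. z \<notin> {''d'', ''T'', ''p''} \<Longrightarrow> s' z = s z"
      by (simp_all add: fun_eq_iff)
    have "round_inv A u p0 T0 i (s' ''d'') (s' ''T'') (s' ''p'' 0)"
      unfolding s' using round_inv_extend[OF r e] True by simp
    then show ?thesis using fr s'(1) True by simp
  next
    case False
    then have "s' = s" using b by (auto simp: s'_def relax_def)
    then show ?thesis using r False by auto
  qed
  then show "round_inv A u p0 T0 i (s' ''d'') (s' ''T'') (s' ''p'' 0)"
    and "s' ''d'' (s x (s ''e'' 0)) = Suc i \<Longrightarrow> s' ''d'' (s y (s ''e'' 0)) \<noteq> 0"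
    and "\<And>z. z \<notin> {''d'', ''T'', ''p''} \<Longrightarrow> s' z = s z"
    and "\<And>v. s ''d'' v \<noteq> 0 \<Longrightarrow> s' ''d'' v \<noteq> 0"
    and "\<And>v. s' ''d'' v = Suc i \<Longrightarrow> s ''d'' v = Suc i"
    by blast+
qed

lemma bfs_body:
  assumes r: "round_inv A u p0 T0 i (s ''d'') (s ''T'') (s ''p'' 0)"
    and e: "s ''e'' 0 = j" "j < m" "A \<subseteq> {..<m}" and inp: "input s"
    and b: "s ''b'' 0 = i" and allowed: "bval allowed s \<longleftrightarrow> j \<in> A"
    and past: "\<forall>f v w. f \<in> A \<longrightarrow> f < j \<longrightarrow> en f = {v, w} \<longrightarrow> s ''d'' v = Suc i \<longrightarrow> s ''d'' w \<noteq> 0"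
  defines "s' \<equiv> exec (If allowed (Seq (relax ''fst'' ''snd'') (relax ''snd'' ''fst'')) SKIP) s"
  shows "round_inv A u p0 T0 i (s' ''d'') (s' ''T'') (s' ''p'' 0) \<and>
    (\<forall>f v w. f \<in> A \<longrightarrow> f < Suc j \<longrightarrow> en f = {v, w} \<longrightarrow> s' ''d'' v = Suc i \<longrightarrow> s' ''d'' w \<noteq> 0) \<and>
    (\<forall>z. z \<notin> {''d'', ''T'', ''p''} \<longrightarrow> s' z = s z)"
proof (cases "j \<in> A")
  case False
  then have "s' = s" using allowed by (simp add: s'_def)
  then show ?thesis using r past False by (auto simp: less_Suc_eq)
next
  case True
  define s1 where "s1 = exec (relax ''fst'' ''snd'') s"
  have s': "s' = exec (relax ''snd'' ''fst'') s1" using True allowed by (simp add: s'_def s1_def)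
  have fs: "s ''fst'' = a" "s ''snd'' = b" using inp by (auto simp: input_def)
  have enj: "en j = {a j, b j}" "en j = {b j, a j}" by (auto simp: en_def)
  have "s ''e'' 0 \<in> A" "en (s ''e'' 0) = {s ''fst'' (s ''e'' 0), s ''snd'' (s ''e'' 0)}"
    using True e fs enj by auto
  note 1 = exec_relax[OF r this(1) e(3) this(2) b, simplified, folded s1_def]
  have s1: "s1 ''e'' 0 = j" "s1 ''b'' 0 = i" "s1 ''fst'' = a" "s1 ''snd'' = b"
    using 1(3) e b fs by auto
  have "s1 ''e'' 0 \<in> A" "en (s1 ''e'' 0) = {s1 ''snd'' (s1 ''e'' 0), s1 ''fst'' (s1 ''e'' 0)}"
    using True s1 enj by auto
  note 2 = exec_relax[OF 1(1) this(1) e(3) this(2) s1(2), simplified, folded s']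
  have "s' ''d'' w \<noteq> 0" if f: "f \<in> A" "f < Suc j" "en f = {v, w}" "s' ''d'' v = Suc i" for f v w
  proof (cases "f = j")
    case True
    then have "v = a j \<and> w = b j \<or> v = b j \<and> w = a j" using f(3) enj by (auto simp: doubleton_eq_iff)
    then show ?thesis using 1(2) 2(2,4,5) f(4) s1 e fs by auto
  next
    case False
    then have "s ''d'' w \<noteq> 0" using past 1(5) 2(5) f by (metis less_SucE)
    then show ?thesis using 1(4) 2(4) by simp
  qed
  then show ?thesis using 2(1,3) 1(3) by simp
qed

lemma round_inv_post:
  assumes r: "round_inv A u p0 T0 n d T p" and u: "u < n"
  shows "bfs_post A u p0 T0 d T p"
proof -
  have "d v \<noteq> 0 \<and> d v \<le> Suc i" if "i < n" "(adj en A ^^ i) u v" for i v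
    using that
  proof (induction i arbitrary: v)
    case 0
    then show ?case using r by (auto simp: round_inv_def)
  next
    case (Suc i)
    then obtain w where w: "(adj en A ^^ i) u w" "adj en A w v" by (auto elim: relpowp_Suc_E)
    then have "d w \<noteq> 0 \<and> d w \<le> Suc i" using Suc by simp
    then show ?case using r w(2) Suc.prems(1) unfolding round_inv_def by fastforce
  qed
  then show ?thesis using r by (auto simp: round_inv_def bfs_post_def)
qed

lemma bfs_post_conn:
  assumes p: "bfs_post A u p0 T0 d T p" and A: "A \<subseteq> {..<m}" and uv: "u < n" "v < n"
  shows "d v \<noteq> 0 \<longleftrightarrow> conn en A u v"
proof
  assume "d v \<noteq> 0"
  then have "conn en (T ` {p0..<p}) u v" using p uv unfolding bfs_post_def tree_inv_def
    by (meson relpowp_imp_rtranclp)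
  then show "conn en A u v" using p conn_mono unfolding bfs_post_def tree_inv_def by metis
next
  assume "conn en A u v"
  then obtain i where "i < card {..<n}" "(adj en A ^^ i) u v"
    using conn_relpowp_less[of en A u v "{..<n}"] uv A en_subset by blast
  then show "d v \<noteq> 0" using p uv unfolding bfs_post_def by auto
qed

lemma wp_bfs:
  assumes inp: "input s" and u: "s ''u'' 0 < n" and A: "A \<subseteq> {..<m}" and N: "n \<le> N" "m \<le> N"
    and allowed: "\<And>s'. \<lbrakk>\<And>x. x \<notin> bfs_vars \<Longrightarrow> s' x = s x; s' ''e'' 0 < m\<rbrakk> \<Longrightarrow> bval allowed s' \<longleftrightarrow> s' ''e'' 0 \<in> A"
    and Q: "\<And>s'. \<lbrakk>\<And>x. x \<notin> bfs_vars \<Longrightarrow> s' x = s x;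
      bfs_post A (s ''u'' 0) (s ''p'' 0) (s ''T'') (s' ''d'') (s' ''T'') (s' ''p'' 0)\<rbrakk> \<Longrightarrow> Q s'"
  shows "wp (bfs allowed) (bfs_time N) Q s"
proof -
  define frame where "frame s' \<longleftrightarrow> (\<forall>x. x \<notin> bfs_vars \<longrightarrow> s' x = s x)" for s'
  have frame_upd: "frame (update s' x i y) \<longleftrightarrow> frame s'" if "x \<in> bfs_vars" for s' x i y
    using that unfolding frame_def update_def by (metis fun_upd_other)
  have frame_input: "frame s' \<Longrightarrow> input s' \<and> s' ''u'' 0 = s ''u'' 0" for s'
    using inp by (simp add: frame_def input_def bfs_vars_def)
  have bv: "''d'' \<in> bfs_vars" "''T'' \<in> bfs_vars" "''p'' \<in> bfs_vars" "''v'' \<in> bfs_vars"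
    "''b'' \<in> bfs_vars" "''e'' \<in> bfs_vars" by (auto simp: bfs_vars_def)
  let ?u = "s ''u'' 0" and ?p = "s ''p'' 0" and ?T = "s ''T''"
  let ?R = "\<lambda>i s'. round_inv A ?u ?p ?T i (s' ''d'') (s' ''T'') (s' ''p'' 0)"
  let ?body = "If allowed (Seq (relax ''fst'' ''snd'') (relax ''snd'' ''fst'')) SKIP"
  let ?inner = "For ''e'' (var ''m'') ?body"
  \<comment> \<open>Between rounds, \<open>J i\<close> bounds the reached distances by
    \<open>i\<close>. Within a round, \<open>I i j\<close> allows \<open>i + 1\<close> and records
    that the edges below \<open>j\<close> have been relaxed from all vertices at distance
    \<open>i\<close>.\<close>
  define J where "J i s' \<longleftrightarrow> frame s' \<and> ?R i s' \<and> (\<forall>v<n. s' ''d'' v \<le> Suc i)" for i s'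
  define I where "I i j s' \<longleftrightarrow> frame s' \<and> ?R i s' \<and> s' ''b'' 0 = i \<and>
      (\<forall>f v w. f \<in> A \<longrightarrow> f < j \<longrightarrow> en f = {v, w} \<longrightarrow> s' ''d'' v = Suc i \<longrightarrow> s' ''d'' w \<noteq> 0)" for i j s'
  have inner: "wp ?inner (for_time N 20) (\<lambda>s'. s' ''b'' 0 = i \<and> J (Suc i) s') s1"
    if s1: "J i s1" "s1 ''b'' 0 = i" for i s1
  proof (rule wp_For[where K = m and I = "I i"])
    show "aval (var ''m'') (update s1 ''e'' 0 0) = m"
      using frame_input[of s1] s1 by (simp add: J_def input_def)
    fix j s' assume j: "j < m" "s' ''e'' 0 = j"
      and Ij: "I i j s'"
    have al: "bval allowed s' \<longleftrightarrow> j \<in> A" using allowed[of s'] Ij j by (auto simp: frame_def I_def)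
    have inp': "input s'" using Ij frame_input by (simp add: I_def)
    have I': "?R i s'" "s' ''b'' 0 = i" "frame s'" and
      past: "\<forall>f v w. f \<in> A \<longrightarrow> f < j \<longrightarrow> en f = {v, w} \<longrightarrow> s' ''d'' v = Suc i \<longrightarrow> s' ''d'' w \<noteq> 0"
      using Ij unfolding I_def by auto
    note B = bfs_body[OF I'(1) j(2) j(1) A inp' I'(2) al past]
    let ?s = "exec ?body s'"
    have fr: "frame ?s"
      unfolding frame_def
    proof (intro allI impI)
      fix x assume "x \<notin> bfs_vars"
      then have "?s x = s' x" using B by (simp add: bfs_vars_def del: exec.simps)
      then show "?s x = s x" using I'(3) \<open>x \<notin> bfs_vars\<close> by (simp add: frame_def)
    qed
    show "wp ?body 20 (for_step ''e'' (var ''m'') m (I i) j) s'"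
    proof (rule wp_straight)
      show "for_step ''e'' (var ''m'') m (I i) j ?s"
        using B I' j fr frame_input[OF fr]
        by (simp add: for_step_def I_def frame_upd bv input_def del: exec.simps)
    qed (auto simp: relax_def)
  next
    fix s' assume "I i m s'"
    then have I: "frame s'" "?R i s'" "s' ''b'' 0 = i"
      "\<forall>f v w. f \<in> A \<longrightarrow> f < m \<longrightarrow> en f = {v, w} \<longrightarrow> s' ''d'' v = Suc i \<longrightarrow> s' ''d'' w \<noteq> 0"
      by (auto simp: I_def)
    have "s' ''d'' w \<noteq> 0 \<and> s' ''d'' w \<le> s' ''d'' v + 1"
      if vw: "s' ''d'' v \<noteq> 0" "s' ''d'' v \<le> Suc i" "adj en A v w" for v w
    proof (cases "s' ''d'' v = Suc i")
      case True
      obtain f where f: "f \<in> A" "en f = {v, w}" using vw by (auto simp: adj_def)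
      then have "w < n" using A en_subset[of f] by auto
      then have "s' ''d'' w \<le> i + 2" using I by (auto simp: round_inv_def)
      moreover have "s' ''d'' w \<noteq> 0" using I f A True by auto
      ultimately show ?thesis using True by simp
    next
      case False
      then show ?thesis using vw I by (auto simp: round_inv_def)
    qed
    then show "s' ''b'' 0 = i \<and> J (Suc i) s'" using I by (fastforce simp: J_def round_inv_def)
  qed (use s1 N bv in \<open>simp_all add: I_def J_def frame_upd\<close>)
  have outer: "wp (For ''b'' (var ''n'') ?inner) (for_time N (for_time N 20)) Q s1" if s1: "J 0 s1" for s1
  proof (rule wp_For[where K = n and I = J])
    show "aval (var ''n'') (update s1 ''b'' 0 0) = n"
      using frame_input[of s1] s1 by (simp add: J_def input_def)
    fix i s' assume i: "s' ''b'' 0 = i" "J i s'"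
    show "wp ?inner (for_time N 20) (for_step ''b'' (var ''n'') n J i) s'"
    proof (rule wp_mono[OF inner[OF i(2,1)] order_refl])
      fix s2 assume "s2 ''b'' 0 = i \<and> J (Suc i) s2"
      then show "for_step ''b'' (var ''n'') n J i s2"
        using frame_input[of s2] by (simp add: for_step_def J_def input_def frame_upd bv)
    qed
  next
    fix s' assume "J n s'"
    then show "Q s'" using round_inv_post[OF _ u] by (intro Q) (auto simp: J_def frame_def)
  qed (use s1 N bv in \<open>auto simp: J_def frame_upd\<close>)
  have start: "J 0 (update s1 ''d'' ?u 1)"
    if s1: "frame s1" "s1 ''T'' = ?T" "s1 ''p'' 0 = ?p" "\<forall>v<n. s1 ''d'' v = 0" for s1
  proof -
    have "{v. v < n \<and> ((s1 ''d'')(?u := 1)) v \<noteq> 0} = {?u}" using s1 u by auto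
    then have "Suc (?p - ?p) = card {v. v < n \<and> ((s1 ''d'')(?u := 1)) v \<noteq> 0}" by (simp only:) simp
    moreover have "\<forall>v<n. ((s1 ''d'')(?u := 1)) v \<noteq> 0 \<longrightarrow>
        (adj en (?T ` {?p..<?p}) ^^ (((s1 ''d'')(?u := 1)) v - 1)) ?u v"
      using s1(4) by simp
    ultimately have "tree_inv A ?u ?p ((s1 ''d'')(?u := 1)) ?T ?p"
      unfolding tree_inv_def by (intro conjI) (auto simp only: forest_def, auto)
    then show ?thesis using s1 u by (auto simp: J_def round_inv_def frame_upd bv)
  qed
  let ?C = "\<lambda>i s1. frame s1 \<and> s1 ''T'' = ?T \<and> s1 ''p'' 0 = ?p \<and> (\<forall>v<i. s1 ''d'' v = 0)"
  have clear: "wp (For ''v'' (var ''n'') (Store ''d'' (var ''v'') (Num 0))) (for_time N 1)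
      (?C n) s"
  proof (rule wp_For[where K = n and I = ?C])
    have "frame s" by (simp add: frame_def)
    then show "?C 0 (update s ''v'' 0 0)" using bv by (simp add: frame_upd)
    show "aval (var ''n'') (update s ''v'' 0 0) = n" using inp by (simp add: input_def)
    fix i s1 assume "s1 ''v'' 0 = i" "aval (var ''n'') s1 = n" "?C i s1"
    then show "wp (Store ''d'' (var ''v'') (Num 0)) 1 (for_step ''v'' (var ''n'') n ?C i) s1"
      using bv by (intro wp_straight) (simp_all add: for_step_def frame_upd less_Suc_eq)
  qed (use N in auto)
  have "wp (bfs allowed) (Suc (for_time N 1 + Suc (1 + for_time N (for_time N 20)))) Q s"
    unfolding bfs_def
  proof (rule wp_Seq, rule wp_mono[OF clear order_refl])
    fix s1 assume s1: "?C n s1"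
    then have "aval (var ''u'') s1 = ?u" using frame_input[of s1] by simp
    then show "wp (Seq (Store ''d'' (var ''u'') (Num 1)) (For ''b'' (var ''n'') ?inner))
        (Suc (1 + for_time N (for_time N 20))) Q s1"
      using s1 start outer by - (rule wp_Seq, rule wp_straight, auto)
  qed
  then show ?thesis by (rule wp_mono) (auto simp: bfs_time_def)
qed

end

section \<open>The packing program\<close>

text \<open>One counter \<open>z\<close> serves two questions about \<open>x\<close>. Below
  \<open>m\<close> it names an edge that might be exchanged for \<open>x\<close>; the values
  \<open>m\<close> to \<open>m + h - 1\<close> stand for the colours 1 to \<open>h\<close> to which
  \<open>x\<close> might be added.\<close>

definition probe_setup :: com where
  "probe_setup =
     Seq (If (Less (var ''z'') (var ''m'')) (assign ''c'' (Cell ''col'' (var ''z'')))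
       (assign ''c'' (Minus (Plus (var ''z'') (Num 1)) (var ''m''))))
    (Seq (assign ''u'' (Cell ''fst'' (var ''x''))) (assign ''p'' (Num 0)))"

definition probe_allowed :: bexp where
  "probe_allowed = And (Eq (Cell ''col'' (var ''e'')) (var ''c'')) (Not (Eq (var ''e'') (var ''z'')))"

text \<open>The search from one end of \<open>x\<close> missed the other end, so the tested set does
  not span \<open>x\<close>. Labels \<open>lev\<close> are levels plus one, with 0 for unlabelled;
  \<open>done\<close> freezes everything after the first augmentation.\<close>

definition probe_update :: com where
  "probe_update =
     If (And (Eq (Cell ''d'' (Cell ''snd'' (var ''x''))) (Num 0)) (Eq (var ''done'') (Num 0)))
       (If (Less (var ''z'') (var ''m''))
         (If (Eq (Cell ''lev'' (var ''z'')) (Num 0)) (Store ''lev'' (var ''z'') (Plus (var ''l'') (Num 2))) SKIP)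
         (Seq (Store ''col'' (var ''x'') (var ''c'')) (assign ''done'' (Num 1))))
       SKIP"

definition probe :: com where
  "probe = Seq probe_setup (Seq (bfs probe_allowed) probe_update)"

text \<open>In round \<open>l\<close> the labels 1 to \<open>l + 1\<close> belong to levels up to
  \<open>l\<close>, while \<open>l + 2\<close> marks an edge found in this round, which has to wait
  for the next.\<close>

definition scan :: com where
  "scan = If (And (Less (Num 0) (Cell ''lev'' (var ''x''))) (Less (Cell ''lev'' (var ''x'')) (Plus (var ''l'') (Num 2))))
     (For ''z'' (Plus (var ''m'') (var ''h'')) probe) SKIP"

text \<open>The \<open>m + 1\<close> rounds examine the levels 0 to \<open>m\<close>; by
  \<open>level_stable\<close> no later level contains anything new.\<close>

definition improve :: com where
  "improve =
     Seq (assign ''done'' (Num 0))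
    (Seq (For ''y'' (var ''m'') (If (Eq (Cell ''col'' (var ''y'')) (Num 0))
        (Store ''lev'' (var ''y'') (Num 1)) (Store ''lev'' (var ''y'') (Num 0))))
      (For ''l'' (Plus (var ''m'') (Num 1)) (For ''x'' (var ''m'') scan)))"

text \<open>The potential is below \<open>(m + 1)^2\<close>, and two nested loops count that far
  without multiplication.\<close>

definition pack :: com where
  "pack = For ''i'' (Plus (var ''m'') (Num 1)) (For ''j'' (Plus (var ''m'') (Num 1)) improve)"

definition probe_time :: "nat \<Rightarrow> nat" where
  "probe_time N = bfs_time N + 20"

definition improve_time :: "nat \<Rightarrow> nat" where
  "improve_time N = for_time N 2 + for_time N (for_time N (Suc (for_time N (probe_time N)))) + 3"

definition pack_time :: "nat \<Rightarrow> nat" where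
  "pack_time N = for_time N (for_time N (improve_time N))"

section \<open>Correctness of the packing program\<close>

locale packing_graph = input_graph n m a b for n m :: nat and a b :: "nat \<Rightarrow> nat" +
  fixes h :: nat
begin

sublocale forest_packing en "{..<n}" "{..<m}" h
  by standard (use a_less b_less in \<open>auto simp: en_def\<close>)

definition pack_input :: "state \<Rightarrow> bool" where
  "pack_input s \<longleftrightarrow> input s \<and> s ''h'' 0 = h"

definition probe_class :: "(nat \<Rightarrow> nat) \<Rightarrow> nat \<Rightarrow> nat set" where
  "probe_class col z = colour_class col (if z < m then col z else Suc z - m) - {z}"

definition probe_vars :: "string set" where
  "probe_vars = bfs_vars \<union> {''c'', ''u'', ''lev'', ''col'', ''done''}"

lemma wp_probe:
  fixes s :: state
  defines "x \<equiv> s ''x'' 0" and "z \<equiv> s ''z'' 0" and "col \<equiv> s ''col''" and "lev \<equiv> s ''lev''"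
  assumes inp: "pack_input s" and x: "x < m" and N: "n \<le> N" "m \<le> N"
    and Q: "\<And>s'. \<lbrakk>\<And>v. v \<notin> probe_vars \<Longrightarrow> s' v = s v;
      \<not> spans en (probe_class col z) x \<and> s ''done'' 0 = 0 \<Longrightarrow> z < m \<Longrightarrow>
        s' ''col'' = col \<and> s' ''done'' 0 = 0 \<and> s' ''lev'' = (if lev z = 0 then lev(z := s ''l'' 0 + 2) else lev);
      \<not> spans en (probe_class col z) x \<and> s ''done'' 0 = 0 \<Longrightarrow> \<not> z < m \<Longrightarrow>
        s' ''col'' = col(x := Suc z - m) \<and> s' ''done'' 0 = 1;
      \<not> (\<not> spans en (probe_class col z) x \<and> s ''done'' 0 = 0) \<Longrightarrow>
        s' ''col'' = col \<and> s' ''done'' 0 = s ''done'' 0 \<and> s' ''lev'' = lev\<rbrakk> \<Longrightarrow> Q s'"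
  shows "wp probe (probe_time N) Q s"
proof -
  let ?c = "if z < m then col z else Suc z - m"
  have inp': "input s" "s ''h'' 0 = h" "s ''m'' 0 = m" "s ''fst'' = a" "s ''snd'' = b"
    using inp by (auto simp: pack_input_def input_def)
  define s1 where "s1 = exec probe_setup s"
  have s1: "s1 ''c'' 0 = ?c" "s1 ''u'' 0 = a x" "s1 ''p'' 0 = 0"
    and s1': "\<And>v. v \<notin> {''c'', ''u'', ''p''} \<Longrightarrow> s1 v = s v"
    using inp' by (auto simp: s1_def probe_setup_def x_def z_def col_def)
  have bfs: "wp (bfs probe_allowed) (bfs_time N) (wp probe_update 10 Q) s1"
  proof (rule wp_bfs[where A = "probe_class col z"])
    show "input s1" using inp' s1' by (simp add: input_def)
    show "s1 ''u'' 0 < n" using s1 a_less x by simp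
    show "probe_class col z \<subseteq> {..<m}" by (auto simp: probe_class_def colour_class_def)
    fix s' assume s': "\<And>v. v \<notin> bfs_vars \<Longrightarrow> s' v = s1 v" and e: "s' ''e'' 0 < m"
    have "s' ''col'' = col" "s' ''c'' 0 = ?c" "s' ''z'' 0 = z"
      using s' s1 s1' by (simp_all add: bfs_vars_def col_def z_def)
    then show "bval probe_allowed s' \<longleftrightarrow> s' ''e'' 0 \<in> probe_class col z"
      using e by (simp add: probe_allowed_def probe_class_def colour_class_def)
  next
    fix s2 assume s2: "\<And>v. v \<notin> bfs_vars \<Longrightarrow> s2 v = s1 v"
      and post: "bfs_post (probe_class col z) (s1 ''u'' 0) (s1 ''p'' 0) (s1 ''T'') (s2 ''d'') (s2 ''T'') (s2 ''p'' 0)"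
    have d: "s2 ''d'' (b x) = 0 \<longleftrightarrow> \<not> spans en (probe_class col z) x"
    proof -
      have "probe_class col z \<subseteq> {..<m}" by (auto simp: probe_class_def colour_class_def)
      moreover have "s1 ''u'' 0 < n" using s1 a_less[OF x] by simp
      ultimately show ?thesis
        using bfs_post_conn[OF post _ _ b_less[OF x]] s1(2)
        by (auto simp: spans_iff en_def)
    qed
    have v2: "s2 ''x'' 0 = x" "s2 ''z'' 0 = z" "s2 ''m'' 0 = m" "s2 ''snd'' = b" "s2 ''done'' 0 = s ''done'' 0"
      "s2 ''lev'' = lev" "s2 ''col'' = col" "s2 ''c'' 0 = ?c" "s2 ''l'' 0 = s ''l'' 0"
      using s2 s1 s1' inp' by (simp_all add: bfs_vars_def x_def z_def lev_def col_def)
    let ?s = "exec probe_update s2"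
    show "wp probe_update 10 Q s2"
    proof (rule wp_straight)
      show "Q ?s"
      proof (rule Q)
        fix v assume "v \<notin> probe_vars"
        then have v: "v \<notin> bfs_vars" "v \<notin> {''c'', ''u'', ''lev'', ''col'', ''done'', ''p''}"
          by (auto simp: probe_vars_def bfs_vars_def)
        have "?s v = s2 v" using v(2) by (auto simp: probe_update_def)
        then show "?s v = s v" using v s2 s1' by simp
      qed (use v2 d in \<open>simp_all add: probe_update_def fun_eq_iff\<close>)
    qed (auto simp: probe_update_def)
  qed (use N in auto)
  have "wp probe (Suc (8 + Suc (bfs_time N + 10))) Q s"
    unfolding probe_def
  proof (rule wp_Seq, rule wp_straight)
    show "wp (Seq (bfs probe_allowed) probe_update) (Suc (bfs_time N + 10)) Q (exec probe_setup s)"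
      using bfs unfolding s1_def by (rule wp_Seq)
  qed (auto simp: probe_setup_def)
  then show ?thesis by (rule wp_mono) (auto simp: probe_time_def)
qed

text \<open>\<open>W\<close> and \<open>C\<close> are the pairs of an edge of the current level and a candidate for the next level,
  respectively a colour, that have been examined so far.\<close>

definition search_inv :: "(nat \<Rightarrow> nat) \<Rightarrow> nat \<Rightarrow> (nat \<Rightarrow> nat \<Rightarrow> bool) \<Rightarrow> (nat \<Rightarrow> nat \<Rightarrow> bool) \<Rightarrow> (nat \<Rightarrow> nat) \<Rightarrow> (nat \<Rightarrow> nat) \<Rightarrow> nat \<Rightarrow> bool" where
  "search_inv col0 l W C col lev fin \<longleftrightarrow>
     fin \<noteq> 0 \<and> (\<exists>t x c. augments col0 t x c \<and> col = col0(x := c)) \<or>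
     fin = 0 \<and> col = col0 \<and> (\<forall>r<l. \<forall>w\<in>level col0 r. \<not> addable col0 w) \<and>
     (\<forall>w\<in>level col0 l. \<forall>c\<in>{1..h}. C w c \<longrightarrow> spans en (colour_class col0 c) w) \<and>
     (\<forall>y<m. lev y \<le> l + 2 \<and> (0 < lev y \<and> lev y < l + 2 \<longleftrightarrow> y \<in> level col0 l) \<and>
       (lev y = l + 2 \<longleftrightarrow> y \<notin> level col0 l \<and> (\<exists>w\<in>level col0 l. W w y \<and> exchangeable col0 w y)))"

text \<open>After an augmentation the bookkeeping is irrelevant, so agreement matters only while
  \<open>fin = 0\<close> and only for edges of the current level.\<close>

lemma search_inv_cong:
  assumes "search_inv col0 l W C col lev fin"
    and "\<And>w y. fin = 0 \<Longrightarrow> w \<in> level col0 l \<Longrightarrow> y < m \<Longrightarrow> W w y \<longleftrightarrow> W' w y"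
    and "\<And>w c. fin = 0 \<Longrightarrow> w \<in> level col0 l \<Longrightarrow> c \<in> {1..h} \<Longrightarrow> C' w c \<Longrightarrow> C w c"
  shows "search_inv col0 l W' C' col lev fin"
  using assms unfolding search_inv_def by (elim disjE) (blast, auto)

lemma search_inv_mark:
  assumes I: "search_inv col0 l W C col lev 0" and x: "x \<in> level col0 l" and z: "z < m"
    and disc: "\<not> spans en (probe_class col z) x"
  shows "search_inv col0 l (\<lambda>w y. W w y \<or> w = x \<and> y = z) C col (if lev z = 0 then lev(z := l + 2) else lev) 0"
proof -
  have col: "col = col0" using I by (simp add: search_inv_def)
  have zl: "lev z \<le> l + 2" "0 < lev z \<and> lev z < l + 2 \<longleftrightarrow> z \<in> level col0 l"
    using I z by (auto simp: search_inv_def)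
  \<comment> \<open>An uncovered \<open>z\<close> is probed as well, although it cannot be
    exchanged; being of level 0, it is already labelled and is never marked.\<close>
  have ex: "exchangeable col0 x z" if "z \<notin> level col0 l"
  proof -
    have "z \<notin> level col0 0" using that level_mono[of 0 l col0] by blast
    then have "col0 z \<noteq> 0" using z by (auto simp: colour_class_def)
    then show ?thesis using disc z col by (simp add: exchangeable_def probe_class_def)
  qed
  show ?thesis
  proof (cases "lev z = 0")
    case True
    then have "z \<notin> level col0 l" using zl by auto
    then show ?thesis using I ex x True unfolding search_inv_def by auto
  next
    case False
    have "(lev y = l + 2) \<longleftrightarrow> y \<notin> level col0 l \<and> (\<exists>w\<in>level col0 l. (W w y \<or> w = x \<and> y = z) \<and> exchangeable col0 w y)"
      if y: "y < m" for y
    proof (cases "y = z")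
      case True
      show ?thesis
      proof (cases "z \<in> level col0 l")
        case False
        then have "lev z = l + 2" using zl \<open>lev z \<noteq> 0\<close> by auto
        then show ?thesis using ex[OF False] x True False by auto
      next
        case z: True
        then show ?thesis using zl True by auto
      qed
    next
      case False
      then show ?thesis using I y unfolding search_inv_def by auto
    qed
    then show ?thesis using I False unfolding search_inv_def by auto
  qed
qed

lemma search_inv_unmarked:
  assumes I: "search_inv col0 l W C col lev 0" and z: "z < m"
    and disc: "spans en (probe_class col z) x"
  shows "search_inv col0 l (\<lambda>w y. W w y \<or> w = x \<and> y = z) C col lev 0"
proof -
  have "\<not> exchangeable col0 x z"
    using I z disc by (auto simp: search_inv_def exchangeable_def probe_class_def)
  then have "(\<exists>w\<in>level col0 l. (W w y \<or> w = x \<and> y = z) \<and> exchangeable col0 w y) \<longleftrightarrow>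
      (\<exists>w\<in>level col0 l. W w y \<and> exchangeable col0 w y)" for y by auto
  then show ?thesis using I unfolding search_inv_def by simp
qed

lemma search_inv_augment:
  assumes I: "search_inv col0 l W C col lev 0" and x: "x \<in> level col0 l" and z: "\<not> z < m" "z < m + h"
    and disc: "\<not> spans en (probe_class col z) x"
  shows "search_inv col0 l' W' C' (col(x := Suc z - m)) lev' 1"
proof -
  have "probe_class col z = colour_class col0 (Suc z - m)"
    using I z by (auto simp: search_inv_def probe_class_def colour_class_def)
  then have "augments col0 l x (Suc z - m)"
    using I x z disc by (auto simp: search_inv_def augments_def)
  then show ?thesis using I by (auto simp: search_inv_def)
qed

lemma search_inv_checked:
  assumes I: "search_inv col0 l W C col lev 0" and z: "\<not> z < m" and disc: "spans en (probe_class col z) x"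
  shows "search_inv col0 l W (\<lambda>w c. C w c \<or> w = x \<and> c + m = Suc z) col lev 0"
proof -
  have "spans en (colour_class col0 (Suc z - m)) x"
    using I z disc by (auto simp: search_inv_def probe_class_def elim: spans_mono)
  then have "spans en (colour_class col0 c) x" if "c + m = Suc z" for c
    using that by (metis add_diff_cancel_right')
  then show ?thesis using I unfolding search_inv_def by auto
qed

text \<open>The pairs before \<open>(x, z)\<close> in the order of the two loops. Colour
  \<open>c\<close> is probed at \<open>z = c + m - 1\<close>, hence that argument in
  \<open>search_at\<close>.\<close>

definition position :: "nat \<Rightarrow> nat \<Rightarrow> nat \<Rightarrow> nat \<Rightarrow> bool" where
  "position x z w y \<longleftrightarrow> w < x \<or> w = x \<and> y < z"

abbreviation search_at :: "(nat \<Rightarrow> nat) \<Rightarrow> nat \<Rightarrow> nat \<Rightarrow> nat \<Rightarrow> state \<Rightarrow> bool" where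
  "search_at col0 l x z s \<equiv> search_inv col0 l (position x z) (\<lambda>w c. position x z w (c + m - 1))
     (s ''col'') (s ''lev'') (s ''done'' 0)"

lemma search_at_Suc:
  assumes "search_inv col0 l (\<lambda>w y. position x z w y \<or> w = x \<and> y = z)
     (\<lambda>w c. position x z w (c + m - 1) \<or> w = x \<and> c + m = Suc z) col lev fin"
  shows "search_inv col0 l (position x (Suc z)) (\<lambda>w c. position x (Suc z) w (c + m - 1)) col lev fin"
  using assms by (rule search_inv_cong) (auto simp: position_def)

lemma wp_probe_search:
  assumes inp: "pack_input s" and x: "s ''x'' 0 = x" "x < m" and l: "s ''l'' 0 = l" and N: "n \<le> N" "m \<le> N"
    and z: "s ''z'' 0 = z" "z < m + h" and I: "search_at col0 l x z s"
    and xl: "s ''done'' 0 = 0 \<Longrightarrow> x \<in> level col0 l"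
    and Q: "\<And>s'. \<lbrakk>\<And>v. v \<notin> probe_vars \<Longrightarrow> s' v = s v; search_at col0 l x (Suc z) s';
      s' ''done'' 0 = 0 \<Longrightarrow> x \<in> level col0 l\<rbrakk> \<Longrightarrow> Q s'"
  shows "wp probe (probe_time N) Q s"
proof (rule wp_probe)
  show "s ''x'' 0 < m" using x by simp
  fix s' assume fr: "\<And>v. v \<notin> probe_vars \<Longrightarrow> s' v = s v"
    and 1: "\<not> spans en (probe_class (s ''col'') (s ''z'' 0)) (s ''x'' 0) \<and> s ''done'' 0 = 0 \<Longrightarrow> s ''z'' 0 < m \<Longrightarrow>
        s' ''col'' = s ''col'' \<and> s' ''done'' 0 = 0 \<and>
        s' ''lev'' = (if s ''lev'' (s ''z'' 0) = 0 then (s ''lev'')(s ''z'' 0 := s ''l'' 0 + 2) else s ''lev'')"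
    and 2: "\<not> spans en (probe_class (s ''col'') (s ''z'' 0)) (s ''x'' 0) \<and> s ''done'' 0 = 0 \<Longrightarrow> \<not> s ''z'' 0 < m \<Longrightarrow>
        s' ''col'' = (s ''col'')(s ''x'' 0 := Suc (s ''z'' 0) - m) \<and> s' ''done'' 0 = 1"
    and 3: "\<not> (\<not> spans en (probe_class (s ''col'') (s ''z'' 0)) (s ''x'' 0) \<and> s ''done'' 0 = 0) \<Longrightarrow>
        s' ''col'' = s ''col'' \<and> s' ''done'' 0 = s ''done'' 0 \<and> s' ''lev'' = s ''lev''"
  note 1 = 1[unfolded x(1) z(1) l] and 2 = 2[unfolded x(1) z(1)] and 3 = 3[unfolded x(1) z(1)]
  have C: "search_inv col0 l W (\<lambda>w c. position x z w (c + m - 1)) col lev fin \<Longrightarrow> z < m \<Longrightarrow>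
      search_inv col0 l W (\<lambda>w c. position x z w (c + m - 1) \<or> w = x \<and> c + m = Suc z) col lev fin" for W col lev fin
    by (erule search_inv_cong) auto
  have W: "search_inv col0 l (position x z) C col lev fin \<Longrightarrow> \<not> z < m \<Longrightarrow>
      search_inv col0 l (\<lambda>w y. position x z w y \<or> w = x \<and> y = z) C col lev fin" for C col lev fin
    by (erule search_inv_cong) auto
  have "search_at col0 l x (Suc z) s' \<and> (s' ''done'' 0 = 0 \<longrightarrow> x \<in> level col0 l)"
  proof (cases "s ''done'' 0 = 0")
    case False
    then have "search_at col0 l x (Suc z) s'" using I 3 by (auto simp: search_inv_def)
    then show ?thesis using 3 False by simp
  next
    case True
    note I0 = I[unfolded True] and xl = xl[OF True]
    show ?thesis
    proof (cases "spans en (probe_class (s ''col'') z) x")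
      case sp: True
      show ?thesis
      proof (cases "z < m")
        case True
        have "search_at col0 l x (Suc z) s"
          unfolding \<open>s ''done'' 0 = 0\<close>
          by (rule search_at_Suc[OF C[OF search_inv_unmarked[OF I0 True sp] True]])
        then show ?thesis using 3 sp xl by auto
      next
        case False
        have "search_at col0 l x (Suc z) s"
          unfolding \<open>s ''done'' 0 = 0\<close>
          by (rule search_at_Suc[OF W[OF search_inv_checked[OF I0 False sp] False]])
        then show ?thesis using 3 sp xl by auto
      qed
    next
      case sp: False
      show ?thesis
      proof (cases "z < m")
        case True
        have s': "s' ''col'' = s ''col''" "s' ''done'' 0 = 0"
          "s' ''lev'' = (if s ''lev'' z = 0 then (s ''lev'')(z := l + 2) else s ''lev'')"
          using 1 sp True \<open>s ''done'' 0 = 0\<close> by auto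
        show ?thesis unfolding s'
          using search_at_Suc[OF C[OF search_inv_mark[OF I0 xl True sp] True]] xl by simp
      next
        case False
        have s': "s' ''col'' = (s ''col'')(x := Suc z - m)" "s' ''done'' 0 = 1"
          using 2 sp False \<open>s ''done'' 0 = 0\<close> by auto
        show ?thesis unfolding s' using search_inv_augment[OF I0 xl False z(2) sp] by simp
      qed
    qed
  qed
  then show "Q s'" using fr by (intro Q) auto
qed (use inp N in auto)

definition pack_frame :: "state \<Rightarrow> state \<Rightarrow> bool" where
  "pack_frame s s' \<longleftrightarrow> (\<forall>v. v \<notin> probe_vars \<union> {''x'', ''y'', ''z'', ''l''} \<longrightarrow> s' v = s v)"

lemma pack_frame_update: "v \<in> probe_vars \<union> {''x'', ''y'', ''z'', ''l''} \<Longrightarrow> pack_frame s (update s' v i y) \<longleftrightarrow> pack_frame s s'"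
  unfolding pack_frame_def update_def by (metis fun_upd_other)

lemma pack_frame_input: "pack_input s \<Longrightarrow> pack_frame s s' \<Longrightarrow> pack_input s'"
  by (simp add: pack_frame_def pack_input_def input_def probe_vars_def bfs_vars_def)

lemma pack_frame_refl: "pack_frame s s"
  by (simp add: pack_frame_def)

lemma pack_frame_trans: "pack_frame s s' \<Longrightarrow> pack_frame s' s'' \<Longrightarrow> pack_frame s s''"
  by (simp add: pack_frame_def)

lemma probe_vars_simps: "''x'' \<notin> probe_vars" "''y'' \<notin> probe_vars" "''z'' \<notin> probe_vars" "''l'' \<notin> probe_vars"
  "''m'' \<notin> probe_vars" "''h'' \<notin> probe_vars" "''lev'' \<in> probe_vars" "''col'' \<in> probe_vars" "''done'' \<in> probe_vars"
  by (auto simp: probe_vars_def bfs_vars_def)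

lemma wp_scan:
  assumes inp: "pack_input s" and x: "s ''x'' 0 = x" "x < m" and l: "s ''l'' 0 = l" and N: "n \<le> N" "m + h \<le> N"
    and I: "search_at col0 l x 0 s"
    and Q: "\<And>s'. \<lbrakk>pack_frame s s'; s' ''x'' 0 = x; s' ''l'' 0 = l; search_at col0 l (Suc x) 0 s'\<rbrakk> \<Longrightarrow> Q s'"
  shows "wp scan (Suc (for_time N (probe_time N))) Q s"
  unfolding scan_def
proof (rule wp_If)
  assume c: "bval (And (Less (Num 0) (Cell ''lev'' (var ''x''))) (Less (Cell ''lev'' (var ''x'')) (Plus (var ''l'') (Num 2)))) s"
  have xl: "x \<in> level col0 l" if "s ''done'' 0 = 0" using I x c l that by (simp add: search_inv_def)
  let ?J = "\<lambda>z s'. pack_frame s s' \<and> s' ''x'' 0 = x \<and> s' ''l'' 0 = l \<and>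
      search_at col0 l x z s' \<and> (s' ''done'' 0 = 0 \<longrightarrow> x \<in> level col0 l)"
  show "wp (For ''z'' (Plus (var ''m'') (var ''h'')) probe) (for_time N (probe_time N)) Q s"
  proof (rule wp_For[where K = "m + h" and I = ?J])
    fix z s1 assume z: "z < m + h" "s1 ''z'' 0 = z" and J: "?J z s1"
    have inp1: "pack_input s1" using pack_frame_input[OF inp] J by simp
    show "wp probe (probe_time N) (for_step ''z'' (Plus (var ''m'') (var ''h'')) (m + h) ?J z) s1"
    proof (rule wp_probe_search[OF inp1 _ x(2) _ N(1) _ z(2,1)])
      fix s' assume fr: "\<And>v. v \<notin> probe_vars \<Longrightarrow> s' v = s1 v" and at: "search_at col0 l x (Suc z) s'"
        and "s' ''done'' 0 = 0 \<Longrightarrow> x \<in> level col0 l"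
      moreover have "pack_frame s s'" using J fr by (simp add: pack_frame_def)
      moreover then have "pack_input s'" using pack_frame_input[OF inp] by simp
      ultimately show "for_step ''z'' (Plus (var ''m'') (var ''h'')) (m + h) ?J z s'"
        using J z by (simp add: for_step_def pack_frame_update probe_vars_simps pack_input_def input_def)
    qed (use J N in auto)
  next
    fix s' assume J: "?J (m + h) s'"
    have "search_at col0 l (Suc x) 0 s'"
      by (rule search_inv_cong[of col0 l "position x (m + h)" "\<lambda>w c. position x (m + h) w (c + m - 1)"])
        (use J in \<open>auto simp: position_def\<close>)
    then show "Q s'" using J by (intro Q) auto
  next
    show "?J 0 (update s ''z'' 0 0)"
      using I xl x l by (simp add: pack_frame_update pack_frame_refl)
    show "aval (Plus (var ''m'') (var ''h'')) (update s ''z'' 0 0) = m + h"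
      using inp by (simp add: pack_input_def input_def)
  qed (use N in auto)
next
  assume c: "\<not> bval (And (Less (Num 0) (Cell ''lev'' (var ''x''))) (Less (Cell ''lev'' (var ''x'')) (Plus (var ''l'') (Num 2)))) s"
  have xl: "x \<notin> level col0 l" if "s ''done'' 0 = 0" using I x c l that by (auto simp: search_inv_def)
  \<comment> \<open>As long as the search is unfinished, a skipped \<open>x\<close> is outside level
    \<open>l\<close>, so counting its pairs as examined changes nothing.\<close>
  have "search_at col0 l (Suc x) 0 s"
    by (rule search_inv_cong[OF I]) (use xl in \<open>auto simp: position_def less_Suc_eq\<close>)
  then show "wp SKIP (for_time N (probe_time N)) Q s"
    by (intro wp_SKIP Q pack_frame_refl) (use x l in auto)
qed

text \<open>The marks \<open>l + 2\<close> turn into ordinary labels of level \<open>l + 1\<close>,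
  and no edge bears the new mark \<open>l + 3\<close> yet. All colours have been tried on level
  \<open>l\<close>, so nothing there is addable.\<close>

lemma search_next_level:
  assumes I: "search_inv col0 l (position m 0) (\<lambda>w c. position m 0 w (c + m - 1)) col lev fin"
  shows "search_inv col0 (Suc l) (position 0 0) (\<lambda>w c. position 0 0 w (c + m - 1)) col lev fin"
proof (cases "fin = 0")
  case True
  have w: "w < m" if "w \<in> level col0 l" for w using that level_subset by auto
  have "\<not> addable col0 w" if "w \<in> level col0 l" for w
    using I w[OF that] that True by (auto simp: search_inv_def addable_def position_def)
  then have na: "\<forall>r<Suc l. \<forall>w\<in>level col0 r. \<not> addable col0 w"
    using I True by (auto simp: search_inv_def less_Suc_eq)
  have "lev y \<le> Suc l + 2 \<and> (0 < lev y \<and> lev y < Suc l + 2 \<longleftrightarrow> y \<in> level col0 (Suc l)) \<and> lev y \<noteq> Suc l + 2"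
    if y: "y < m" for y
  proof -
    have 1: "lev y \<le> l + 2" "0 < lev y \<and> lev y < l + 2 \<longleftrightarrow> y \<in> level col0 l"
      "lev y = l + 2 \<longleftrightarrow> y \<notin> level col0 l \<and> (\<exists>w\<in>level col0 l. exchangeable col0 w y)"
      using I y True w unfolding search_inv_def position_def by auto
    have "0 < lev y \<longleftrightarrow> y \<in> level col0 (Suc l)"
      using 1 y by (cases "lev y = l + 2") auto
    then show ?thesis using 1(1) by auto
  qed
  then show ?thesis using I True na by (simp add: search_inv_def position_def)
next
  case False
  then show ?thesis using I by (simp add: search_inv_def)
qed

text \<open>A stuck colouring is kept, so surplus iterations of \<open>pack\<close> are
  harmless.\<close>

definition improves :: "(nat \<Rightarrow> nat) \<Rightarrow> (nat \<Rightarrow> nat) \<Rightarrow> bool" where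
  "improves col col' \<longleftrightarrow> (\<exists>t x c. augments col t x c \<and> col' = col(x := c)) \<or> stuck col \<and> col' = col"

lemma wp_improve:
  assumes inp: "pack_input s" and N: "n \<le> N" "Suc m \<le> N" "m + h \<le> N"
    and Q: "\<And>s'. \<lbrakk>pack_frame s s'; improves (s ''col'') (s' ''col'')\<rbrakk> \<Longrightarrow> Q s'"
  shows "wp improve (improve_time N) Q s"
proof -
  define col0 where "col0 = s ''col''"
  let ?J = "\<lambda>l x s'. pack_frame s s' \<and> s' ''l'' 0 = l \<and> search_at col0 l x 0 s'"
  have inner: "wp (For ''x'' (var ''m'') scan) (for_time N (Suc (for_time N (probe_time N)))) Q' s1"
    if J: "?J l 0 s1" and Q': "\<And>s'. ?J l m s' \<Longrightarrow> Q' s'" for l s1 Q'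
  proof (rule wp_For[where K = m and I = "?J l"])
    show "?J l 0 (update s1 ''x'' 0 0)" using J by (simp add: pack_frame_update)
    show "aval (var ''m'') (update s1 ''x'' 0 0) = m"
      using J pack_frame_input[OF inp, of s1] by (simp add: pack_input_def input_def)
    fix x s2 assume x: "x < m" "s2 ''x'' 0 = x" and J2: "?J l x s2"
    have inp2: "pack_input s2" using J2 pack_frame_input[OF inp] by simp
    show "wp scan (Suc (for_time N (probe_time N))) (for_step ''x'' (var ''m'') m (?J l) x) s2"
    proof (rule wp_scan[OF inp2 x(2,1) _ N(1,3)])
      fix s' assume s': "pack_frame s2 s'" "s' ''x'' 0 = x" "s' ''l'' 0 = l" "search_at col0 l (Suc x) 0 s'"
      have "pack_input s'" using pack_frame_input[OF inp2 s'(1)] .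
      moreover have "pack_frame s s'" using pack_frame_trans J2 s'(1) by blast
      ultimately show "for_step ''x'' (var ''m'') m (?J l) x s'"
        using s' by (simp add: for_step_def pack_frame_update pack_input_def input_def)
    qed (use J2 in auto)
  qed (use Q' N in auto)
  let ?K = "\<lambda>l s'. pack_frame s s' \<and> search_at col0 l 0 0 s'"
  have outer: "wp (For ''l'' (Plus (var ''m'') (Num 1)) (For ''x'' (var ''m'') scan))
      (for_time N (for_time N (Suc (for_time N (probe_time N))))) Q s1"
    if J: "pack_frame s s1" "search_at col0 0 0 0 s1" for s1
  proof (rule wp_For[where K = "Suc m" and I = ?K])
    show "aval (Plus (var ''m'') (Num 1)) (update s1 ''l'' 0 0) = Suc m"
      using J pack_frame_input[OF inp, of s1] by (simp add: pack_input_def input_def)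
    fix l s2 assume l: "s2 ''l'' 0 = l" and J2: "?K l s2"
    show "wp (For ''x'' (var ''m'') scan) (for_time N (Suc (for_time N (probe_time N))))
      (for_step ''l'' (Plus (var ''m'') (Num 1)) (Suc m) ?K l) s2"
    proof (rule inner)
      show "?J l 0 s2" using J2 l by simp
      fix s' assume J': "?J l m s'"
      have "pack_input s'" using J' pack_frame_input[OF inp] by simp
      then show "for_step ''l'' (Plus (var ''m'') (Num 1)) (Suc m) ?K l s'"
        using J' search_next_level by (simp add: for_step_def pack_frame_update pack_input_def input_def)
    qed
  next
    fix s' assume J': "?K (Suc m) s'"
    then have "improves col0 (s' ''col'')"
      by (auto simp: search_inv_def improves_def stuck_iff)
    then show "Q s'" using J' by (intro Q) (auto simp: col0_def)
  qed (use J N in \<open>simp_all add: pack_frame_update\<close>)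
  let ?label = "If (Eq (Cell ''col'' (var ''y'')) (Num 0)) (Store ''lev'' (var ''y'') (Num 1)) (Store ''lev'' (var ''y'') (Num 0))"
  let ?M = "\<lambda>i s'. pack_frame s s' \<and> s' ''done'' 0 = 0 \<and> s' ''col'' = col0 \<and>
      (\<forall>y<i. s' ''lev'' y = (if col0 y = 0 then 1 else 0))"
  have label: "wp (For ''y'' (var ''m'') ?label) (for_time N 2) Q' s1"
    if s1: "pack_frame s s1" "s1 ''done'' 0 = 0" "s1 ''col'' = col0"
      and Q': "\<And>s'. pack_frame s s' \<Longrightarrow> search_at col0 0 0 0 s' \<Longrightarrow> Q' s'" for s1 Q'
  proof (rule wp_For[where K = m and I = ?M])
    show "aval (var ''m'') (update s1 ''y'' 0 0) = m"
      using s1 pack_frame_input[OF inp, of s1] by (simp add: pack_input_def input_def)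
    fix i s2 assume i: "s2 ''y'' 0 = i" "aval (var ''m'') s2 = m" and J: "?M i s2"
    show "wp ?label 2 (for_step ''y'' (var ''m'') m ?M i) s2"
      by (rule wp_straight)
        (use i J in \<open>simp_all add: for_step_def pack_frame_update probe_vars_simps less_Suc_eq\<close>)
  next
    fix s' assume J: "?M m s'"
    then show "Q' s'"
      by (intro Q') (auto simp: search_inv_def position_def colour_class_def)
  qed (use s1 N in \<open>simp_all add: pack_frame_update\<close>)
  have "wp improve (Suc (1 + Suc (for_time N 2 + for_time N (for_time N (Suc (for_time N (probe_time N))))))) Q s"
    unfolding improve_def
  proof (rule wp_Seq, rule wp_straight)
    let ?s = "exec (assign ''done'' (Num 0)) s"
    show "wp (Seq (For ''y'' (var ''m'') ?label) (For ''l'' (Plus (var ''m'') (Num 1)) (For ''x'' (var ''m'') scan)))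
      (Suc (for_time N 2 + for_time N (for_time N (Suc (for_time N (probe_time N)))))) Q ?s"
    proof (rule wp_Seq, rule label)
      show "pack_frame s ?s" by (simp add: pack_frame_update probe_vars_simps pack_frame_refl)
    qed (use outer in \<open>simp_all add: col0_def\<close>)
  qed auto
  then show ?thesis by (rule wp_mono) (auto simp: improve_time_def)
qed

text \<open>The number \<open>i\<close> of improvements is charged against the potential until the
  colouring is stuck, from where on the potential carries no information; hence the
  disjunction.\<close>

lemma improves_potential:
  assumes "valid col" "stuck col \<or> potential col + i < Suc m * Suc m" "improves col col'"
  shows "valid col' \<and> (stuck col' \<or> potential col' + Suc i < Suc m * Suc m)"
proof (cases "stuck col \<and> col' = col")
  case False
  then obtain t x c where aug: "augments col t x c" "col' = col(x := c)"
    using assms(3) by (auto simp: improves_def)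
  have ns: "\<not> stuck col" using aug(1) unfolding augments_def stuck_def addable_def by blast
  have "valid col'" using augments_valid assms(1) aug by blast
  moreover have "potential col' < potential col" if "\<not> stuck col'"
    using augments_potential assms(1) aug that by blast
  ultimately show ?thesis using assms(2) ns by fastforce
qed (use assms in auto)

lemma wp_pack:
  assumes inp: "pack_input s" and N: "n \<le> N" "Suc m \<le> N" "m + h \<le> N" and col: "s ''col'' = (\<lambda>_. 0)"
    and Q: "\<And>s'. \<lbrakk>\<And>v. v \<notin> probe_vars \<union> {''x'', ''y'', ''z'', ''l'', ''i'', ''j''} \<Longrightarrow> s' v = s v;
      valid (s' ''col''); stuck (s' ''col'')\<rbrakk> \<Longrightarrow> Q s'"
  shows "wp pack (pack_time N) Q s"
proof -
  define fr where "fr s' \<longleftrightarrow> (\<forall>v. v \<notin> probe_vars \<union> {''x'', ''y'', ''z'', ''l'', ''i'', ''j''} \<longrightarrow> s' v = s v)" for s'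
  have fr_upd: "fr (update s' v i y) \<longleftrightarrow> fr s'" if "v \<in> {''i'', ''j''}" for s' v i y
    using that unfolding fr_def update_def by (metis UnI2 fun_upd_other insertCI insertE singletonD)
  have fr_inp: "fr s' \<Longrightarrow> pack_input s'" for s'
    using inp by (simp add: fr_def pack_input_def input_def probe_vars_def bfs_vars_def)
  let ?J = "\<lambda>q s'. fr s' \<and> valid (s' ''col'') \<and> (stuck (s' ''col'') \<or> potential (s' ''col'') + q < Suc m * Suc m)"
  have inner: "wp (For ''j'' (Plus (var ''m'') (Num 1)) improve) (for_time N (improve_time N)) Q' s1"
    if J: "?J q s1" "s1 ''i'' 0 = i" and Q': "\<And>s'. ?J (q + Suc m) s' \<Longrightarrow> s' ''i'' 0 = i \<Longrightarrow> Q' s'" for q i s1 Q'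
  proof (rule wp_For[where K = "Suc m" and I = "\<lambda>j s'. ?J (q + j) s' \<and> s' ''i'' 0 = i"])
    show "aval (Plus (var ''m'') (Num 1)) (update s1 ''j'' 0 0) = Suc m"
      using J fr_inp[of s1] by (simp add: pack_input_def input_def)
    fix j s2 assume j: "s2 ''j'' 0 = j" and J2: "?J (q + j) s2 \<and> s2 ''i'' 0 = i"
    have inp2: "pack_input s2" using J2 fr_inp by simp
    show "wp improve (improve_time N) (for_step ''j'' (Plus (var ''m'') (Num 1)) (Suc m)
        (\<lambda>j s'. ?J (q + j) s' \<and> s' ''i'' 0 = i) j) s2"
    proof (rule wp_improve[OF inp2 N])
      fix s' assume s': "pack_frame s2 s'" "improves (s2 ''col'') (s' ''col'')"
      have ij: "s' ''j'' 0 = j" "s' ''i'' 0 = i" using s'(1) j J2 by (simp_all add: pack_frame_def probe_vars_def bfs_vars_def)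
      have "fr s'" using s'(1) J2 by (simp add: fr_def pack_frame_def)
      then show "for_step ''j'' (Plus (var ''m'') (Num 1)) (Suc m) (\<lambda>j s'. ?J (q + j) s' \<and> s' ''i'' 0 = i) j s'"
        using ij improves_potential[OF _ _ s'(2), of "q + j"] J2 fr_inp[of s']
        by (simp add: for_step_def fr_upd pack_input_def input_def)
    qed
  qed (use J Q' N in \<open>simp_all add: fr_upd\<close>)
  show ?thesis
    unfolding pack_def pack_time_def
  proof (rule wp_For[where K = "Suc m" and I = "\<lambda>i. ?J (i * Suc m)"])
    show "?J (0 * Suc m) (update s ''i'' 0 0)"
      using col potential_less[of "\<lambda>_. 0"]
      by (auto simp: fr_upd) (auto simp: fr_def valid_def colour_class_def forest_def)
    show "aval (Plus (var ''m'') (Num 1)) (update s ''i'' 0 0) = Suc m"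
      using inp by (simp add: pack_input_def input_def)
    fix i s1 assume i: "s1 ''i'' 0 = i" and J: "?J (i * Suc m) s1"
    show "wp (For ''j'' (Plus (var ''m'') (Num 1)) improve) (for_time N (improve_time N))
      (for_step ''i'' (Plus (var ''m'') (Num 1)) (Suc m) (\<lambda>i. ?J (i * Suc m)) i) s1"
    proof (rule inner[OF J i])
      fix s' assume J': "?J (i * Suc m + Suc m) s'" "s' ''i'' 0 = i"
      then show "for_step ''i'' (Plus (var ''m'') (Num 1)) (Suc m) (\<lambda>i. ?J (i * Suc m)) i s'"
        using fr_inp[of s'] by (simp add: for_step_def fr_upd pack_input_def input_def ac_simps)
    qed
  next
    \<comment> \<open>After \<open>(m + 1)^2\<close> improvements the inequality of the invariant is
      impossible, which leaves \<open>stuck\<close>.\<close>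
    fix s' assume "?J (Suc m * Suc m) s'"
    then show "Q s'" by (intro Q) (auto simp: fr_def)
  qed (use N in auto)
qed

end

section \<open>Sampling and output\<close>

text \<open>Appends one binary digit to \<open>r\<close> and doubles the range \<open>w\<close>.
  Clearing \<open>f\<close> makes the final state depend on the resulting label alone, not on the
  individual flips.\<close>

definition flip_step :: com where
  "flip_step = Seq (Flip ''f'' (Num 0))
    (Seq (assign ''r'' (Plus (Plus (var ''r'') (var ''r'')) (var ''f'')))
    (Seq (assign ''w'' (Plus (var ''w'') (var ''w''))) (assign ''f'' (Num 0))))"

definition sample_label :: com where
  "sample_label = Seq (Seq (assign ''w'' (Num 1)) (assign ''r'' (Num 0)))
    (Seq (While (Less (var ''w'') (var ''h'')) flip_step)
      (Seq (Store ''g'' (var ''e'') (var ''r'')) (Seq (assign ''w'' (Num 0)) (assign ''r'' (Num 0)))))"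

definition sample :: com where
  "sample = For ''e'' (var ''m'') sample_label"

definition sample_time :: "nat \<Rightarrow> nat" where
  "sample_time N = for_time N (20 + N * 10)"

lemma yields_straight: "straight p \<Longrightarrow> yields p s (cost p) (return_pmf (exec p s))"
  using wp_straight[of p "\<lambda>s'. s' = exec p s" s "cost p"] by (auto simp: wp_def)

text \<open>Splits a uniform number into its top bit and the rest, matching the order in which the
  digits are read.\<close>

lemma pmf_of_set_double:
  "pmf_of_set {..<2 ^ Suc k} =
    bind_pmf (bernoulli_pmf (1/2)) (\<lambda>b. map_pmf (\<lambda>y. (if b then 1 else 0) * 2 ^ k + y) (pmf_of_set {..<2 ^ k :: nat}))"
proof -
  let ?f = "\<lambda>(b, y). (if b then 1 else 0) * 2 ^ k + y :: nat"
  have "bij_betw ?f (UNIV \<times> {..<2 ^ k}) {..<2 ^ Suc k}"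
    by (rule bij_betwI[where g = "\<lambda>z. (2 ^ k \<le> z, if 2 ^ k \<le> z then z - 2 ^ k else z)"])
      (auto split: if_splits)
  then have "map_pmf ?f (pmf_of_set (UNIV \<times> {..<2 ^ k})) = pmf_of_set {..<2 ^ Suc k}"
    by (rule map_pmf_of_set_bij_betw) (auto simp: lessThan_empty_iff)
  moreover have "pmf_of_set (UNIV \<times> {..<2 ^ k}) = pair_pmf (bernoulli_pmf (1/2)) (pmf_of_set {..<2 ^ k :: nat})"
    unfolding bernoulli_pmf_half_conv_pmf_of_set
    by (rule pmf_eqI) (auto simp: pmf_pair lessThan_empty_iff indicator_def)
  ultimately show ?thesis
    by (simp add: pair_pmf_def map_bind_pmf map_pmf_def bind_assoc_pmf bind_return_pmf)
qed

definition put :: "state \<Rightarrow> nat \<Rightarrow> nat \<Rightarrow> state" where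
  "put s w r = update (update s ''w'' 0 w) ''r'' 0 r"

lemma yields_flip_step:
  assumes "s ''f'' 0 = 0"
  shows "yields flip_step (put s w r) 7
    (map_pmf (\<lambda>b. put s (2 * w) (2 * r + (if b then 1 else 0))) (bernoulli_pmf (1/2)))"
proof -
  let ?rest = "Seq (assign ''r'' (Plus (Plus (var ''r'') (var ''r'')) (var ''f'')))
    (Seq (assign ''w'' (Plus (var ''w'') (var ''w''))) (assign ''f'' (Num 0)))"
  let ?s = "\<lambda>b. update (put s w r) ''f'' 0 (if b then 1 else 0)"
  have "yields (Flip ''f'' (Num 0)) (put s w r) (Suc 0) (map_pmf ?s (bernoulli_pmf (1/2)))"
    using yields_Flip[of "''f''" "Num 0" "put s w r" 0] by simp
  then have "yields flip_step (put s w r) (Suc (Suc 0 + cost ?rest))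
      (bind_pmf (map_pmf ?s (bernoulli_pmf (1/2))) (\<lambda>s'. return_pmf (exec ?rest s')))"
    unfolding flip_step_def by (rule yields_Seq) (rule yields_straight, simp)
  also have "bind_pmf (map_pmf ?s (bernoulli_pmf (1/2))) (\<lambda>s'. return_pmf (exec ?rest s')) =
      map_pmf (\<lambda>b. exec ?rest (?s b)) (bernoulli_pmf (1/2))"
    by (simp only: bind_map_pmf map_pmf_def[of "\<lambda>b. exec ?rest (?s b)"] o_def)
  finally have "yields flip_step (put s w r) (Suc (Suc 0 + cost ?rest))
      (map_pmf (\<lambda>b. exec ?rest (?s b)) (bernoulli_pmf (1/2)))" .
  moreover have "exec ?rest (?s b) = put s (2 * w) (2 * r + (if b then 1 else 0))" for b
    using assms by (auto simp: put_def update_def fun_eq_iff)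
  ultimately have "yields flip_step (put s w r) (Suc (Suc 0 + cost ?rest))
    (map_pmf (\<lambda>b. put s (2 * w) (2 * r + (if b then 1 else 0))) (bernoulli_pmf (1/2)))" by (simp only:)
  then show ?thesis by (rule yields_mono) simp
qed

text \<open>Generalised to a partly read label: \<open>j\<close> digits have produced
  \<open>r\<close>, and the other \<open>k\<close> digits contribute a uniform \<open>y\<close>. The
  two bounds on \<open>h\<close> make the loop stop after exactly \<open>c\<close> digits.\<close>

lemma yields_flips:
  assumes f: "s ''f'' 0 = 0" and h: "s ''h'' 0 = h" "h \<le> 2 ^ c" "c = 0 \<or> 2 ^ c < 2 * h"
    and j: "j + k = c"
  shows "yields (While (Less (var ''w'') (var ''h'')) flip_step) (put s (2 ^ j) r) (1 + k * 10)
    (map_pmf (\<lambda>y. put s (2 ^ c) (r * 2 ^ k + y)) (pmf_of_set {..<2 ^ k}))"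
  using j
proof (induction k arbitrary: j r)
  case 0
  let ?W = "While (Less (var ''w'') (var ''h'')) flip_step"
  have "\<not> bval (Less (var ''w'') (var ''h'')) (put s (2 ^ j) r)" using 0 h by (simp add: put_def)
  then have "yields ?W (put s (2 ^ j) r) 1 (return_pmf (put s (2 ^ j) r))"
    by (simp add: yields_def bind_return_pmf)
  moreover have "{..<2 ^ 0} = {0 :: nat}" by auto
  ultimately show ?case using 0 by (simp only: pmf_of_set_singleton) simp
next
  case (Suc k)
  let ?W = "While (Less (var ''w'') (var ''h'')) flip_step"
  \<comment> \<open>A digit is missing, so \<open>2 ^ j\<close> is at most half of
    \<open>2 ^ c\<close> and thus below \<open>h\<close>.\<close>
  have "2 * 2 ^ j \<le> (2 :: nat) ^ c" using Suc.prems by (metis Suc_leI less_add_same_cancel1 one_le_numeral power_Suc power_increasing zero_less_Suc)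
  then have "bval (Less (var ''w'') (var ''h'')) (put s (2 ^ j) r)"
    using h Suc.prems by (auto simp: put_def)
  moreover have "yields (Seq flip_step ?W) (put s (2 ^ j) r) (Suc (7 + (1 + k * 10)))
     (bind_pmf (map_pmf (\<lambda>b. put s (2 * 2 ^ j) (2 * r + (if b then 1 else 0))) (bernoulli_pmf (1/2)))
       (\<lambda>s'. map_pmf (\<lambda>y. put s (2 ^ c) (s' ''r'' 0 * 2 ^ k + y)) (pmf_of_set {..<2 ^ k})))"
  proof (rule yields_Seq[OF yields_flip_step[of s, OF f]])
    fix s' assume "s' \<in> set_pmf (map_pmf (\<lambda>b. put s (2 * 2 ^ j) (2 * r + (if b then 1 else 0))) (bernoulli_pmf (1/2)))"
    then obtain b where s': "s' = put s (2 ^ Suc j) (2 * r + (if b then 1 else 0))" by auto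
    then have "s' ''r'' 0 = 2 * r + (if b then 1 else 0)" by (simp add: put_def)
    then show "yields ?W s' (1 + k * 10) (map_pmf (\<lambda>y. put s (2 ^ c) (s' ''r'' 0 * 2 ^ k + y)) (pmf_of_set {..<2 ^ k}))"
      using Suc.IH[of "Suc j" "2 * r + (if b then 1 else 0)"] Suc.prems s' by simp
  qed
  moreover have "bind_pmf (map_pmf (\<lambda>b. put s (2 * 2 ^ j) (2 * r + (if b then 1 else 0))) (bernoulli_pmf (1/2)))
       (\<lambda>s'. map_pmf (\<lambda>y. put s (2 ^ c) (s' ''r'' 0 * 2 ^ k + y)) (pmf_of_set {..<2 ^ k})) =
      map_pmf (\<lambda>y. put s (2 ^ c) (r * 2 ^ Suc k + y)) (pmf_of_set {..<2 ^ Suc k})"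
    unfolding pmf_of_set_double map_bind_pmf bind_map_pmf map_pmf_comp
    by (intro bind_pmf_cong refl map_pmf_cong) (auto simp: put_def algebra_simps)
  ultimately have "yields ?W (put s (2 ^ j) r) (Suc (Suc (7 + (1 + k * 10))))
     (map_pmf (\<lambda>y. put s (2 ^ c) (r * 2 ^ Suc k + y)) (pmf_of_set {..<2 ^ Suc k}))"
    using yields_While by metis
  then show ?case by (rule yields_mono) simp
qed

definition scratch_clear :: "state \<Rightarrow> bool" where
  "scratch_clear s \<longleftrightarrow> s ''f'' 0 = 0 \<and> s ''r'' 0 = 0 \<and> s ''w'' 0 = 0"

lemma yields_sample_label:
  assumes s: "scratch_clear s" and h: "s ''h'' 0 = h" "h \<le> 2 ^ c" "c = 0 \<or> 2 ^ c < 2 * h"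
  shows "yields sample_label s (12 + c * 10)
    (map_pmf (\<lambda>y. update s ''g'' (s ''e'' 0) y) (pmf_of_set {..<2 ^ c}))"
proof -
  let ?init = "Seq (assign ''w'' (Num 1)) (assign ''r'' (Num 0))"
  let ?fin = "Seq (Store ''g'' (var ''e'') (var ''r'')) (Seq (assign ''w'' (Num 0)) (assign ''r'' (Num 0)))"
  let ?W = "While (Less (var ''w'') (var ''h'')) flip_step"
  let ?d = "map_pmf (\<lambda>y. put s (2 ^ c) y) (pmf_of_set {..<2 ^ c})"
  have "yields ?W (put s 1 0) (1 + c * 10) ?d"
    using yields_flips[of s h c 0 c 0] s h by (simp add: scratch_clear_def)
  then have "yields (Seq ?W ?fin) (put s 1 0) (Suc ((1 + c * 10) + cost ?fin)) (bind_pmf ?d (\<lambda>s'. return_pmf (exec ?fin s')))"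
    by (rule yields_Seq) (rule yields_straight, simp)
  moreover have "exec ?init s = put s 1 0" by (simp add: put_def)
  ultimately have "yields sample_label s (Suc (cost ?init + Suc ((1 + c * 10) + cost ?fin)))
      (bind_pmf (return_pmf (exec ?init s)) (\<lambda>_. bind_pmf ?d (\<lambda>s'. return_pmf (exec ?fin s'))))"
    unfolding sample_label_def
    by - (rule yields_Seq[OF yields_straight], auto)
  also have "bind_pmf (return_pmf (exec ?init s)) (\<lambda>_. bind_pmf ?d (\<lambda>s'. return_pmf (exec ?fin s'))) =
      map_pmf (\<lambda>y. exec ?fin (put s (2 ^ c) y)) (pmf_of_set {..<2 ^ c})"
    by (simp only: bind_return_pmf bind_map_pmf map_pmf_def[of "\<lambda>y. exec ?fin (put s (2 ^ c) y)"] o_def)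
  finally have "yields sample_label s (Suc (cost ?init + Suc ((1 + c * 10) + cost ?fin)))
      (map_pmf (\<lambda>y. exec ?fin (put s (2 ^ c) y)) (pmf_of_set {..<2 ^ c}))" .
  moreover have "exec ?fin (put s (2 ^ c) y) = update s ''g'' (s ''e'' 0) y" for y
    using s by (auto simp: put_def update_def scratch_clear_def fun_eq_iff)
  ultimately have "yields sample_label s (Suc (cost ?init + Suc ((1 + c * 10) + cost ?fin)))
      (map_pmf (\<lambda>y. update s ''g'' (s ''e'' 0) y) (pmf_of_set {..<2 ^ c}))" by (simp only:)
  then show ?thesis by (rule yields_mono) simp
qed

text \<open>The state after the sampling loop as a function of the labels; the start index
  \<open>i\<close> lets an induction peel off one label at a time.\<close>

definition labelled :: "state \<Rightarrow> nat \<Rightarrow> nat \<Rightarrow> (nat \<Rightarrow> nat) \<Rightarrow> state" where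
  "labelled s i m g = (s(''g'' := (\<lambda>e. if i \<le> e \<and> e < m then g e else s ''g'' e)))(''e'' := (s ''e'')(0 := m))"

lemma yields_sample:
  assumes s: "scratch_clear s" and h: "s ''h'' 0 = h" "h \<le> 2 ^ c" "c = 0 \<or> 2 ^ c < 2 * h"
    and m: "s ''m'' 0 = m" and N: "m \<le> N" "c \<le> N"
  shows "yields sample s (sample_time N)
    (map_pmf (labelled s 0 m) (Pi_pmf {..<m} 0 (\<lambda>_. pmf_of_set {..<2 ^ c})))"
proof -
  let ?next = "assign ''e'' (Plus (var ''e'') (Num 1))"
  let ?W = "While (Less (var ''e'') (var ''m'')) (Seq sample_label ?next)"
  let ?T = "12 + c * 10"
  let ?U = "pmf_of_set {..<2 ^ c} :: nat pmf"
  have loop: "yields ?W s (1 + j * (?T + 4)) (map_pmf (labelled s i m) (Pi_pmf {i..<m} 0 (\<lambda>_. ?U)))"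
    if "i + j = m" "s ''e'' 0 = i" "scratch_clear s" "s ''h'' 0 = h" "s ''m'' 0 = m" for i j s
    using that
  proof (induction j arbitrary: i s)
    case 0
    then have "yields ?W s 1 (return_pmf s)" by (simp add: yields_def bind_return_pmf)
    moreover have "labelled s i m (\<lambda>_. 0) = s" using 0 by (auto simp: labelled_def fun_eq_iff)
    ultimately show ?case using 0 by simp
  next
    case (Suc j)
    have "yields (Seq sample_label ?next) s (Suc (?T + 1))
        (bind_pmf (map_pmf (\<lambda>y. update s ''g'' i y) ?U) (\<lambda>s'. return_pmf (exec ?next s')))"
      using yields_sample_label[OF Suc.prems(3,4) h(2,3)] Suc.prems(2)
        yields_Seq[of sample_label s ?T _ ?next 1] yields_straight[of ?next] by simp
    also have "bind_pmf (map_pmf (\<lambda>y. update s ''g'' i y) ?U) (\<lambda>s'. return_pmf (exec ?next s')) =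
        map_pmf (\<lambda>y. update (update s ''g'' i y) ''e'' 0 (Suc i)) ?U"
      using Suc.prems(2) by (simp add: bind_map_pmf) (simp add: map_pmf_def)
    finally have 1: "yields (Seq sample_label ?next) s (Suc (?T + 1))
        (map_pmf (\<lambda>y. update (update s ''g'' i y) ''e'' 0 (Suc i)) ?U)" .
    have "yields (Seq (Seq sample_label ?next) ?W) s (Suc (Suc (?T + 1) + (1 + j * (?T + 4))))
       (bind_pmf (map_pmf (\<lambda>y. update (update s ''g'' i y) ''e'' 0 (Suc i)) ?U)
         (\<lambda>s'. map_pmf (labelled s' (Suc i) m) (Pi_pmf {Suc i..<m} 0 (\<lambda>_. ?U))))"
    proof (rule yields_Seq[OF 1])
      fix s' assume "s' \<in> set_pmf (map_pmf (\<lambda>y. update (update s ''g'' i y) ''e'' 0 (Suc i)) ?U)"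
      then obtain y where s': "s' = update (update s ''g'' i y) ''e'' 0 (Suc i)" by auto
      show "yields ?W s' (1 + j * (?T + 4)) (map_pmf (labelled s' (Suc i) m) (Pi_pmf {Suc i..<m} 0 (\<lambda>_. ?U)))"
        by (rule Suc.IH) (use Suc.prems s' in \<open>auto simp: scratch_clear_def\<close>)
    qed
    also have "bind_pmf (map_pmf (\<lambda>y. update (update s ''g'' i y) ''e'' 0 (Suc i)) ?U)
         (\<lambda>s'. map_pmf (labelled s' (Suc i) m) (Pi_pmf {Suc i..<m} 0 (\<lambda>_. ?U))) =
        map_pmf (labelled s i m) (Pi_pmf {i..<m} 0 (\<lambda>_. ?U))"
    proof -
      have im: "{i..<m} = insert i {Suc i..<m}" using Suc.prems(1) by auto
      have "labelled (update (update s ''g'' i y) ''e'' 0 (Suc i)) (Suc i) m g = labelled s i m (g(i := y))" for y g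
        using Suc.prems(1) by (auto simp: labelled_def update_def fun_eq_iff)
      then show ?thesis unfolding im
        by (subst Pi_pmf_insert') (auto simp: bind_map_pmf map_bind_pmf map_pmf_def bind_assoc_pmf bind_return_pmf)
    qed
    finally have "yields (Seq (Seq sample_label ?next) ?W) s (Suc (Suc (?T + 1) + (1 + j * (?T + 4))))
        (map_pmf (labelled s i m) (Pi_pmf {i..<m} 0 (\<lambda>_. ?U)))" .
    then have "yields ?W s (Suc (Suc (Suc (?T + 1) + (1 + j * (?T + 4)))))
        (map_pmf (labelled s i m) (Pi_pmf {i..<m} 0 (\<lambda>_. ?U)))"
      using Suc.prems by (intro yields_While) auto
    then show ?case by (rule yields_mono) simp
  qed
  let ?s = "update s ''e'' 0 0"
  have "yields ?W ?s (1 + m * (?T + 4)) (map_pmf (labelled ?s 0 m) (Pi_pmf {0..<m} 0 (\<lambda>_. ?U)))"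
    by (rule loop) (use s h m in \<open>auto simp: scratch_clear_def\<close>)
  moreover have "yields (assign ''e'' (Num 0)) s 1 (return_pmf ?s)"
    using yields_straight[of "assign ''e'' (Num 0)" s] by simp
  ultimately have "yields sample s (Suc (1 + (1 + m * (?T + 4)))) (bind_pmf (return_pmf ?s)
      (\<lambda>_. map_pmf (labelled ?s 0 m) (Pi_pmf {0..<m} 0 (\<lambda>_. ?U))))"
    unfolding sample_def For_def by (intro yields_Seq) auto
  moreover have "labelled ?s 0 m = labelled s 0 m" by (auto simp: labelled_def update_def fun_eq_iff)
  ultimately have "yields sample s (Suc (1 + (1 + m * (?T + 4)))) (map_pmf (labelled s 0 m) (Pi_pmf {..<m} 0 (\<lambda>_. ?U)))"
    by (simp add: bind_return_pmf atLeast0LessThan)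
  moreover have "m * (?T + 4) \<le> N * (20 + N * 10 + 4)" using N by (intro mult_le_mono) auto
  ultimately show ?thesis by (elim yields_mono) (simp add: sample_time_def for_time_def)
qed

text \<open>A disjunction by De Morgan. Tree \<open>i\<close> has colour \<open>i + 1\<close>, since
  colour 0 means uncovered, but label \<open>i\<close>.\<close>

definition output_allowed :: bexp where
  "output_allowed = Not (And (Not (Eq (Cell ''col'' (var ''e'')) (Plus (var ''i'') (Num 1))))
     (Not (Eq (Cell ''g'' (var ''e'')) (var ''i''))))"

definition write_trees :: com where
  "write_trees = Seq (assign ''p'' (Num 0))
     (For ''i'' (var ''h'') (Seq (assign ''u'' (Num 0)) (bfs output_allowed)))"

definition output_time :: "nat \<Rightarrow> nat" where
  "output_time N = for_time N (bfs_time N + 2) + 2"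

context packing_graph
begin

text \<open>The last clause is what breadth-first search guarantees: every radius around vertex 0
  that suffices in \<open>A\<close> suffices in \<open>F\<close>. Quantifying over \<open>R\<close>
  separates the program from the random radius.\<close>

definition shallow_tree :: "nat set \<Rightarrow> nat set \<Rightarrow> bool" where
  "shallow_tree A F \<longleftrightarrow> F \<subseteq> A \<and> forest en F \<and> (\<forall>v<n. conn en F 0 v) \<and>
     (\<forall>R. (\<forall>v<n. near en A R 0 v) \<longrightarrow> (\<forall>v<n. near en F R 0 v))"

text \<open>All \<open>n\<close> vertices are reached, so exactly \<open>n - 1\<close> edges are
  written, which is the block length of the output format.\<close>

lemma bfs_post_shallow_tree:
  assumes p: "bfs_post A 0 p0 T0 d T p" and A: "A \<subseteq> {..<m}" and n: "0 < n"
    and conn: "\<And>v. v < n \<Longrightarrow> conn en A 0 v"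
  shows "p = p0 + (n - 1)" and "shallow_tree A {T (p0 + j) |j. j < n - 1}"
proof -
  have t: "tree_inv A 0 p0 d T p" using p by (simp add: bfs_post_def)
  have dv: "d v \<noteq> 0" if "v < n" for v using bfs_post_conn[OF p A n that] conn[OF that] by simp
  then have "{v. v < n \<and> d v \<noteq> 0} = {..<n}" by auto
  then show pn: "p = p0 + (n - 1)" using t unfolding tree_inv_def by auto
  have "T ` {p0..<p} = {T (p0 + j) |j. j < n - 1}"
  proof -
    have "{p0..<p} = (\<lambda>j. p0 + j) ` {..<n - 1}" unfolding pn
      by (auto simp: image_iff) (metis add_diff_inverse_nat diff_less_mono2 less_diff_conv2 not_less lessThan_iff nat_add_left_cancel_less)
    then show ?thesis by auto
  qed
  moreover have "shallow_tree A (T ` {p0..<p})"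
    unfolding shallow_tree_def
  proof (intro conjI allI impI)
    show "T ` {p0..<p} \<subseteq> A" "forest en (T ` {p0..<p})" using t by (auto simp: tree_inv_def)
    fix v assume v: "v < n"
    have path: "(adj en (T ` {p0..<p}) ^^ (d v - 1)) 0 v" using t v dv unfolding tree_inv_def by auto
    then show "conn en (T ` {p0..<p}) 0 v" by (rule relpowp_imp_rtranclp)
    fix R assume "\<forall>v<n. near en A R 0 v"
    then obtain i where i: "i \<le> R" "(adj en A ^^ i) 0 v" using v by (auto simp: near_def)
    \<comment> \<open>\<open>bfs_post\<close> speaks of walks with fewer than \<open>n\<close>
      edges; for a longer one a simple path takes its place.\<close>
    have "d v \<le> Suc R"
    proof (cases "i < n")
      case True
      then have "d v \<le> Suc i" using p v i(2) by (auto simp: bfs_post_def)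
      then show ?thesis using i by simp
    next
      case False
      obtain i' where "i' < n" "(adj en A ^^ i') 0 v"
        using conn_relpowp_less[OF conn[OF v], of "{..<n}"] A en_subset n by fastforce
      then have "d v \<le> Suc i'" using p v by (auto simp: bfs_post_def)
      then show ?thesis using False i \<open>i' < n\<close> by simp
    qed
    then show "near en (T ` {p0..<p}) R 0 v" using path unfolding near_def
      by (intro exI[of _ "d v - 1"]) auto
  qed
  ultimately show "shallow_tree A {T (p0 + j) |j. j < n - 1}" by simp
qed

definition augmented :: "(nat \<Rightarrow> nat) \<Rightarrow> (nat \<Rightarrow> nat) \<Rightarrow> nat \<Rightarrow> nat set" where
  "augmented col g i = {e. e < m \<and> (col e = Suc i \<or> g e = i)}"

lemma wp_write_trees:
  assumes inp: "pack_input s" and n: "0 < n" and N: "n \<le> N" "m \<le> N" "h \<le> N"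
    and conn: "\<And>i v. i < h \<Longrightarrow> v < n \<Longrightarrow> conn en (augmented (s ''col'') (s ''g'') i) 0 v"
    and Q: "\<And>s'. (\<And>i. i < h \<Longrightarrow> shallow_tree (augmented (s ''col'') (s ''g'') i)
        {s' ''T'' (i * (n - 1) + j) |j. j < n - 1}) \<Longrightarrow> Q s'"
  shows "wp write_trees (output_time N) Q s"
proof -
  let ?A = "augmented (s ''col'') (s ''g'')"
  define fr where "fr s' \<longleftrightarrow> pack_input s' \<and> s' ''col'' = s ''col'' \<and> s' ''g'' = s ''g''" for s'
  have fr_upd: "fr (update s' v i y) \<longleftrightarrow> fr s'" if "v \<in> {''i'', ''u'', ''p''}" for s' v i y
    using that by (auto simp: fr_def pack_input_def input_def)
  have A: "?A i \<subseteq> {..<m}" for i by (auto simp: augmented_def)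
  let ?J = "\<lambda>i s'. fr s' \<and> s' ''p'' 0 = i * (n - 1) \<and>
     (\<forall>i'<i. shallow_tree (?A i') {s' ''T'' (i' * (n - 1) + j) |j. j < n - 1})"
  let ?body = "Seq (assign ''u'' (Num 0)) (bfs output_allowed)"
  have body: "wp ?body (bfs_time N + 2) (for_step ''i'' (var ''h'') h ?J i) s1"
    if i: "i < h" "s1 ''i'' 0 = i" and J: "?J i s1" for i s1
  proof -
    let ?s = "update s1 ''u'' 0 0"
    have inp1: "pack_input s1" using J by (simp add: fr_def)
    have "wp (bfs output_allowed) (bfs_time N) (for_step ''i'' (var ''h'') h ?J i) ?s"
    proof (rule wp_bfs[where A = "?A i"])
      show "input ?s" using inp1 by (simp add: pack_input_def input_def)
      fix s' assume s': "\<And>v. v \<notin> bfs_vars \<Longrightarrow> s' v = ?s v" and e: "s' ''e'' 0 < m"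
      have "s' ''col'' = s ''col''" "s' ''g'' = s ''g''" "s' ''i'' 0 = i"
        using s' J i by (simp_all add: bfs_vars_def fr_def)
      then show "bval output_allowed s' \<longleftrightarrow> s' ''e'' 0 \<in> ?A i"
        using e by (auto simp: output_allowed_def augmented_def)
    next
      fix s' assume s': "\<And>v. v \<notin> bfs_vars \<Longrightarrow> s' v = ?s v"
        and "bfs_post (?A i) (?s ''u'' 0) (?s ''p'' 0) (?s ''T'') (s' ''d'') (s' ''T'') (s' ''p'' 0)"
      then have post: "bfs_post (?A i) 0 (i * (n - 1)) (s1 ''T'') (s' ''d'') (s' ''T'') (s' ''p'' 0)"
        using J by simp
      note B = bfs_post_shallow_tree[OF post A n conn[OF i(1)]]
      have i': "s' ''i'' 0 = i" using s' i by (simp add: bfs_vars_def)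
      have fr': "fr s'" using s' J by (simp add: bfs_vars_def fr_def pack_input_def input_def)
      have "shallow_tree (?A i') {s' ''T'' (i' * (n - 1) + j) |j. j < n - 1}" if "i' < Suc i" for i'
      proof (cases "i' = i")
        case True
        then show ?thesis using B(2) by simp
      next
        case False
        \<comment> \<open>Earlier blocks lie entirely below the position where the current search
          starts to write.\<close>
        have "s' ''T'' (i' * (n - 1) + j) = s1 ''T'' (i' * (n - 1) + j)" if "j < n - 1" for j
        proof -
          have "i' * (n - 1) + j < Suc i' * (n - 1)" using that by simp
          also have "\<dots> \<le> i * (n - 1)" using False \<open>i' < Suc i\<close> by (intro mult_le_mono1) simp
          finally show ?thesis using post by (simp add: bfs_post_def)
        qed
        then have "{s' ''T'' (i' * (n - 1) + j) |j. j < n - 1} = {s1 ''T'' (i' * (n - 1) + j) |j. j < n - 1}"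
          by auto metis+
        then show ?thesis using J False that by simp
      qed
      then show "for_step ''i'' (var ''h'') h ?J i s'"
        using i' fr' B(1) by (simp add: for_step_def fr_upd) (simp add: fr_def pack_input_def)
    qed (use A n N in auto)
    then have "wp ?body (Suc (1 + bfs_time N)) (for_step ''i'' (var ''h'') h ?J i) s1"
      by - (rule wp_Seq, rule wp_straight, auto)
    then show ?thesis by (rule wp_mono) auto
  qed
  have loop: "wp (For ''i'' (var ''h'') ?body) (for_time N (bfs_time N + 2)) Q (update s ''p'' 0 0)"
  proof (rule wp_For[where K = h and I = ?J])
    show "?J 0 (update (update s ''p'' 0 0) ''i'' 0 0)"
      using inp by (simp add: fr_upd) (simp add: fr_def)
    show "aval (var ''h'') (update (update s ''p'' 0 0) ''i'' 0 0) = h"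
      using inp by (simp add: pack_input_def)
  qed (use body Q N in auto)
  have "wp write_trees (Suc (1 + for_time N (bfs_time N + 2))) Q s"
    unfolding write_trees_def using loop by - (rule wp_Seq, rule wp_straight, auto)
  then show ?thesis by (rule wp_mono) (auto simp: output_time_def)
qed

end

section \<open>The algorithm\<close>

text \<open>With fewer than \<open>k\<close> edges in the cut, deleting them would leave no way out
  of \<open>X\<close>.\<close>

lemma edge_connected_cut:
  assumes wf: "wf_multigraph G" and con: "edge_connected k G" and k: "0 < k" and X: "X \<noteq> {}" "X \<subset> verts G"
  shows "k \<le> card {e \<in> edges G. ends G e \<inter> X \<noteq> {} \<and> ends G e \<inter> (verts G - X) \<noteq> {}}"
proof (rule ccontr)
  let ?F = "{e \<in> edges G. ends G e \<inter> X \<noteq> {} \<and> ends G e \<inter> (verts G - X) \<noteq> {}}"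
  let ?H = "G\<lparr>edges := edges G - ?F\<rparr>"
  assume "\<not> k \<le> card ?F"
  then have "card ?F \<le> k - 1" by simp
  then have H: "connected_graph ?H"
    using con[unfolded edge_connected_def, rule_format, of ?F] by auto
  obtain x y where xy: "x \<in> X" "y \<in> verts G" "y \<notin> X" using X by blast
  have "conn (ends G) (edges G - ?F) x y" using connected_graph_conn[OF H, of x y] xy X by auto
  then have "y \<in> X"
    using xy(1)
  proof (induction rule: rtranclp_induct)
    case (step v w)
    then obtain e where e: "e \<in> edges G" "e \<notin> ?F" "ends G e = {v, w}" by (auto simp: adj_def)
    moreover have "w \<in> verts G" using e wf by (auto simp: wf_multigraph_def)
    ultimately show ?case using step by auto
  qed simp
  then show False using xy by simp
qed

lemma adj_cong: "(\<And>e. e \<in> A \<Longrightarrow> en e = en' e) \<Longrightarrow> adj en A = adj en' A"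
  by (auto simp: adj_def fun_eq_iff)

lemma forest_cong:
  assumes "\<And>e. e \<in> A \<Longrightarrow> en e = en' e"
  shows "forest en A \<longleftrightarrow> forest en' A"
  using assms adj_cong[of _ en en'] unfolding forest_def by (metis DiffD1)

lemma half_le_ln:
  assumes "2 \<le> n"
  shows "1 / 2 \<le> ln (real n)"
proof -
  have "ln (1 / 2 :: real) \<le> 1 / 2 - 1" by (rule ln_le_minus_one) simp
  then have "1 / 2 \<le> ln (2 :: real)" by (simp add: ln_div)
  also have "\<dots> \<le> ln (real n)" using assms by simp
  finally show ?thesis .
qed

text \<open>Uses \<open>1 - x \<le> exp (- x)\<close>; the factor 4 in \<open>l\<close> becomes the
  exponent of \<open>n\<close>, and \<open>W \<le> k\<close> allows \<open>l\<close> to be defined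
  by \<open>k\<close>.\<close>

lemma miss_power_le:
  assumes W: "1 \<le> W" "W \<le> k" and n: "2 \<le> n" and l: "4 * real k * ln (real n) \<le> real l"
  shows "(1 - 1 / real W) ^ l \<le> 1 / real n ^ 4"
proof -
  have "(1 - 1 / real W) ^ l \<le> exp (- 1 / real W) ^ l"
    using W exp_ge_add_one_self[of "- 1 / real W"] by (intro power_mono) auto
  also have "\<dots> = exp (- (real l / real W))"
    by (simp flip: exp_of_nat_mult)
  also have "\<dots> \<le> exp (- (4 * ln (real n)))"
  proof -
    have "4 * real W * ln (real n) \<le> 4 * real k * ln (real n)"
      using W n by (intro mult_right_mono) auto
    then have "4 * ln (real n) \<le> real l / real W" using W l by (simp add: field_simps)
    then show ?thesis by simp
  qed
  also have "\<dots> = 1 / real n ^ 4"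
    using n exp_of_nat_mult[of 4 "ln (real n)"] by (simp add: exp_minus field_simps)
  finally show ?thesis .
qed

text \<open>Halving by counting, as the machine has no division; \<open>2 h + 1 < k\<close> holds
  exactly while \<open>h < k div 2\<close>.\<close>

definition count_trees :: com where
  "count_trees = For ''j'' (var ''k'') (If (Less (Plus (Plus (var ''h'') (var ''h'')) (Num 1)) (var ''k''))
     (assign ''h'' (Plus (var ''h'') (Num 1))) SKIP)"

definition program :: com where
  "program = If (Less (Num 1) (var ''n'')) (Seq count_trees (Seq pack (Seq sample write_trees))) SKIP"

definition program_time :: "nat \<Rightarrow> nat" where
  "program_time N = for_time N 2 + pack_time N + sample_time N + output_time N + 4"

lemma wp_count_trees:
  assumes "s ''h'' 0 = 0" "s ''k'' 0 = k" "k \<le> N"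
    and Q: "\<And>s'. \<lbrakk>\<And>v. v \<notin> {''h'', ''j''} \<Longrightarrow> s' v = s v; s' ''h'' 0 = k div 2\<rbrakk> \<Longrightarrow> Q s'"
  shows "wp count_trees (for_time N 2) Q s"
  unfolding count_trees_def
proof (rule wp_For[where K = k and I = "\<lambda>i s'. (\<forall>v. v \<notin> {''h'', ''j''} \<longrightarrow> s' v = s v) \<and> s' ''h'' 0 = min i (k div 2)"])
  let ?I = "\<lambda>i s'. (\<forall>v. v \<notin> {''h'', ''j''} \<longrightarrow> s' v = s v) \<and> s' ''h'' 0 = min i (k div 2)"
  fix i s' assume i: "i < k" "s' ''j'' 0 = i" and I: "?I i s'"
  have k: "s' ''k'' 0 = k" using I assms by simp
  have "Suc (2 * min i (k div 2)) < k \<longleftrightarrow> i < k div 2" using i(1) by auto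
  then show "wp (If (Less (Plus (Plus (var ''h'') (var ''h'')) (Num 1)) (var ''k'')) (assign ''h'' (Plus (var ''h'') (Num 1))) SKIP) 2
     (for_step ''j'' (var ''k'') k ?I i) s'"
    using i I k by (intro wp_straight) (auto simp: for_step_def mult_2)
qed (use assms in auto)

context packing_graph
begin

text \<open>Levels are distances from vertex 0. They are bounded by \<open>min D n\<close>, so one
  tree fails with probability at most \<open>n * n / n^4\<close>, and at most \<open>n\<close> trees
  fail with total probability at most \<open>1 / n\<close>.\<close>

lemma prob_all_near:
  assumes n: "2 \<le> n" and diam: "\<And>v. v < n \<Longrightarrow> near en {..<m} D 0 v"
    and F: "\<And>i. i < h \<Longrightarrow> F i \<subseteq> {..<m}" "\<And>i u v. i < h \<Longrightarrow> u < n \<Longrightarrow> v < n \<Longrightarrow> conn en (F i) u v"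
    and W: "1 \<le> W" "h \<le> W" "W \<le> k" and hn: "h \<le> n" and l_ge: "4 * real k * ln (real n) \<le> real l"
  shows "measure_pmf.prob (Pi_pmf {..<m} 0 (\<lambda>_. pmf_of_set {..<W}))
      {g. \<forall>i<h. \<forall>t<n. near en (F i \<union> {e \<in> {..<m}. g e = i}) (radius l (min D n)) t 0} \<ge> 1 - 1 / real n"
proof -
  let ?L = "min D n" and ?P = "measure_pmf.prob (Pi_pmf {..<m} 0 (\<lambda>_. pmf_of_set {..<W}))"
  define lvl where "lvl = edge_dist en {..<m} 0"
  define par where "par v = (SOME e. e < m \<and> (\<exists>w<n. en e = {v, w} \<and> lvl w < lvl v))" for v
  have conn: "conn en {..<m} 0 v" if "v < n" for v using near_conn[OF diam[OF that]] .
  have lvl_relpowp: "(adj en {..<m} ^^ lvl v) 0 v" if "v < n" for v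
    unfolding lvl_def using edge_dist_relpowp[OF conn[OF that]] .
  have lvl_0: "lvl v = 0 \<longleftrightarrow> v = 0" if "v < n" for v
    using lvl_relpowp[OF that] edge_dist_le[of 0 en "{..<m}" 0 0] by (auto simp: lvl_def)
  have par: "par v \<in> {..<m} \<and> (\<exists>w\<in>{..<n}. en (par v) = {v, w} \<and> lvl w < lvl v)" if v: "v < n" "v \<noteq> 0" for v
  proof -
    obtain d where d: "lvl v = Suc d" using lvl_0 v by (cases "lvl v") auto
    then obtain w where w: "(adj en {..<m} ^^ d) 0 w" "adj en {..<m} w v"
      using lvl_relpowp[OF v(1)] by (metis relpowp_Suc_E)
    then obtain e where e: "e < m" "en e = {v, w}" by (auto simp: adj_def insert_commute)
    moreover have "lvl w < lvl v" using edge_dist_le[OF w(1)] d by (simp add: lvl_def)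
    moreover have "w < n" using en_subset[OF e(1)] e(2) by auto
    ultimately have "\<exists>e. e < m \<and> (\<exists>w<n. en e = {v, w} \<and> lvl w < lvl v)" by blast
    then have "par v < m \<and> (\<exists>w<n. en (par v) = {v, w} \<and> lvl w < lvl v)" unfolding par_def by (rule someI_ex)
    then show ?thesis by auto
  qed
  have lvl_le: "lvl v \<le> ?L" if v: "v < n" for v
  proof -
    obtain i where "i \<le> D" "(adj en {..<m} ^^ i) 0 v" using diam[OF v] by (auto simp: near_def)
    then have "lvl v \<le> D" using edge_dist_le unfolding lvl_def by (meson order_trans)
    moreover obtain i where "i < card {..<n}" "(adj en {..<m} ^^ i) 0 v"
      using conn_relpowp_less[OF conn[OF v], of "{..<n}"] en_subset n by fastforce
    then have "lvl v \<le> n" using edge_dist_le[of i en "{..<m}" 0 v] by (simp add: lvl_def)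
    ultimately show ?thesis by simp
  qed
  have "0 < 4 * real k * ln (real n)" using W n by (intro mult_pos_pos) auto
  then have l1: "1 \<le> l" using l_ge by linarith
  define B where "B i = {g. \<exists>t\<in>{..<n}. \<not> near en (F i \<union> {e \<in> {..<m}. g e = i}) (radius l ?L) t 0}" for i
  have B: "?P (B i) \<le> 1 / real n ^ 2" if i: "i < h" for i
  proof -
    interpret sampled_tree en "{..<n}" "{..<m}" "F i" 0 lvl par ?L l
      by unfold_locales (use F[OF i] n lvl_0 par lvl_le l1 en_subset in \<open>simp_all\<close>)
    have "?P (B i) \<le> real ?L * real (card {..<n}) * (1 - 1 / real W) ^ l"
      unfolding B_def by (rule prob_far_le) (use i W in simp)
    also have "\<dots> \<le> real n * real n * (1 / real n ^ 4)"
      using miss_power_le[OF W(1,3) n l_ge] W by (intro mult_mono) auto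
    also have "\<dots> = 1 / real n ^ 2" using n by (simp add: field_simps eval_nat_numeral)
    finally show ?thesis .
  qed
  have "?P (\<Union>i<h. B i) \<le> (\<Sum>i<h. ?P (B i))"
    by (intro measure_pmf.finite_measure_subadditive_finite) auto
  also have "\<dots> \<le> (\<Sum>i<h. 1 / real n ^ 2)" using B by (intro sum_mono) auto
  also have "\<dots> = real h / real n ^ 2" by simp
  also have "\<dots> \<le> real n / real n ^ 2" using hn by (intro divide_right_mono) auto
  also have "\<dots> = 1 / real n" using n by (simp add: power2_eq_square)
  finally have "?P (\<Union>i<h. B i) \<le> 1 / real n" .
  moreover have "?P (- (\<Union>i<h. B i)) = 1 - ?P (\<Union>i<h. B i)"
    using measure_pmf.prob_compl[of "\<Union>i<h. B i"] by (simp add: Compl_eq_Diff_UNIV)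
  moreover have "- (\<Union>i<h. B i) = {g. \<forall>i<h. \<forall>t<n. near en (F i \<union> {e \<in> {..<m}. g e = i}) (radius l ?L) t 0}"
    by (auto simp: B_def)
  ultimately show ?thesis by simp
qed

text \<open>\<open>col\<close> is chosen before \<open>g\<close>: the packed trees do not depend on
  the labels, as the probability estimate requires.\<close>

lemma yields_program:
  assumes n: "2 \<le> n" and inp: "input s" and k: "s ''k'' 0 = k" "0 < k" "h = k div 2"
    and zero: "\<And>x. x \<in> {''h'', ''col'', ''f'', ''r'', ''w''} \<Longrightarrow> s x = (\<lambda>_. 0)"
    and N: "n \<le> N" "k \<le> N" "Suc m \<le> N" "m + h \<le> N" "c \<le> N" and c: "h \<le> 2 ^ c" "c = 0 \<or> 2 ^ c < 2 * h"
    and cut: "\<And>X. X \<noteq> {} \<Longrightarrow> X \<subset> {..<n} \<Longrightarrow> k \<le> card {e \<in> {..<m}. en e \<inter> X \<noteq> {} \<and> en e \<inter> ({..<n} - X) \<noteq> {}}"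
  shows "\<exists>col final. (\<forall>i<h. \<forall>u<n. \<forall>v<n. conn en (colour_class col (Suc i)) u v) \<and>
    yields program s (program_time N) (map_pmf final (Pi_pmf {..<m} 0 (\<lambda>_. pmf_of_set {..<2 ^ c}))) \<and>
    (\<forall>g. \<forall>i<h. shallow_tree (augmented col g i) {final g ''T'' (i * (n - 1) + j) |j. j < n - 1})"
proof -
  let ?P = "Pi_pmf {..<m} 0 (\<lambda>_. pmf_of_set {..<2 ^ c}) :: (nat \<Rightarrow> nat) pmf"
  have "wp count_trees (for_time N 2) (\<lambda>s'. (\<forall>v. v \<notin> {''h'', ''j''} \<longrightarrow> s' v = s v) \<and> s' ''h'' 0 = h) s"
    by (rule wp_count_trees) (use zero k N in auto)
  then obtain s1 where y1: "yields count_trees s (for_time N 2) (return_pmf s1)"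
    and fr1: "\<And>v. v \<notin> {''h'', ''j''} \<Longrightarrow> s1 v = s v" and h1: "s1 ''h'' 0 = h"
    by (auto simp: wp_def)
  have inp1: "pack_input s1" using inp fr1 h1 by (simp add: pack_input_def input_def)
  have "wp pack (pack_time N) (\<lambda>s'. (\<forall>v. v \<notin> probe_vars \<union> {''x'', ''y'', ''z'', ''l'', ''i'', ''j''} \<longrightarrow> s' v = s1 v) \<and>
      valid (s' ''col'') \<and> stuck (s' ''col'')) s1"
    by (rule wp_pack) (use inp1 N zero fr1 in auto)
  then obtain s2 where y2: "yields pack s1 (pack_time N) (return_pmf s2)"
    and fr2: "\<And>v. v \<notin> probe_vars \<union> {''x'', ''y'', ''z'', ''l'', ''i'', ''j''} \<Longrightarrow> s2 v = s1 v"
    and col: "valid (s2 ''col'')" "stuck (s2 ''col'')"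
    by (auto simp: wp_def)
  have inp2: "pack_input s2" using inp1 fr2 by (simp add: pack_input_def input_def probe_vars_def bfs_vars_def)
  have sc: "scratch_clear s2" using fr2 fr1 zero by (simp add: scratch_clear_def probe_vars_def bfs_vars_def)
  have tree: "conn en (colour_class (s2 ''col'') (Suc i)) u v" if "i < h" "u < n" "v < n" for i u v
    by (rule stuck_connected[OF col, of k]) (use n k cut that in auto)
  have y3: "yields sample s2 (sample_time N) (map_pmf (labelled s2 0 m) ?P)"
    by (rule yields_sample[where h = h]) (use sc inp2 c N in \<open>auto simp: pack_input_def input_def\<close>)
  have lab: "augmented (s2 ''col'') (labelled s2 0 m g ''g'') i = augmented (s2 ''col'') g i" for g i
    by (auto simp: augmented_def labelled_def)
  have "wp write_trees (output_time N) (\<lambda>s'. \<forall>i<h. shallow_tree (augmented (s2 ''col'') g i)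
        {s' ''T'' (i * (n - 1) + j) |j. j < n - 1}) (labelled s2 0 m g)" for g
  proof (rule wp_write_trees)
    show inp3: "pack_input (labelled s2 0 m g)" using inp2 by (simp add: labelled_def pack_input_def input_def)
    have col3: "labelled s2 0 m g ''col'' = s2 ''col''" by (simp add: labelled_def)
    show "conn en (augmented (labelled s2 0 m g ''col'') (labelled s2 0 m g ''g'') i) 0 v" if "i < h" "v < n" for i v
      unfolding col3 lab using n that
      by (intro conn_mono[OF tree]) (auto simp: augmented_def colour_class_def)
    fix s' assume "\<And>i. i < h \<Longrightarrow> shallow_tree (augmented (labelled s2 0 m g ''col'') (labelled s2 0 m g ''g'') i)
        {s' ''T'' (i * (n - 1) + j) |j. j < n - 1}"
    then show "\<forall>i<h. shallow_tree (augmented (s2 ''col'') g i) {s' ''T'' (i * (n - 1) + j) |j. j < n - 1}"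
      unfolding col3 lab by blast
  qed (use n N in auto)
  then have "\<forall>g. \<exists>s'. yields write_trees (labelled s2 0 m g) (output_time N) (return_pmf s') \<and>
      (\<forall>i<h. shallow_tree (augmented (s2 ''col'') g i) {s' ''T'' (i * (n - 1) + j) |j. j < n - 1})"
    by (simp add: wp_def)
  from choice[OF this] obtain final where "\<forall>g. yields write_trees (labelled s2 0 m g) (output_time N) (return_pmf (final g)) \<and>
      (\<forall>i<h. shallow_tree (augmented (s2 ''col'') g i) {final g ''T'' (i * (n - 1) + j) |j. j < n - 1})" ..
  then have final: "\<And>g. yields write_trees (labelled s2 0 m g) (output_time N) (return_pmf (final g))"
    "\<And>g i. i < h \<Longrightarrow> shallow_tree (augmented (s2 ''col'') g i) {final g ''T'' (i * (n - 1) + j) |j. j < n - 1}"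
    by blast+
  \<comment> \<open>\<open>yields_Seq\<close> needs the continuation as a function of the state, so
    \<open>g\<close> is recovered from the array; beyond \<open>m\<close> a sample has the default
    value 0.\<close>
  have restrict: "(\<lambda>e. if e < m then labelled s2 0 m g ''g'' e else 0) = g" if "g \<in> set_pmf ?P" for g
  proof -
    have "g e = 0" if "\<not> e < m" for e using set_Pi_pmf_subset[of "{..<m}"] \<open>g \<in> set_pmf ?P\<close> that by fastforce
    then show ?thesis by (auto simp: labelled_def)
  qed
  let ?final = "\<lambda>s'. final (\<lambda>e. if e < m then s' ''g'' e else 0)"
  have y4: "yields (Seq sample write_trees) s2 (Suc (sample_time N + output_time N))
      (bind_pmf (map_pmf (labelled s2 0 m) ?P) (\<lambda>s'. return_pmf (?final s')))"
    by (rule yields_Seq[OF y3]) (use restrict final(1) in auto)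
  have "bind_pmf (map_pmf (labelled s2 0 m) ?P) (\<lambda>s'. return_pmf (?final s')) =
      map_pmf (\<lambda>g. ?final (labelled s2 0 m g)) ?P"
    by (simp add: bind_map_pmf) (simp add: map_pmf_def)
  also have "\<dots> = map_pmf final ?P"
    by (intro map_pmf_cong refl) (simp add: restrict)
  finally have "yields (Seq sample write_trees) s2 (Suc (sample_time N + output_time N)) (map_pmf final ?P)"
    using y4 by simp
  then have "yields (Seq pack (Seq sample write_trees)) s1 (Suc (pack_time N + Suc (sample_time N + output_time N)))
      (bind_pmf (return_pmf s2) (\<lambda>_. map_pmf final ?P))"
    by (intro yields_Seq[OF y2]) auto
  then have "yields (Seq count_trees (Seq pack (Seq sample write_trees))) s
      (Suc (for_time N 2 + Suc (pack_time N + Suc (sample_time N + output_time N))))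
      (bind_pmf (return_pmf s1) (\<lambda>_. map_pmf final ?P))"
    by (intro yields_Seq[OF y1]) (auto simp: bind_return_pmf)
  moreover have "1 < s ''n'' 0" using inp n by (simp add: input_def)
  ultimately have "yields program s (Suc (Suc (for_time N 2 + Suc (pack_time N + Suc (sample_time N + output_time N)))))
      (map_pmf final ?P)"
    by (simp add: program_def yields_def bind_return_pmf)
  then have "yields program s (program_time N) (map_pmf final ?P)"
    by (rule yields_mono) (simp add: program_time_def)
  then show ?thesis using tree final(2) by blast
qed

end

section \<open>Polynomial running time\<close>

definition polynomial_fun :: "(nat \<Rightarrow> nat) \<Rightarrow> bool" where
  "polynomial_fun f \<longleftrightarrow> (\<exists>q. \<forall>x. f x = poly q x)"

lemma polynomial_fun_const: "polynomial_fun (\<lambda>_. c)"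
  unfolding polynomial_fun_def by (intro exI[of _ "[:c:]"]) simp

lemma polynomial_fun_id: "polynomial_fun (\<lambda>x. x)"
  unfolding polynomial_fun_def by (intro exI[of _ "[:0, 1:]"]) simp

lemma polynomial_fun_add: "polynomial_fun f \<Longrightarrow> polynomial_fun g \<Longrightarrow> polynomial_fun (\<lambda>x. f x + g x)"
  unfolding polynomial_fun_def by (metis poly_add)

lemma polynomial_fun_mult: "polynomial_fun f \<Longrightarrow> polynomial_fun g \<Longrightarrow> polynomial_fun (\<lambda>x. f x * g x)"
  unfolding polynomial_fun_def by (metis poly_mult)

lemmas polynomial_fun_intros =
  polynomial_fun_const polynomial_fun_id polynomial_fun_add polynomial_fun_mult

text \<open>\<open>2 * x + 2\<close> is the loop bound \<open>N\<close> at input size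
  \<open>x\<close>.\<close>

lemma polynomial_program_time: "polynomial_fun (\<lambda>x. program_time (2 * x + 2))"
  unfolding program_time_def pack_time_def improve_time_def probe_time_def sample_time_def output_time_def
    bfs_time_def for_time_def Suc_eq_plus1
  by (intro polynomial_fun_intros)

text \<open>\<open>bit_length\<close> is at least 1, even at 0, so every edge contributes to the
  size.\<close>

lemma length_le_input_size: "length es \<le> input_size D n k es"
proof -
  have "length es \<le> (\<Sum>(u, v)\<leftarrow>es. bit_length u + bit_length v)"
    by (induction es) (auto simp: bit_length_def)
  then show ?thesis by (simp add: input_size_def)
qed

lemma ex_power_of_two: "\<exists>c. h \<le> 2 ^ c \<and> (c = 0 \<or> 2 ^ c < 2 * h) \<and> c \<le> h" for h :: nat
proof (induction h)
  case 0
  then show ?case by (intro exI[of _ 0]) auto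
next
  case (Suc h)
  then obtain c where c: "h \<le> 2 ^ c" "c = 0 \<or> 2 ^ c < 2 * h" "c \<le> h" by blast
  show ?case
  proof (cases "Suc h \<le> 2 ^ c")
    case True
    then show ?thesis using c by (intro exI[of _ c]) auto
  next
    case False
    then have "h = 2 ^ c" using c by simp
    then show ?thesis using c by (intro exI[of _ "Suc c"]) auto
  qed
qed

context packing_graph
begin

lemma shallow_tree_spanning:
  assumes G: "verts G = {..<n}" "edges G = {..<m}" "\<And>e. e < m \<Longrightarrow> ends G e = en e" and n: "0 < n"
    and F: "shallow_tree A F" and A: "A \<subseteq> {..<m}"
  shows "spanning_tree G F"
    and "(\<And>v. v < n \<Longrightarrow> near en F R 0 v) \<Longrightarrow> graph_diameter (spanning_subgraph G F) \<le> 2 * R"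
proof -
  have Fm: "F \<subseteq> {..<m}" using F A by (auto simp: shallow_tree_def)
  have eq: "ends G e = en e" if "e \<in> F" for e using G(3) Fm that by auto
  have adj: "adj (ends G) F = adj en F" using eq by (rule adj_cong)
  have sub: "ends G e \<subseteq> {..<n}" if "e \<in> F" for e using eq[OF that] en_subset Fm that by auto
  have "conn (ends G) F u v" if "u < n" "v < n" for u v
  proof -
    have "conn en F 0 u" "conn en F 0 v" using F that by (auto simp: shallow_tree_def)
    then show ?thesis unfolding adj by (meson conn_sym rtranclp_trans)
  qed
  then have "connected_graph (spanning_subgraph G F)"
    using n sub G by (intro conn_connected_graph) auto
  moreover have "forest (ends G) F" using F forest_cong[of F "ends G" en, OF eq] by (simp add: shallow_tree_def)
  then have "\<nexists>vs es. is_cycle (spanning_subgraph G F) vs es"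
    using forest_acyclic[of "spanning_subgraph G F"] by simp
  ultimately show "spanning_tree G F" using Fm G by (simp add: spanning_tree_def)
  assume R: "\<And>v. v < n \<Longrightarrow> near en F R 0 v"
  show "graph_diameter (spanning_subgraph G F) \<le> 2 * R"
  proof (rule graph_diameter_le)
    fix u v assume "u \<in> verts (spanning_subgraph G F)" "v \<in> verts (spanning_subgraph G F)"
    then have "near en F (R + R) u v" using near_trans[OF near_sym[OF R] R] G by simp
    then show "\<exists>i\<le>2 * R. (adj (ends (spanning_subgraph G F)) (edges (spanning_subgraph G F)) ^^ i) u v"
      unfolding near_def by (simp add: adj mult_2)
  qed (use G n sub in auto)
qed

lemma shallow_tree_near_n:
  assumes "shallow_tree A F" "A \<subseteq> {..<m}" "v < n"
  shows "near en F n 0 v"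
proof -
  have "F \<subseteq> {..<m}" "conn en F 0 v" using assms by (auto simp: shallow_tree_def)
  then obtain i where "i < n" "(adj en F ^^ i) 0 v"
    using conn_relpowp_less[of en F 0 v "{..<n}"] en_subset assms(3) by fastforce
  then show ?thesis unfolding near_def by (intro exI[of _ i]) auto
qed

end

text \<open>With \<open>x = k ln n\<close> the growth factor \<open>2 l + 1\<close> is at most
  \<open>8 x + 3\<close>, and \<open>x \<ge> 1/2\<close> turns this into \<open>14 x\<close>, well
  below \<open>101 x\<close>. The base exceeds 1, so \<open>L\<close> may be raised to
  \<open>D\<close>.\<close>

lemma radius_le_real:
  assumes n: "2 \<le> n" and k: "1 \<le> k" and L: "L \<le> D" and l: "l = nat \<lceil>4 * real k * ln (real n)\<rceil>"
  shows "real (radius l L) \<le> (101 * real k * ln (real n)) ^ D"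
proof -
  have kn: "1 / 2 \<le> real k * ln (real n)"
    using mult_mono[of 1 "real k" "1 / 2" "ln (real n)"] half_le_ln[OF n] k by simp
  then have "0 < 4 * real k * ln (real n)" by simp
  then have l': "1 \<le> l" "real l \<le> 4 * real k * ln (real n) + 1" unfolding l by linarith+
  have "real (radius l L) \<le> real ((2 * l + 1) ^ L)"
    using radius_le[OF l'(1), of L] by linarith
  also have "\<dots> \<le> (101 * real k * ln (real n)) ^ L"
    unfolding of_nat_power using l' kn by (intro power_mono) auto
  also have "\<dots> \<le> (101 * real k * ln (real n)) ^ D" using kn L by (intro power_increasing) auto
  finally show ?thesis .
qed

theorem theorem1p1:
  "\<exists>(prog :: com) (time :: nat poly) (c :: nat) (C :: real). c \<ge> 1 \<and>
    (\<forall>(D :: nat) (n :: nat) (k :: nat) (es :: (nat \<times> nat) list).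
      D > 0 \<and> n > 0 \<and> k > 0 \<and> wf_multigraph (graph_of n es) \<and>
      edge_connected k (graph_of n es) \<and> graph_diameter (graph_of n es) \<le> D \<longrightarrow>
      (let G = graph_of n es;
           R = run (poly time (input_size D n k es)) prog (input_state D n k es)
       in (\<forall>(p, s)\<in>set_pmf R. p = SKIP \<and>
             (\<forall>i<k div 2. spanning_tree G (output_tree n s i)) \<and>
             (\<forall>e\<in>edges G. card {i. i < k div 2 \<and> e \<in> output_tree n s i} \<le> 2)) \<and>
          measure_pmf.prob R
             {(p, s). \<forall>i<k div 2.
                real (graph_diameter (spanning_subgraph G (output_tree n s i)))
                  \<le> C * (101 * real k * ln (real n)) ^ D}
            \<ge> 1 - 1 / real n ^ c))"
proof -
  obtain time :: "nat poly" where time: "\<And>x. poly time x = program_time (2 * x + 2)"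
    using polynomial_program_time unfolding polynomial_fun_def by metis
  show ?thesis
  \<comment> \<open>The constant 2 comes from passing through the root: a radius bounds half the
    diameter. The exponent of the failure probability is 1.\<close>
  proof (intro exI[of _ program] exI[of _ time] exI[of _ "1 :: nat"] exI[of _ "2 :: real"] conjI allI impI, goal_cases)
    case (2 D n k es)
    then have D: "0 < D" and n0: "0 < n" and k: "0 < k" and wf: "wf_multigraph (graph_of n es)"
      and con: "edge_connected k (graph_of n es)" and diam: "graph_diameter (graph_of n es) \<le> D" by auto
    define G where "G = graph_of n es"
    define R where "R = run (poly time (input_size D n k es)) program (input_state D n k es)"
    define m where "m = length es"
    define h where "h = k div 2"
    have G: "verts G = {..<n}" "edges G = {..<m}" "ends G = (\<lambda>e. {fst (es ! e), snd (es ! e)})"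
      by (auto simp: G_def graph_of_def m_def)
    have "(\<forall>(p, s)\<in>set_pmf R. p = SKIP \<and>
             (\<forall>i<h. spanning_tree G (output_tree n s i)) \<and>
             (\<forall>e\<in>edges G. card {i. i < h \<and> e \<in> output_tree n s i} \<le> 2)) \<and>
          measure_pmf.prob R
             {(p, s). \<forall>i<h.
                real (graph_diameter (spanning_subgraph G (output_tree n s i)))
                  \<le> 2 * (101 * real k * ln (real n)) ^ D}
            \<ge> 1 - 1 / real n ^ 1"
    \<comment> \<open>For one vertex the demanded probability is 0, and the empty edge set written
      by doing nothing is a spanning tree.\<close>
    proof (cases "n = 1")
      case True
      have "\<not> 1 < input_state D n k es ''n'' 0" using True by (simp add: input_state_def array_def)
      then have "yields program (input_state D n k es) 1 (return_pmf (input_state D n k es))"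
        by (simp add: program_def yields_def bind_return_pmf)
      then have "yields program (input_state D n k es) (poly time (input_size D n k es)) (return_pmf (input_state D n k es))"
        by (rule yields_mono) (simp add: time program_time_def)
      then have R: "R = return_pmf (SKIP, input_state D n k es)" by (simp add: R_def yields_def)
      have out: "output_tree n s i = {}" for s i using True by (simp add: output_tree_def)
      have "connected_graph (spanning_subgraph G {})"
        by (rule conn_connected_graph) (use True G in auto)
      moreover have "\<not> is_cycle (spanning_subgraph G {}) vs fs" for vs fs
        by (rule forest_acyclic) (simp add: forest_def)
      ultimately have "spanning_tree G {}" by (simp add: spanning_tree_def)
      moreover have "1 - 1 / real n ^ 1 \<le> 0" using True by simp
      then have "1 - 1 / real n ^ 1 \<le> measure_pmf.prob R Z" for Z
        using measure_nonneg order_trans by blast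
      ultimately show ?thesis by (simp add: R out)
    next
      case False
      then have n: "2 \<le> n" using n0 by simp
      define a where "a = array (map fst es)"
      define b where "b = array (map snd es)"
      have ab: "e < m \<Longrightarrow> a e = fst (es ! e)" "e < m \<Longrightarrow> b e = snd (es ! e)" for e
        by (auto simp: a_def b_def array_def m_def)
      interpret packing_graph n m a b h
      proof
        fix e assume e: "e < m"
        then have "ends G e \<subseteq> {..<n}"
          using wf G unfolding wf_multigraph_def G_def[symmetric] by auto
        then show "a e < n" "b e < n" using ab[OF e] G(3) by auto
      qed
      have ends: "ends G e = en e" if "e < m" for e using ab[OF that] G(3) by (simp add: en_def)
      have cut: "k \<le> card {e \<in> {..<m}. en e \<inter> X \<noteq> {} \<and> en e \<inter> ({..<n} - X) \<noteq> {}}"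
        if "X \<noteq> {}" "X \<subset> {..<n}" for X
      proof -
        have eq: "{e \<in> edges G. ends G e \<inter> X \<noteq> {} \<and> ends G e \<inter> (verts G - X) \<noteq> {}} =
            {e \<in> {..<m}. en e \<inter> X \<noteq> {} \<and> en e \<inter> ({..<n} - X) \<noteq> {}}"
          using G(1,2) ends by auto
        have "X \<subset> verts G" using that(2) G(1) by simp
        then show ?thesis
          unfolding eq[symmetric] by (rule edge_connected_cut[OF wf[folded G_def] con[folded G_def] k that(1)])
      qed
      have single: "{v} \<subset> {..<n}" if "v < n" for v
      proof (rule psubsetI)
        show "{v} \<noteq> {..<n}"
        proof
          assume "{v} = {..<n}"
          then have "card {v} = card {..<n}" by (rule arg_cong)
          then show False using n by simp
        qed
      qed (use that in simp)
      \<comment> \<open>The cut around vertex 0 has at least \<open>k\<close> edges, so a loop up to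
        \<open>k\<close> is polynomial although \<open>k\<close> is given in binary.\<close>
      have km: "k \<le> m"
      proof -
        have "k \<le> card {e \<in> {..<m}. en e \<inter> {0} \<noteq> {} \<and> en e \<inter> ({..<n} - {0}) \<noteq> {}}"
          by (intro cut single) (use n0 in auto)
        also have "\<dots> \<le> card {..<m}" by (intro card_mono) auto
        finally show ?thesis by simp
      qed
      \<comment> \<open>Every vertex is an end of some edge, so \<open>n\<close> too is bounded by
        the length of the edge list.\<close>
      have nm: "n \<le> 2 * m"
      proof -
        have "v \<in> (\<Union>e\<in>{..<m}. en e)" if "v < n" for v
        proof -
          have "0 < card {e \<in> {..<m}. en e \<inter> {v} \<noteq> {} \<and> en e \<inter> ({..<n} - {v}) \<noteq> {}}"
            using cut[OF _ single[OF that]] k by (meson insert_not_empty less_le_trans)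
          then have "{e \<in> {..<m}. en e \<inter> {v} \<noteq> {} \<and> en e \<inter> ({..<n} - {v}) \<noteq> {}} \<noteq> {}"
            by (metis card.empty less_irrefl)
          then show ?thesis by auto
        qed
        then have "card {..<n} \<le> card (\<Union>e\<in>{..<m}. en e)"
          by (intro card_mono) (auto simp: en_def)
        also have "\<dots> \<le> (\<Sum>e\<in>{..<m}. card (en e))" by (rule card_UN_le) simp
        also have "\<dots> \<le> (\<Sum>e\<in>{..<m}. 2)" by (intro sum_mono) (auto simp: en_def card_insert_if)
        finally show ?thesis by simp
      qed
      define N where "N = 2 * input_size D n k es + 2"
      have mN: "m \<le> input_size D n k es" unfolding m_def by (rule length_le_input_size)
      obtain c where c: "h \<le> 2 ^ c" "c = 0 \<or> 2 ^ c < 2 * h" "c \<le> h" using ex_power_of_two by blast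
      let ?W = "2 ^ c :: nat"
      let ?P = "Pi_pmf {..<m} 0 (\<lambda>_. pmf_of_set {..<?W}) :: (nat \<Rightarrow> nat) pmf"
      \<comment> \<open>Either \<open>W = 1\<close>, or \<open>W < 2 h \<le> k\<close>.\<close>
      have Wk: "?W \<le> k" using c(2) k by (auto simp: h_def)
      have "\<exists>col final. (\<forall>i<h. \<forall>u<n. \<forall>v<n. conn en (colour_class col (Suc i)) u v) \<and>
        yields program (input_state D n k es) (program_time N) (map_pmf final ?P) \<and>
        (\<forall>g. \<forall>i<h. shallow_tree (augmented col g i) {final g ''T'' (i * (n - 1) + j) |j. j < n - 1})"
      proof (rule yields_program[OF n _ _ k h_def _ _ _ _ _ _ c(1,2) cut])
        show "input (input_state D n k es)"
          unfolding input_def by (simp add: input_state_def a_def b_def m_def) (simp add: array_def)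
        show "input_state D n k es ''k'' 0 = k" by (simp add: input_state_def array_def)
        show "input_state D n k es x = (\<lambda>_. 0)" if "x \<in> {''h'', ''col'', ''f'', ''r'', ''w''}" for x
          using that by (auto simp: input_state_def)
        show "n \<le> N" "k \<le> N" "Suc m \<le> N" "m + h \<le> N" "c \<le> N"
          using mN nm km c(3) by (auto simp: N_def h_def)
      qed
      then obtain col final where 1: "\<forall>i<h. \<forall>u<n. \<forall>v<n. conn en (colour_class col (Suc i)) u v"
        and y: "yields program (input_state D n k es) (program_time N) (map_pmf final ?P)"
        and 2: "\<forall>g. \<forall>i<h. shallow_tree (augmented col g i) {final g ''T'' (i * (n - 1) + j) |j. j < n - 1}"
        by (elim exE conjE)
      from 1 have trees: "\<And>i u v. i < h \<Longrightarrow> u < n \<Longrightarrow> v < n \<Longrightarrow> conn en (colour_class col (Suc i)) u v" by blast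
      from 2 have final: "\<And>g i. i < h \<Longrightarrow> shallow_tree (augmented col g i) {final g ''T'' (i * (n - 1) + j) |j. j < n - 1}"
        by blast
      have R: "R = map_pmf (\<lambda>g. (SKIP, final g)) ?P"
        using y by (simp add: R_def yields_def time N_def map_pmf_comp)
      have out: "shallow_tree (augmented col g i) (output_tree n (final g) i)" if "i < h" for g i
        using final[OF that] by (simp add: output_tree_def)
      have aug: "augmented col g i \<subseteq> {..<m}" for g i by (auto simp: augmented_def)
      note tree = shallow_tree_spanning[OF G(1,2) ends n0 out aug]
      have congestion: "card {i. i < h \<and> e \<in> output_tree n (final g) i} \<le> 2" for g e
      proof -
        \<comment> \<open>Only the tree of its colour and the tree of its label can contain
          \<open>e\<close>; for colour 0 the truncated \<open>col e - 1\<close> merely enlarges the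
          superset.\<close>
        have "{i. i < h \<and> e \<in> output_tree n (final g) i} \<subseteq> {col e - 1, g e}"
          using out by (fastforce simp: shallow_tree_def augmented_def)
        then have "card {i. i < h \<and> e \<in> output_tree n (final g) i} \<le> card {col e - 1, g e}"
          by (intro card_mono) auto
        also have "\<dots> \<le> 2" by (simp add: card_insert_if)
        finally show ?thesis .
      qed
      let ?good = "\<lambda>g. \<forall>i<h. real (graph_diameter (spanning_subgraph G (output_tree n (final g) i)))
                  \<le> 2 * (101 * real k * ln (real n)) ^ D"
      have "measure_pmf.prob ?P {g. ?good g} \<ge> 1 - 1 / real n"
      \<comment> \<open>Here there may be too many trees for the union bound, but the trivial
        diameter bound \<open>2 n\<close> suffices; \<open>D > 0\<close> is used for the
        power.\<close>
      proof (cases "n \<le> k")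
        case True
        have "real n \<le> 101 * real k * ln (real n)"
        proof -
          have "real k * (1 / 2) \<le> real k * ln (real n)" using half_le_ln[OF n] by (intro mult_left_mono) auto
          then show ?thesis using True by linarith
        qed
        also have "\<dots> \<le> (101 * real k * ln (real n)) ^ D"
          using calculation n D by (intro self_le_power) auto
        finally have big: "real n \<le> (101 * real k * ln (real n)) ^ D" .
        have "?good g" for g
        proof (intro allI impI)
          fix i assume i: "i < h"
          have "graph_diameter (spanning_subgraph G (output_tree n (final g) i)) \<le> 2 * n"
            using tree(2)[OF _ i, of g n] shallow_tree_near_n[OF out[OF i] aug] by simp
          then show "real (graph_diameter (spanning_subgraph G (output_tree n (final g) i)))
                  \<le> 2 * (101 * real k * ln (real n)) ^ D" using big by linarith
        qed
        then have "{g. ?good g} = UNIV" by auto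
        then show ?thesis by simp
      next
        case False
        define l where "l = nat \<lceil>4 * real k * ln (real n)\<rceil>"
        let ?r = "radius l (min D n)"
        have con0: "connected_graph G"
        proof -
          have "connected_graph (G\<lparr>edges := edges G - {}\<rparr>)"
            using con[folded G_def, unfolded edge_connected_def, rule_format, of "{}"] by simp
          then show ?thesis by simp
        qed
        have dist: "near en {..<m} D 0 v" if v: "v < n" for v
        proof -
          have "adj (ends G) (edges G) = adj en {..<m}" 
            unfolding G(2) by (rule adj_cong) (use ends in simp)
          moreover obtain i where "i \<le> graph_diameter G" "(adj (ends G) (edges G) ^^ i) 0 v"
            using relpowp_le_graph_diameter[OF con0, of 0 v] G(1) n0 v by auto
          moreover have "graph_diameter G \<le> D" using diam by (simp add: G_def)
          ultimately show ?thesis unfolding near_def by (intro exI[of _ i]) simp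
        qed
        let ?near = "{g. \<forall>i<h. \<forall>t<n. near en (colour_class col (Suc i) \<union> {e \<in> {..<m}. g e = i}) ?r t 0}"
        \<comment> \<open>Now \<open>k < n\<close>, hence \<open>h \<le> n\<close>, as the union
          bound over the trees requires.\<close>
        have near: "1 - 1 / real n \<le> measure_pmf.prob ?P ?near"
        proof (rule prob_all_near[OF n dist])
          show "4 * real k * ln (real n) \<le> real l" unfolding l_def by linarith
        qed (use trees c Wk False k in \<open>auto simp: colour_class_def h_def\<close>)
        have "?near \<subseteq> {g. ?good g}"
        proof (intro subsetI CollectI allI impI)
          fix g i assume g: "g \<in> ?near" and i: "i < h"
          have eq: "colour_class col (Suc i) \<union> {e \<in> {..<m}. g e = i} = augmented col g i"
            by (auto simp: colour_class_def augmented_def)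
          have "\<forall>v<n. near en (augmented col g i) ?r 0 v"
          proof (intro allI impI)
            fix v assume "v < n"
            then have "near en (colour_class col (Suc i) \<union> {e \<in> {..<m}. g e = i}) ?r v 0"
              using g i by blast
            then show "near en (augmented col g i) ?r 0 v" unfolding eq by (rule near_sym)
          qed
          then have "\<forall>v<n. near en (output_tree n (final g) i) ?r 0 v"
            using out[OF i, of g] unfolding shallow_tree_def by blast
          then have "graph_diameter (spanning_subgraph G (output_tree n (final g) i)) \<le> 2 * ?r"
            using tree(2)[OF _ i, of g ?r] by simp
          moreover have "real ?r \<le> (101 * real k * ln (real n)) ^ D"
            using n k by (intro radius_le_real) (auto simp: l_def)
          ultimately show "real (graph_diameter (spanning_subgraph G (output_tree n (final g) i)))
                  \<le> 2 * (101 * real k * ln (real n)) ^ D" by linarith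
        qed
        then have "measure_pmf.prob ?P ?near \<le> measure_pmf.prob ?P {g. ?good g}"
          by (intro measure_pmf.finite_measure_mono) auto
        with near show ?thesis by (rule order_trans)
      qed
      then show ?thesis using tree(1) congestion by (auto simp: R vimage_def)
    qed
    then show ?case by (simp add: Let_def G_def R_def h_def)
  qed simp
qed

end
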